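(* For every integer $k \geq 1$, $gr_k(K_3 : C_8) = 3k+5$.
   Context: An edge-coloring of a graph is called rainbow if no two edges receive the same color. For graphs $G$ and $H$ and a positive integer $k$, the Gallai-Ramsey number $gr_k(G : H)$ is the minimum integer $N$ such that for every integer $n \geq N$, every coloring of the edges of the complete graph $K_n$ using at most $k$ colors contains either a rainbow copy of $G$ or a monochromatic copy of $H$. Here $K_3$ is the triangle and $C_8$ is the cycle on $8$ vertices. *)

theory Defs
  imports Main
begin

text \<open>A (simple) graph is given by a vertex count m (vertices 0..m-1) and a set of
  edges, each edge being a 2-element subset of the vertex set.\<close>

definition K_edges :: "nat \<Rightarrow> nat set set" where
  "K_edges n = {e. e \<subseteq> {..<n} \<and> card e = 2}"

definition k_coloring :: "nat \<Rightarrow> nat \<Rightarrow> (nat set \<Rightarrow> nat) \<Rightarrow> bool" where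
  "k_coloring n k c \<longleftrightarrow> (\<forall>e\<in>K_edges n. c e < k)"

definition rainbow_copy :: "nat \<Rightarrow> (nat set \<Rightarrow> nat) \<Rightarrow> nat \<Rightarrow> nat set set \<Rightarrow> bool" where
  "rainbow_copy n c m E \<longleftrightarrow>
     (\<exists>f. inj_on f {..<m} \<and> f ` {..<m} \<subseteq> {..<n} \<and> inj_on (\<lambda>e. c (f ` e)) E)"

definition mono_copy :: "nat \<Rightarrow> (nat set \<Rightarrow> nat) \<Rightarrow> nat \<Rightarrow> nat set set \<Rightarrow> bool" where
  "mono_copy n c m E \<longleftrightarrow>
     (\<exists>f col. inj_on f {..<m} \<and> f ` {..<m} \<subseteq> {..<n} \<and> (\<forall>e\<in>E. c (f ` e) = col))"

definition gallai_ramsey :: "nat \<Rightarrow> nat \<Rightarrow> nat set set \<Rightarrow> nat \<Rightarrow> nat set set \<Rightarrow> nat" where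
  "gallai_ramsey k mG EG mH EH =
     (LEAST N. \<forall>n\<ge>N. \<forall>c. k_coloring n k c \<longrightarrow>
        rainbow_copy n c mG EG \<or> mono_copy n c mH EH)"

definition triangle_edges :: "nat set set" where
  "triangle_edges = K_edges 3"

definition cycle_edges :: "nat \<Rightarrow> nat set set" where
  "cycle_edges m = {{i, (i + 1) mod m} | i. i < m}"

end

theory Submission
  imports Defs
begin

text \<open>
  \<^bold>\<open>Upper bound.\<close>  Suppose that a rainbow-triangle-free coloring of \<open>3k + 5\<close> vertices has no
  monochromatic \<open>C\<^sub>8\<close>, and let \<open>T\<close> be a smallest set of at least four vertices that every outside vertex
  sees in a single color.  As there is no monochromatic \<open>K\<^sub>4\<^sub>,\<^sub>4\<close>, each color is used by at most three
  outside vertices.  By Gallai's theorem two colors, red and blue, can be chosen such that the graph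
  of all other colors is disconnected on \<open>T\<close>.  Its components are again seen in a single color by the
  rest of \<open>T\<close>, so by minimality they have at most three vertices.  Together with the outside vertices
  that see \<open>T\<close> in red or blue, \<open>T\<close> has at least 11 vertices.  Hence everything reduces to a finite
  statement: if the pairs of an 11-set are colored red or blue, except inside classes of at most
  three twins, then there is a monochromatic \<open>C\<^sub>8\<close>.

  The finite statement generalizes \<open>R(C\<^sub>8, C\<^sub>8) = 11\<close>.  It is derived by case distinctions, where each
  partial coloring (pattern) that has been refuted is reused up to permutations of the vertices and
  exchange of the two colors; the patterns culminate in a cycle \<open>C\<^sub>7\<close>, then in shorter and shorter
  monochromatic paths.  The case distinctions were found by a computer search.

  \<^bold>\<open>Lower bound.\<close>  Color the pair \<open>u < v\<close> of vertices below \<open>3k + 4\<close> by \<open>(v - 4) div 3\<close>: color \<open>0\<close> is a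
  complete graph on seven vertices, and every other color is covered by three vertices.\<close>

section \<open>Refutations of partial colorings of the complete graph on 11 vertices\<close>

datatype clr = Red | Blue | Unc

fun swap :: "clr \<Rightarrow> clr" where
  "swap Red = Blue"
| "swap Blue = Red"
| "swap Unc = Unc"

text \<open>Only the values of \<open>col\<close> at increasing pairs count, so that every function
  is a coloring and symmetry comes for free.\<close>

definition ecol :: "(nat \<Rightarrow> nat \<Rightarrow> clr) \<Rightarrow> nat \<Rightarrow> nat \<Rightarrow> clr" where
  "ecol col a b = (if a < b then col a b else col b a)"

lemma ecol_commute: "ecol col a b = ecol col b a"
  by (cases a b rule: linorder_cases) (auto simp: ecol_def)

definition verts :: "nat list \<Rightarrow> bool" where
  "verts w \<longleftrightarrow> distinct w \<and> (\<forall>x\<in>set w. x < 11)"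

text \<open>
  A hypothetical counterexample on the vertices \<open>0, \<dots>, 10\<close>.  \<open>Unc\<close> marks the pairs of twins,
  whose own color is irrelevant; the classes of mutual twins have at most three elements.\<close>

definition good :: "(nat \<Rightarrow> nat \<Rightarrow> clr) \<Rightarrow> bool" where
  "good col \<longleftrightarrow>
     (\<forall>a b x. verts [a, b, x] \<longrightarrow> ecol col a b = Unc \<longrightarrow> ecol col a x = ecol col b x) \<and>
     (\<forall>a b x y. verts [a, b, x, y] \<longrightarrow>
        \<not> (ecol col a b = Unc \<and> ecol col a x = Unc \<and> ecol col a y = Unc)) \<and>
     (\<forall>w s. verts w \<longrightarrow> length w = 8 \<longrightarrow> s \<noteq> Unc \<longrightarrow> \<not> successively (\<lambda>a b. ecol col a b = s) (w @ [hd w]))"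

lemma goodD:
  assumes "good col"
  shows good_twin: "verts [a, b, x] \<Longrightarrow> ecol col a b = Unc \<Longrightarrow> ecol col a x = ecol col b x"
    and good_star: "verts [a, b, x, y] \<Longrightarrow> ecol col a b = Unc \<Longrightarrow> ecol col a x = Unc \<Longrightarrow> ecol col a y \<noteq> Unc"
    and good_cycle: "verts w \<Longrightarrow> length w = 8 \<Longrightarrow> s \<noteq> Unc \<Longrightarrow> \<not> successively (\<lambda>a b. ecol col a b = s) (w @ [hd w])"
  using assms unfolding good_def by blast+

text \<open>A pattern lists monochromatic walks.\<close>

type_synonym pattern = "(clr \<times> nat list) list"

fun holds :: "(nat \<Rightarrow> nat \<Rightarrow> clr) \<Rightarrow> pattern \<Rightarrow> bool" where
  "holds col [] \<longleftrightarrow> True"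
| "holds col ((s, w) # p) \<longleftrightarrow> successively (\<lambda>a b. ecol col a b = s) w \<and> holds col p"

text \<open>The list \<open>g\<close> holds the images of the vertices 0 to 10. The result is again
  an explicit pattern, so that it can be compared literally with the colors known in a
  branch.\<close>

fun inst :: "(clr \<Rightarrow> clr) \<Rightarrow> nat list \<Rightarrow> pattern \<Rightarrow> pattern" where
  "inst \<sigma> g [] = []"
| "inst \<sigma> g ((s, w) # p) = (\<sigma> s, map (nth g) w) # inst \<sigma> g p"

definition unsat :: "pattern \<Rightarrow> bool" where
  "unsat p \<longleftrightarrow> (\<forall>col. good col \<longrightarrow> \<not> holds col p)"

text \<open>
  Refutations of a pattern: branch on the color of a pair (\<open>Br\<close>), transfer a color to a twin (\<open>Tw\<close>),
  or stop at a monochromatic cycle (\<open>Cy\<close>), at a clash between twins (\<open>Cl\<close>), at four mutual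
  twins (\<open>St\<close>), or at an image of a refuted pattern under a permutation of the vertices (\<open>Us\<close>),
  possibly with the colors swapped (\<open>Sw\<close>).\<close>

datatype refutation =
    Br nat nat refutation refutation refutation
  | Tw nat nat nat refutation
  | Cy clr "nat list"
  | Cl nat nat nat
  | St nat nat nat nat
  | Us pattern "nat list"
  | Sw pattern "nat list"

text \<open>Stated about the coloring itself: the premise of each implication becomes a rewrite rule
  inside its branch, so the colors found on the way down need no bookkeeping.\<close>

fun closed :: "(nat \<Rightarrow> nat \<Rightarrow> clr) \<Rightarrow> refutation \<Rightarrow> bool" where
  "closed col (Br a b t u v) \<longleftrightarrow>
     (ecol col a b = Red \<longrightarrow> closed col t) \<and> (ecol col a b = Blue \<longrightarrow> closed col u) \<and>
     (ecol col a b = Unc \<longrightarrow> closed col v)"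
| "closed col (Tw a x b t) \<longleftrightarrow>
     verts [a, x, b] \<and> ecol col a x = Unc \<and> (ecol col a b = ecol col x b \<longrightarrow> closed col t)"
| "closed col (Cy s w) \<longleftrightarrow> s \<noteq> Unc \<and> length w = 8 \<and> verts w \<and> successively (\<lambda>a b. ecol col a b = s) (w @ [hd w])"
| "closed col (Cl a b x) \<longleftrightarrow> verts [a, b, x] \<and> ecol col a b = Unc \<and> ecol col a x \<noteq> ecol col b x"
| "closed col (St a b x y) \<longleftrightarrow>
     verts [a, b, x, y] \<and> ecol col a b = Unc \<and> ecol col a x = Unc \<and> ecol col a y = Unc"
| "closed col (Us p g) \<longleftrightarrow> unsat p \<and> length g = 11 \<and> verts g \<and> holds col (inst id g p)"
| "closed col (Sw p g) \<longleftrightarrow> unsat p \<and> length g = 11 \<and> verts g \<and> holds col (inst swap g p)"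

section \<open>Soundness of refutations\<close>

lemma swap_swap [simp]: "swap (swap s) = s"
  by (cases s) auto

text \<open>The coloring as seen through the relabelling. It reduces the use of an image of a
  refuted pattern to the refuted pattern itself.\<close>

definition pull :: "(clr \<Rightarrow> clr) \<Rightarrow> nat list \<Rightarrow> (nat \<Rightarrow> nat \<Rightarrow> clr) \<Rightarrow> nat \<Rightarrow> nat \<Rightarrow> clr" where
  "pull \<sigma> g col a b = \<sigma> (ecol col (g ! a) (g ! b))"

lemma ecol_pull: "ecol (pull \<sigma> g col) a b = \<sigma> (ecol col (g ! a) (g ! b))"
  by (simp add: ecol_def[of "pull \<sigma> g col"] pull_def ecol_commute)

lemma successively_pull:
  assumes "\<And>s. \<sigma> (\<sigma> s) = s"
  shows "successively (\<lambda>a b. ecol col a b = \<sigma> s) (map (nth g) w) \<longleftrightarrow>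
    successively (\<lambda>a b. ecol (pull \<sigma> g col) a b = s) w"
proof -
  have "x = \<sigma> s \<longleftrightarrow> \<sigma> x = s" for x using assms by metis
  thus ?thesis by (simp add: successively_map ecol_pull)
qed

lemma holds_inst:
  assumes "\<And>s. \<sigma> (\<sigma> s) = s"
  shows "holds col (inst \<sigma> g p) \<longleftrightarrow> holds (pull \<sigma> g col) p"
  by (induction p) (auto simp: successively_pull[OF assms])

lemma verts_map_nth:
  assumes "verts g" "length g = 11" "verts w"
  shows "verts (map (nth g) w)"
  using assms unfolding verts_def
  by (auto simp: distinct_map inj_on_def nth_eq_iff_index_eq)

text \<open>A permutation of the vertices carries 8-cycles, twins and twin classes to objects of the
  same kind. Only Red and Blue may be exchanged, hence the condition that \<open>\<sigma>\<close>
  preserves \<open>Unc\<close>.\<close>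

lemma good_pull:
  assumes "good col" "verts g" "length g = 11" "\<And>s. \<sigma> (\<sigma> s) = s" "\<And>s. \<sigma> s = Unc \<longleftrightarrow> s = Unc"
  shows "good (pull \<sigma> g col)"
  unfolding good_def ecol_pull assms(5)
proof (intro conjI allI impI notI)
  fix a b x assume "verts [a, b, x]" "ecol col (g ! a) (g ! b) = Unc"
  thus "\<sigma> (ecol col (g ! a) (g ! x)) = \<sigma> (ecol col (g ! b) (g ! x))"
    using good_twin[OF assms(1), of "g ! a" "g ! b" "g ! x"] verts_map_nth[OF assms(2,3), of "[a,b,x]"] by simp
next
  fix a b x y assume "verts [a, b, x, y]"
    "ecol col (g ! a) (g ! b) = Unc \<and> ecol col (g ! a) (g ! x) = Unc \<and> ecol col (g ! a) (g ! y) = Unc"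
  thus False
    using good_star[OF assms(1), of "g ! a" "g ! b" "g ! x" "g ! y"] verts_map_nth[OF assms(2,3), of "[a,b,x,y]"] by simp
next
  fix w s assume w: "verts w" "length w = 8" "s \<noteq> Unc" "successively (\<lambda>a b. \<sigma> (ecol col (g ! a) (g ! b)) = s) (w @ [hd w])"
  have "successively (\<lambda>a b. ecol col a b = \<sigma> s) (map (nth g) w @ [hd (map (nth g) w)])"
    using w(2,4) successively_pull[OF assms(4), of col s g "w @ [hd w]", unfolded ecol_pull] by (cases w) auto
  thus False
    using good_cycle[OF assms(1) verts_map_nth[OF assms(2,3) w(1)], of "\<sigma> s"] w(2,3) assms(5) by simp
qed

text \<open>Every leaf exhibits a configuration that \<open>good\<close> forbids, or an image of a
  refuted pattern, and one of the three branches always applies.\<close>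

lemma not_closed:
  assumes "good col"
  shows "\<not> closed col t"
proof (induction t)
  case (Br a b t u v)
  thus ?case by (cases "ecol col a b") auto
next
  case (Tw a x b t)
  thus ?case using good_twin[OF assms] by auto
next
  case (Cy s w)
  thus ?case using good_cycle[OF assms] by auto
next
  case (Cl a b x)
  thus ?case using good_twin[OF assms] by auto
next
  case (St a b x y)
  thus ?case using good_star[OF assms] by auto
next
  case (Us p g)
  thus ?case using good_pull[OF assms, of g id] by (auto simp: holds_inst unsat_def)
next
  case (Sw p g)
  have "swap s = Unc \<longleftrightarrow> s = Unc" for s by (cases s) auto
  thus ?case using good_pull[OF assms, of g swap] by (auto simp: holds_inst unsat_def)
qed

lemma unsatI:
  assumes "\<And>col. holds col p \<Longrightarrow> closed col t"
  shows "unsat p"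
  using assms not_closed unfolding unsat_def by blast

text \<open>
  Congruences that unfold a pattern constant below \<open>inst\<close> and \<open>holds\<close>, while \<open>unsat\<close> keeps it folded.\<close>

lemma inst_cong: "p = q \<Longrightarrow> inst \<sigma> g p = inst \<sigma> g q"
  and holds_cong: "p = q \<Longrightarrow> holds col p = holds col q"
  by simp_all

text \<open>One rewrite per lookup in a literal list, instead of a recursion on the index.\<close>

lemma nth_literal:
  "(a#xs)!0 = a" "(a#b#xs)!1 = b" "(a#b#c#xs)!2 = c" "(a#b#c#d#xs)!3 = d" "(a#b#c#d#e#xs)!4 = e"
  "(a#b#c#d#e#f#xs)!5 = f" "(a#b#c#d#e#f#g#xs)!6 = g" "(a#b#c#d#e#f#g#h#xs)!7 = h"
  "(a#b#c#d#e#f#g#h#i#xs)!8 = i" "(a#b#c#d#e#f#g#h#i#j#xs)!9 = j" "(a#b#c#d#e#f#g#h#i#j#k#xs)!10 = k"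
  by simp_all

lemma length_literal: "length [a,b,c,d,e,f,g,h] = 8" "length [a,b,c,d,e,f,g,h,i,j,k] = 11"
  by simp_all

text \<open>Grows with each pattern: its unfolding below \<open>inst\<close> and
  \<open>holds\<close>, and its refutation, which later trees cite at \<open>Us\<close> and
  \<open>Sw\<close>.\<close>

named_theorems known

text \<open>The fixed part of the rewrite set that evaluates a tree: \<open>closed\<close>, walks,
  list lookups, distinctness, and comparisons of numerals and of colors.\<close>

lemmas check = closed.simps successively.simps holds.simps inst.simps swap.simps ecol_def verts_def
  list.map nth_literal length_literal id_apply append.simps list.sel distinct.simps list.set
  empty_iff insert_iff ball_simps clr.distinct clr.distinct[symmetric] rel_simps HOL.simp_thms
  if_True if_False zero_neq_numeral numeral_neq_zero one_eq_numeral_iff numeral_eq_one_iff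
  zero_neq_one one_neq_zero zero_less_numeral zero_less_one not_less_zero

section \<open>The finite case analysis\<close>

definition "p1 = ([(Red,[2,1,0,3,6,2,5,4,6,9,5]), (Red,[4,8]), (Blue,[1,5,6,7,3,2,0,4])] :: pattern)"
lemmas [known] = p1_def[THEN inst_cong] p1_def[THEN holds_cong]
text \<open>In all trees the three subtrees of \<open>Br a b\<close> belong to Red, Blue and
  \<open>Unc\<close> in this order.\<close>

lemma [known]: "unsat p1"
  by (rule unsatI[where t = "
    Br 0 8 (Cy Red [4,8,0,1,2,5,9,6]) (Br 1 8 (Cy Red [4,8,1,0,3,6,2,5]) (Cy Blue [0,8,1,5,6,7,3,2])
    (Cl 1 8 0)) (Cl 8 0 4)"])
    (simp only: check known cong: imp_cong)

definition "p2 = ([(Red,[3,1,0,4,7,2,1,5,7,3,6,2,8]), (Red,[5,6]), (Blue,[0,2,4,3,0,5,4]), (Unc,[2,3,5,2])] :: pattern)"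
lemmas [known] = p2_def[THEN inst_cong] p2_def[THEN holds_cong]
lemma [known]: "unsat p2"
  by (rule unsatI[where t = "
    Br 0 8 (Cy Red [2,8,0,1,3,6,5,7]) (Br 1 8 (Cy Red [2,8,1,0,4,7,3,6]) (Br 3 8 (Br 0 6 (Cy Red
    [3,8,2,1,0,6,5,7]) (Br 1 6 (Cy Red [3,8,2,6,1,0,4,7]) (Br 6 4 (Cy Red [3,8,2,1,5,6,4,7]) (Br 6 7
    (Cy Red [3,8,2,1,0,4,7,6]) (Br 4 8 (Cy Red [2,8,4,7,3,1,5,6]) (Br 7 8 (Cy Red [2,8,7,4,0,1,3,6])
    (Br 5 10 (Us p1 [0,1,2,4,5,6,7,8,10,3,9]) (Br 2 10 (Us p1 [0,1,3,4,2,6,7,8,10,5,9]) (Cy Blue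
    [5,10,2,0,6,1,8,4]) (St 2 3 5 10)) (St 5 2 3 10)) (Cl 7 8 4)) (Cl 8 4 2)) (Cl 7 6 4)) (Cl 6 4 2))
    (Cl 1 6 0)) (Cl 6 0 5)) (Cl 2 3 8) (St 3 2 5 8)) (Cl 1 8 0)) (Cl 8 0 2)"])
    (simp only: check known cong: imp_cong)

definition "p3 = ([(Red,[0,1,2,7,3,8,4,0,6]), (Red,[1,3]), (Red,[2,8]), (Red,[5,7]),
    (Blue,[0,2,4,3,0,5,9,3,10,5,4]), (Blue,[6,2,9])] :: pattern)"
lemmas [known] = p3_def[THEN inst_cong] p3_def[THEN holds_cong]
lemma [known]: "unsat p3"
  by (rule unsatI[where t = "
    Br 1 6 (Cy Red [0,6,1,2,7,3,8,4]) (Br 1 4 (Br 1 9 (Br 7 6 (Cy Red [0,6,7,2,1,3,8,4]) (Br 0 7 (Br 4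
    6 (Cy Red [0,6,4,8,2,7,3,1]) (Br 9 6 (Cy Red [0,7,2,8,3,1,9,6]) (Cy Blue [4,6,9,2,0,3,10,5]) (Cl 9
    6 1)) (Cl 4 6 1)) (Cy Blue [7,6,2,4,3,9,5,0]) (Cl 7 0 5)) (Cl 7 6 2)) (Cy Blue [1,6,2,0,3,4,5,9])
    (Cl 1 9 2)) (Cy Blue [1,6,2,0,3,9,5,4]) (Cl 1 4 2)) (Cl 1 6 2)"])
    (simp only: check known cong: imp_cong)

definition "p4 = ([(Red,[1,0,4,8,2,1,3,7,2]), (Red,[3,8]), (Red,[5,7]), (Blue,[4,2,0,3,4,5,0,6,2,9,3,10,5,9])] :: pattern)"
lemmas [known] = p4_def[THEN inst_cong] p4_def[THEN holds_cong]
lemma [known]: "unsat p4"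
  by (rule unsatI[where t = "
    Br 4 6 (Us p3 [4,8,2,3,0,5,6,7,1,9,10]) (Cy Blue [0,6,4,2,9,3,10,5]) (Cl 4 6 0)"])
    (simp only: check known cong: imp_cong)

text \<open>A red \<open>C7\<close> 4-2-0-1-3-5-6, where 3, 6 and the outside vertex 7 are mutual
  twins.\<close>

definition "p5 = ([(Red,[4,2,0,1,3,5,6,4,7,5]), (Unc,[3,6,7])] :: pattern)"
lemmas [known] = p5_def[THEN inst_cong] p5_def[THEN holds_cong]
lemma [known]: "unsat p5"
  by (rule unsatI[where t = "
    Tw 6 3 1 (Br 0 6 (Cy Red [1,6,0,2,4,7,5,3]) (Br 0 3 (Cy Red [1,6,5,7,4,2,0,3]) (Br 0 7 (Cy Red
    [1,6,4,2,0,7,5,3]) (Tw 7 6 1 (Br 3 7 (Cy Red [4,6,5,7,3,1,0,2]) (Cl 6 3 7) (Tw 3 6 4 (Br 3 2 (Cy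
    Red [1,6,4,7,5,3,2,0]) (Br 7 2 (Cy Red [4,6,5,3,1,0,2,7]) (Br 2 6 (Cy Red [4,6,2,0,1,3,5,7]) (Br 3
    9 (Us p2 [0,1,3,7,2,6,5,4,9,8,10]) (Br 3 8 (Us p2 [0,1,3,7,2,6,5,4,8,9,10]) (Br 7 8 (Us p2
    [0,1,7,3,2,6,5,4,8,9,10]) (Br 7 10 (Us p2 [0,1,7,3,2,6,5,4,10,8,9]) (Br 6 8 (Us p2
    [0,1,6,3,2,7,5,4,8,9,10]) (Br 6 10 (Us p2 [0,1,6,3,2,7,5,4,10,8,9]) (Br 0 9 (Us p3
    [0,1,3,7,2,6,9,5,4,8,10]) (Us p4 [0,1,3,7,2,6,9,5,4,8,10]) (Br 2 9 (Us p3
    [2,4,3,7,0,6,9,5,1,8,10]) (Us p4 [2,4,3,7,0,6,9,5,1,8,10]) (Cl 9 0 2))) (St 6 3 7 10)) (St 6 3 7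
    8)) (St 7 3 6 10)) (St 7 3 6 8)) (St 3 7 6 8)) (St 3 7 6 9)) (St 6 3 7 2)) (Cl 2 7 0)) (Cl 2 3
    0))))) (Cl 7 0 6)) (Cl 3 0 6)) (St 6 3 0 7))"])
    (simp only: check known cong: imp_cong)

definition "p6 = ([(Red,[5,8,2,9,3,0,1,6,8,4,9]), (Blue,[0,2,3,5,0,4,6,5,1,7]), (Blue,[2,6]), (Blue,[3,4]),
    (Unc,[4,2,5])] :: pattern)"
lemmas [known] = p6_def[THEN inst_cong] p6_def[THEN holds_cong]
lemma [known]: "unsat p6"
  by (rule unsatI[where t = "
    Br 0 7 (Br 6 7 (Br 1 8 (Cy Red [6,7,0,3,9,2,8,1]) (Br 8 3 (Br 1 3 (Cy Red [6,7,0,1,3,9,2,8]) (Br 2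
    7 (Cy Red [0,7,2,9,4,8,6,1]) (Cy Blue [1,3,4,0,5,6,2,7]) (St 2 5 4 7)) (Cl 3 1 8)) (Cy Blue
    [1,8,3,2,0,4,6,5]) (Cl 8 3 2)) (Cl 8 1 5)) (Cy Blue [1,7,6,2,0,4,3,5]) (Cl 6 7 1)) (Cy Blue
    [1,7,0,2,6,4,3,5]) (Cl 0 7 1)"])
    (simp only: check known cong: imp_cong)

definition "p7 = ([(Red,[0,1,6,8,2,9,4,8,5,9,3,0]), (Blue,[0,2,1,4,0,5,3,2,6,4,3]), (Blue,[1,5,6]), (Unc,[4,2,5]),
    (Unc,[1,7])] :: pattern)"
lemmas [known] = p7_def[THEN inst_cong] p7_def[THEN holds_cong]
lemma [known]: "unsat p7"
  by (rule unsatI[where t = "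
    Br 0 7 (Tw 7 1 6 (Br 1 8 (Cy Red [6,7,0,3,9,2,8,1]) (Br 8 7 (Cy Red [6,7,8,2,9,3,0,1]) (Br 2 7 (Cl
    7 1 2) (Cy Blue [8,7,2,0,4,6,5,1]) (St 2 5 4 7)) (Us p5 [9,2,3,8,0,6,7,1,4,5,10])) (Cl 8 1 5)))
    (Us p6 [1,0,2,6,4,5,3,7,9,8,10]) (Cl 7 1 0)"])
    (simp only: check known cong: imp_cong)

definition "p8 = ([(Red,[6,2,0,1,3,7,4,6,5,7]), (Blue,[2,4,3,5,2]), (Unc,[5,4,8])] :: pattern)"
lemmas [known] = p8_def[THEN inst_cong] p8_def[THEN holds_cong]
lemma [known]: "unsat p8"
  by (rule unsatI[where t = "
    Tw 8 4 3 (Tw 8 4 7 (Br 1 8 (Us p5 [0,1,2,8,6,7,4,5,3,9,10]) (Tw 4 8 1 (Tw 5 4 1 (Tw 8 4 6 (Br 0 5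
    (Us p5 [1,0,3,5,7,6,4,8,2,9,10]) (Tw 4 5 0 (Br 0 8 (Us p5 [1,0,3,8,7,6,4,5,2,9,10]) (Tw 8 4 2 (Br
    1 9 (Br 0 9 (Cy Red [1,9,0,2,6,4,7,3]) (Us p6 [1,0,4,3,5,8,2,9,6,7,10]) (Us p7
    [1,0,4,3,5,8,2,9,6,7,10])) (Us p6 [0,1,4,2,5,8,3,9,7,6,10]) (Us p7 [0,1,4,2,5,8,3,9,7,6,10]))) (Cl
    0 8 1))) (Cl 0 5 2))))) (Cl 1 8 3)))"])
    (simp only: check known cong: imp_cong)

definition "p9 = ([(Red,[0,1,4,7,3,0,2,6,3,8,5,6]), (Red,[5,7]), (Blue,[2,3,4,5,2])] :: pattern)"
lemmas [known] = p9_def[THEN inst_cong] p9_def[THEN holds_cong]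
lemma [known]: "unsat p9"
  by (rule unsatI[where t = "
    Br 0 4 (Cy Red [3,8,5,7,4,0,2,6]) (Br 1 5 (Cy Red [0,3,7,4,1,5,6,2]) (Br 1 7 (Cy Red
    [3,8,5,7,1,0,2,6]) (Br 1 8 (Cy Red [5,8,1,0,2,6,3,7]) (Br 0 8 (Cy Red [5,8,0,1,4,7,3,6]) (Br 4 6
    (Cy Red [0,3,8,5,7,4,6,2]) (Br 0 6 (Cy Red [3,8,5,7,4,1,0,6]) (Cy Blue [4,6,0,8,1,5,2,3]) (Tw 6 0
    1 (Br 0 7 (Cy Red [1,6,5,8,3,0,7,4]) (Br 4 8 (Cy Red [0,3,7,4,8,5,6,2]) (Cy Blue
    [0,7,1,5,2,3,4,8]) (Cl 8 4 5)) (Cl 7 0 4)))) (Cl 6 4 3)) (Cl 0 8 1)) (Cl 8 1 5)) (Cl 7 1 5)) (Cl 1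
    5 4)) (Cl 0 4 3)"])
    (simp only: check known cong: imp_cong)

definition "p10 = ([(Red,[6,2,0,1,3,7,4,6,5,7]), (Red,[4,8]), (Blue,[2,4,3,5,2]), (Unc,[4,5])] :: pattern)"
lemmas [known] = p10_def[THEN inst_cong] p10_def[THEN holds_cong]
lemma [known]: "unsat p10"
  by (rule unsatI[where t = "
    Br 5 8 (Br 0 5 (Us p9 [0,1,2,5,3,4,6,7,8,9,10]) (Br 0 6 (Cy Red [5,8,4,7,3,1,0,6]) (Br 0 8 (Cy Red
    [4,8,0,1,3,7,5,6]) (Br 1 4 (Us p9 [1,0,3,4,2,5,7,6,8,9,10]) (Br 1 7 (Cy Red [5,8,4,7,1,0,2,6]) (Br
    1 5 (Us p9 [1,0,3,5,2,4,7,6,8,9,10]) (Br 1 8 (Cy Red [4,8,1,0,2,6,5,7]) (Br 3 6 (Br 0 3 (Cy Red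
    [5,8,4,7,3,0,2,6]) (Br 0 7 (Cy Red [3,6,4,8,5,7,0,1]) (Br 3 8 (Br 7 6 (Cy Red [3,8,4,7,6,2,0,1])
    (Cy Blue [0,3,4,2,5,1,7,6]) (Br 7 8 (Cy Red [4,8,7,3,1,0,2,6]) (Cy Blue [0,3,4,2,5,1,7,8]) (Us p5
    [0,2,1,6,3,4,7,8,5,9,10]))) (Cy Blue [0,7,1,4,2,5,3,8]) (Cl 8 3 4)) (Cl 7 0 5)) (Cl 3 0 6)) (Cy
    Blue [1,8,0,6,3,4,2,5]) (Cl 6 3 5)) (Cl 1 8 0)) (Cl 1 5 3)) (Cl 7 1 4)) (Cl 1 4 3)) (Cl 8 0 5))
    (Cl 6 0 5)) (Cl 0 5 2)) (Cl 4 5 8) (Us p8 [0,1,2,3,5,4,6,7,8,9,10])"])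
    (simp only: check known cong: imp_cong)

definition "p11 = ([(Red,[2,5,7,6,4,1,0,3]), (Unc,[0,2])] :: pattern)"
lemmas [known] = p11_def[THEN inst_cong] p11_def[THEN holds_cong]
text \<open>The red pair of 0 and the end 3 passes to the twin 2 of 0, which is the other end of the
  path on eight vertices. This closes the path to a \<open>C8\<close>.\<close>

lemma [known]: "unsat p11"
  by (rule unsatI[where t = "
    Tw 2 0 3 (Cy Red [1,4,6,7,5,2,3,0])"])
    (simp only: check known cong: imp_cong)

definition "p12 = ([(Red,[4,1,0,3,7,4,6,2,1,5,6,10]), (Red,[5,7]), (Blue,[8,4,9,5,2,3,5,10]), (Blue,[0,2])] :: pattern)"
lemmas [known] = p12_def[THEN inst_cong] p12_def[THEN holds_cong]
lemma [known]: "unsat p12"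
  by (rule unsatI[where t = "
    Br 0 10 (Cy Red [6,10,0,3,7,4,1,2]) (Br 3 10 (Cy Red [6,10,3,0,1,4,7,5]) (Br 0 8 (Br 2 8 (Cy Red
    [0,8,2,6,4,7,5,1]) (Cy Blue [3,10,0,2,8,4,9,5]) (Sw p11 [2,0,8,3,10,4,5,9,1,6,7])) (Cy Blue
    [3,10,0,8,4,9,5,2]) (Sw p11 [0,2,8,10,3,4,5,9,1,6,7])) (Us p11 [3,7,10,0,4,6,1,2,5,8,9])) (Us p11
    [0,1,10,3,4,6,7,5,2,8,9])"])
    (simp only: check known cong: imp_cong)

definition "p13 = ([(Red,[1,0,2,6,4,1,3,7,5,6]), (Red,[4,7]), (Blue,[3,5,2,4,8,5,9,4,10,5]), (Unc,[4,5])] :: pattern)"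
lemmas [known] = p13_def[THEN inst_cong] p13_def[THEN holds_cong]
lemma [known]: "unsat p13"
  by (rule unsatI[where t = "
    Br 0 4 (Cy Red [1,4,0,2,6,5,7,3]) (Tw 5 4 1 (Br 0 3 (Cy Red [1,4,7,5,6,2,0,3]) (Br 3 2 (Cy Red
    [1,4,6,5,7,3,2,0]) (Br 7 9 (Us p12 [0,1,3,2,4,5,7,6,8,10,9]) (Br 7 8 (Us p12
    [0,1,3,2,4,5,7,6,9,10,8]) (Cy Blue [7,9,4,0,3,2,5,8]) (Cl 7 8 4)) (Cl 7 9 4)) (Us p11
    [2,6,3,0,4,1,7,5,8,9,10])) (Us p11 [0,1,3,2,4,7,6,5,8,9,10]))) (Cl 0 4 2)"])
    (simp only: check known cong: imp_cong)

definition "p14 = ([(Red,[0,1,5,6,2,7,3,0]), (Blue,[1,4,0,2,3]), (Blue,[8,2,9]), (Unc,[3,9])] :: pattern)"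
lemmas [known] = p14_def[THEN inst_cong] p14_def[THEN holds_cong]
lemma [known]: "unsat p14"
  by (rule unsatI[where t = "
    Tw 9 3 0 (Tw 9 3 7 (Br 1 3 (Cy Red [7,9,0,3,1,5,6,2]) (Br 1 9 (Us p11 [3,7,9,0,2,1,6,5,4,8,10])
    (Br 3 8 (Us p10 [6,5,2,1,3,9,7,0,8,4,10]) (Br 3 10 (Us p10 [6,5,2,1,3,9,7,0,10,4,8]) (Sw p11
    [3,8,9,10,2,1,0,4,5,6,7]) (Us p8 [6,5,2,1,3,9,7,0,10,4,8])) (Us p8 [6,5,2,1,3,9,7,0,8,4,10])) (Us
    p5 [6,5,2,1,7,0,9,3,4,8,10])) (Us p5 [6,5,2,1,7,0,3,9,4,8,10])))"])
    (simp only: check known cong: imp_cong)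

definition "p15 = ([(Red,[3,0,1,5,7,2,8,3,9]), (Blue,[2,0,4,1,6,5,2,9]), (Blue,[4,8])] :: pattern)"
lemmas [known] = p15_def[THEN inst_cong] p15_def[THEN holds_cong]
lemma [known]: "unsat p15"
  by (rule unsatI[where t = "
    Br 8 9 (Cy Red [3,9,8,2,7,5,1,0]) (Br 0 9 (Cy Red [3,9,0,1,5,7,2,8]) (Cy Blue [8,9,0,2,5,6,1,4])
    (Sw p11 [9,2,0,8,5,4,6,1,3,7,10])) (Cl 8 9 2)"])
    (simp only: check known cong: imp_cong)

definition "p16 = ([(Red,[3,0,1,5,6,2,7,3,10]), (Blue,[2,0,4,1,2,3,4,5,2,8,4,10,2,9])] :: pattern)"
lemmas [known] = p16_def[THEN inst_cong] p16_def[THEN holds_cong]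
lemma [known]: "unsat p16"
  by (rule unsatI[where t = "
    Br 7 10 (Cy Red [3,10,7,2,6,5,1,0]) (Br 1 10 (Br 0 5 (Cy Red [1,10,3,7,2,6,5,0]) (Br 0 7 (Cy Red
    [1,10,3,0,7,2,6,5]) (Br 5 3 (Br 5 8 (Br 1 8 (Cy Red [5,8,1,0,3,7,2,6]) (Cy Blue
    [0,7,10,2,1,8,4,5]) (Br 1 6 (Us p11 [1,6,8,0,2,5,7,3,4,9,10]) (Sw p11 [1,2,8,6,0,4,7,10,3,5,9])
    (Cl 6 1 2))) (Cy Blue [0,7,10,2,1,4,8,5]) (Us p14 [1,0,2,5,4,3,7,6,9,8,10])) (Cy Blue
    [0,7,10,2,1,4,3,5]) (Cl 3 5 0)) (Cl 7 0 2)) (Us p14 [1,10,2,5,4,3,7,6,8,0,9])) (Br 0 10 (Cy Red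
    [3,10,0,1,5,6,2,7]) (Br 3 9 (Us p15 [0,1,2,3,10,5,4,6,7,9,8]) (Br 3 8 (Us p15
    [0,1,2,3,10,5,4,6,7,8,9]) (Cy Blue [3,9,2,0,10,1,4,8]) (Us p14 [0,1,2,3,4,5,6,7,9,8,10])) (Us p14
    [0,1,2,3,4,5,6,7,8,9,10])) (Cl 0 10 1)) (Us p11 [1,5,10,0,6,3,2,7,4,8,9])) (Cl 7 10 2)"])
    (simp only: check known cong: imp_cong)

definition "p17 = ([(Red,[4,2,0,1,3,5,6,4,7,5]), (Blue,[3,6]), (Unc,[6,7])] :: pattern)"
lemmas [known] = p17_def[THEN inst_cong] p17_def[THEN holds_cong]
lemma [known]: "unsat p17"
  by (rule unsatI[where t = "
    Br 3 7 (Cy Red [4,6,5,7,3,1,0,2]) (Br 7 2 (Cy Red [4,6,5,3,1,0,2,7]) (Br 2 6 (Cy Red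
    [4,6,2,0,1,3,5,7]) (Br 7 8 (Us p10 [0,1,2,3,7,6,4,5,8,9,10]) (Br 7 9 (Us p10
    [0,1,2,3,7,6,4,5,9,8,10]) (Br 7 10 (Us p10 [0,1,2,3,7,6,4,5,10,8,9]) (Br 6 8 (Us p10
    [0,1,2,3,6,7,4,5,8,9,10]) (Br 6 9 (Us p10 [0,1,2,3,6,7,4,5,9,8,10]) (Br 6 10 (Us p10
    [0,1,2,3,6,7,4,5,10,8,9]) (Br 1 7 (Us p13 [0,1,2,3,7,6,4,5,8,9,10]) (Br 0 7 (Us p13
    [1,0,3,2,7,6,5,4,8,9,10]) (Br 0 6 (Us p13 [1,0,3,2,6,7,5,4,8,9,10]) (Br 1 6 (Us p13
    [0,1,2,3,6,7,4,5,8,9,10]) (Br 2 10 (Us p16 [0,1,7,2,6,3,5,4,8,9,10]) (Br 3 8 (Us p16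
    [1,0,7,3,6,2,4,5,9,10,8]) (Br 3 9 (Us p16 [1,0,7,3,6,2,4,5,8,10,9]) (Br 2 8 (Us p16
    [0,1,7,2,6,3,5,4,9,10,8]) (Cy Blue [3,9,7,0,6,10,2,8]) (Us p14 [0,1,7,2,6,3,5,4,9,8,10])) (Us p14
    [1,0,7,3,6,2,4,5,8,9,10])) (Us p14 [1,0,7,3,6,2,4,5,9,8,10])) (Us p14 [0,1,7,2,6,3,5,4,8,10,9]))
    (Cl 1 6 3)) (Cl 0 6 2)) (Cl 0 7 2)) (Cl 1 7 3)) (Us p8 [0,1,2,3,6,7,4,5,10,8,9])) (Us p8
    [0,1,2,3,6,7,4,5,9,8,10])) (Us p8 [0,1,2,3,6,7,4,5,8,9,10])) (Us p8 [0,1,2,3,7,6,4,5,10,8,9])) (Us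
    p8 [0,1,2,3,7,6,4,5,9,8,10])) (Us p8 [0,1,2,3,7,6,4,5,8,9,10])) (Us p5 [1,0,3,2,5,4,6,7,8,9,10]))
    (Us p5 [1,0,3,2,5,4,7,6,8,9,10])) (Us p5 [0,1,2,3,4,5,7,6,8,9,10])"])
    (simp only: check known cong: imp_cong)

definition "p18 = ([(Red,[0,1,3,5,6,4,2,0]), (Unc,[6,7])] :: pattern)"
lemmas [known] = p18_def[THEN inst_cong] p18_def[THEN holds_cong]
text \<open>The twin 7 inherits the red neighbors 4 and 5 of the cycle vertex 6. A red pair 3-7
  closes a \<open>C8\<close>; the other two colors are \<open>p17\<close> and
  \<open>p5\<close>.\<close>

lemma [known]: "unsat p18"
  by (rule unsatI[where t = "
    Tw 7 6 5 (Tw 7 6 4 (Br 3 7 (Cy Red [5,7,3,1,0,2,4,6]) (Us p17 [0,1,2,3,4,5,7,6,8,9,10]) (Us p5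
    [0,1,2,3,4,5,7,6,8,9,10])))"])
    (simp only: check known cong: imp_cong)

section \<open>Excluding a red \<open>C7\<close>\<close>

definition "p19 = ([(Red,[0,1,5,2,0,3,9,8,6,5]), (Red,[1,7]), (Red,[2,8]), (Blue,[0,4,9,6,1,2,3,6,2]), (Blue,[1,3])] :: pattern)"
lemmas [known] = p19_def[THEN inst_cong] p19_def[THEN holds_cong]
lemma [known]: "unsat p19"
  by (rule unsatI[where t = "
    Br 0 7 (Cy Red [1,7,0,3,9,8,2,5]) (Br 2 7 (Us p9 [8,9,6,2,3,1,5,0,7,4,10]) (Cy Blue
    [0,7,2,1,3,6,9,4]) (Us p18 [0,3,1,9,5,8,2,7,4,6,10])) (Us p18 [2,8,5,9,1,3,0,7,4,6,10])"])
    (simp only: check known cong: imp_cong)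

definition "p20 = ([(Red,[0,1,4,2,0,3,7,6,5,4]), (Red,[2,6]), (Red,[3,8]), (Blue,[1,2,3,1,5,2,7,5,3])] :: pattern)"
lemmas [known] = p20_def[THEN inst_cong] p20_def[THEN holds_cong]
lemma [known]: "unsat p20"
  by (rule unsatI[where t = "
    Br 0 8 (Cy Red [3,8,0,1,4,2,6,7]) (Br 4 8 (Cy Red [3,8,4,1,0,2,6,7]) (Br 2 8 (Cy Red
    [3,8,2,6,5,4,1,0]) (Br 7 8 (Cy Red [3,8,7,6,2,4,1,0]) (Br 5 8 (Cy Red [3,8,5,6,2,4,1,0]) (Br 1 10
    (Us p19 [0,1,2,3,8,4,5,10,6,7,9]) (Br 1 9 (Us p19 [0,1,2,3,8,4,5,9,6,7,10]) (Br 0 9 (Br 4 10 (Br 2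
    9 (Cy Red [0,9,2,4,5,6,7,3]) (Br 7 10 (Cy Red [4,10,7,3,0,2,6,5]) (Cy Blue [2,9,1,10,7,8,5,3]) (Us
    p18 [1,4,0,2,3,6,7,10,5,8,9])) (Us p18 [0,3,1,7,4,6,2,9,5,8,10])) (Cy Blue [1,10,4,8,2,7,5,3]) (Us
    p18 [7,3,6,0,2,1,4,10,5,8,9])) (Cy Blue [1,9,0,8,2,7,5,3]) (Us p18 [2,6,4,7,1,3,0,9,5,8,10])) (Us
    p18 [6,7,2,3,4,0,1,9,5,8,10])) (Us p18 [6,7,2,3,4,0,1,10,5,8,9])) (Us p18
    [3,0,7,1,6,4,5,8,2,9,10])) (Us p18 [1,4,0,2,3,6,7,8,5,9,10])) (Us p18 [0,3,1,7,4,6,2,8,5,9,10]))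
    (Us p18 [7,3,6,0,2,1,4,8,5,9,10])) (Us p18 [2,6,4,7,1,3,0,8,5,9,10])"])
    (simp only: check known cong: imp_cong)

definition "p21 = ([(Red,[4,0,1,5,2,0,3,8,7,6,5]), (Red,[2,7]), (Blue,[4,8,2,1,6,8,9,3,10]), (Blue,[2,6])] :: pattern)"
lemmas [known] = p21_def[THEN inst_cong] p21_def[THEN holds_cong]
lemma [known]: "unsat p21"
  by (rule unsatI[where t = "
    Br 1 4 (Cy Red [0,4,1,5,2,7,8,3]) (Br 2 10 (Br 6 10 (Us p9 [0,3,1,2,8,6,5,7,10,4,9]) (Cy Blue
    [1,4,8,9,3,10,6,2]) (Us p18 [3,0,8,1,7,5,6,10,2,4,9])) (Cy Blue [1,4,8,9,3,10,2,6]) (Us p18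
    [0,3,1,8,5,7,2,10,4,6,9])) (Us p18 [7,8,2,3,5,0,1,4,6,9,10])"])
    (simp only: check known cong: imp_cong)

text \<open>A red \<open>C7\<close> 0-3-7-6-5-4-1 and an outside vertex 2 with the red neighbors 0,
  4 and 6 on it.\<close>

definition "p22 = ([(Red,[0,1,4,2,0,3,7,6,5,4]), (Red,[2,6]), (Blue,[2,1,5,2,7,5])] :: pattern)"
lemmas [known] = p22_def[THEN inst_cong] p22_def[THEN holds_cong]
lemma [known]: "unsat p22"
  by (rule unsatI[where t = "
    Br 1 7 (Cy Red [0,2,6,5,4,1,7,3]) (Br 1 3 (Cy Red [0,2,4,5,6,7,3,1]) (Br 2 3 (Cy Red
    [0,2,3,7,6,5,4,1]) (Br 3 5 (Cy Red [0,2,6,7,3,5,4,1]) (Br 3 9 (Us p20 [0,1,2,3,4,5,6,7,9,8,10])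
    (Br 7 8 (Us p20 [6,5,2,7,4,1,0,3,8,9,10]) (Br 7 9 (Us p20 [6,5,2,7,4,1,0,3,9,8,10]) (Br 7 10 (Us
    p20 [6,5,2,7,4,1,0,3,10,8,9]) (Br 3 8 (Us p20 [0,1,2,3,4,5,6,7,8,9,10]) (Br 3 10 (Us p20
    [0,1,2,3,4,5,6,7,10,8,9]) (Br 0 10 (Us p21 [0,1,2,3,10,4,5,6,7,9,8]) (Br 0 8 (Us p21
    [0,1,2,3,8,4,5,6,7,9,10]) (Cy Blue [0,10,7,1,2,5,3,8]) (Us p18 [2,6,4,7,1,3,0,8,5,9,10])) (Us p18
    [2,6,4,7,1,3,0,10,5,8,9])) (Us p18 [4,2,1,6,0,7,3,10,5,8,9])) (Us p18 [4,2,1,6,0,7,3,8,5,9,10]))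
    (Us p18 [1,4,0,2,3,6,7,10,5,8,9])) (Us p18 [1,4,0,2,3,6,7,9,5,8,10])) (Us p18
    [1,4,0,2,3,6,7,8,5,9,10])) (Us p18 [4,2,1,6,0,7,3,9,5,8,10])) (Us p18 [4,2,1,6,0,7,3,5,8,9,10]))
    (Us p11 [3,0,2,7,1,6,4,5,8,9,10])) (Us p11 [3,0,1,7,2,4,6,5,8,9,10])) (Us p11
    [7,6,1,3,5,0,4,2,8,9,10])"])
    (simp only: check known cong: imp_cong)

definition "p23 = ([(Red,[0,1,5,2,7,8,3,0]), (Blue,[2,0,4,8,2,1,6,3,9]), (Blue,[6,8])] :: pattern)"
lemmas [known] = p23_def[THEN inst_cong] p23_def[THEN holds_cong]
lemma [known]: "unsat p23"
  by (rule unsatI[where t = "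
    Br 0 9 (Br 1 9 (Cy Red [0,9,1,5,2,7,8,3]) (Cy Blue [3,9,1,2,0,4,8,6]) (Us p18
    [7,8,2,3,5,0,1,9,4,6,10])) (Cy Blue [3,9,0,4,8,2,1,6]) (Us p18 [2,7,5,8,1,3,0,9,4,6,10])"])
    (simp only: check known cong: imp_cong)

definition "p24 = ([(Red,[4,1,0,3,7,6,2,4,5,6]), (Red,[3,8]), (Blue,[0,2,1,5,3,2,7,5])] :: pattern)"
lemmas [known] = p24_def[THEN inst_cong] p24_def[THEN holds_cong]
lemma [known]: "unsat p24"
  by (rule unsatI[where t = "
    Br 0 8 (Cy Red [3,8,0,1,4,2,6,7]) (Br 7 8 (Cy Red [3,8,7,6,2,4,1,0]) (Br 3 9 (Br 0 9 (Cy Red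
    [3,9,0,1,4,2,6,7]) (Br 1 9 (Br 0 4 (Cy Red [1,9,3,7,6,2,4,0]) (Br 4 9 (Cy Red [1,9,4,2,6,7,3,0])
    (Br 2 9 (Cy Red [3,9,2,6,5,4,1,0]) (Cy Blue [4,9,2,1,5,7,8,0]) (Us p18 [0,3,1,7,4,6,2,9,5,8,10]))
    (Us p18 [7,3,6,0,2,1,4,9,5,8,10])) (Cl 4 0 2)) (Cy Blue [0,9,1,2,3,5,7,8]) (Us p18
    [6,7,2,3,4,0,1,9,5,8,10])) (Us p18 [2,6,4,7,1,3,0,9,5,8,10])) (Us p23 [0,1,2,3,8,4,5,6,7,9,10])
    (Us p18 [4,2,1,6,0,7,3,9,5,8,10])) (Us p18 [1,4,0,2,3,6,7,8,5,9,10])) (Us p18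
    [2,6,4,7,1,3,0,8,5,9,10])"])
    (simp only: check known cong: imp_cong)

text \<open>A red \<open>C7\<close> 3-1-0-2-4-7-5 and an outside vertex 6 that shares with 5 its
  cycle neighbors 3 and 7.\<close>

definition "p25 = ([(Red,[3,1,0,2,4,7,5,3,6,7]), (Blue,[4,6,5])] :: pattern)"
lemmas [known] = p25_def[THEN inst_cong] p25_def[THEN holds_cong]
lemma [known]: "unsat p25"
  by (rule unsatI[where t = "
    Br 1 5 (Cy Red [3,6,7,4,2,0,1,5]) (Br 1 6 (Cy Red [3,6,1,0,2,4,7,5]) (Br 5 4 (Cy Red
    [3,6,7,5,4,2,0,1]) (Br 0 5 (Us p22 [0,1,5,2,3,6,7,4,8,9,10]) (Br 0 6 (Us p22
    [0,1,6,2,3,5,7,4,8,9,10]) (Br 5 2 (Us p22 [2,4,5,0,7,6,3,1,8,9,10]) (Br 2 6 (Us p22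
    [2,4,6,0,7,5,3,1,8,9,10]) (Br 2 10 (Us p24 [0,1,5,2,3,6,7,4,10,8,9]) (Br 0 8 (Us p24
    [2,4,5,0,7,6,3,1,8,9,10]) (Br 0 10 (Us p24 [2,4,5,0,7,6,3,1,10,8,9]) (Br 1 8 (Br 1 10 (Br 3 8 (Cy
    Red [1,8,3,5,7,4,2,0]) (Br 3 10 (Cy Red [1,10,3,5,7,4,2,0]) (Cy Blue [3,8,0,5,1,6,2,10]) (Us p18
    [4,2,7,0,5,1,3,10,6,8,9])) (Us p18 [4,2,7,0,5,1,3,8,6,9,10])) (Us p23 [2,4,5,0,10,7,6,3,1,8,9])
    (Us p18 [7,4,5,2,3,0,1,10,6,8,9])) (Cy Blue [0,10,2,5,4,6,1,8]) (Us p18 [7,4,5,2,3,0,1,8,6,9,10]))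
    (Us p18 [5,7,3,4,1,2,0,10,6,8,9])) (Us p18 [5,7,3,4,1,2,0,8,6,9,10])) (Us p18
    [3,5,1,7,0,4,2,10,6,8,9])) (Us p18 [3,5,1,7,0,4,2,6,8,9,10])) (Us p11 [2,0,5,4,1,7,3,6,8,9,10]))
    (Us p18 [5,7,3,4,1,2,0,6,8,9,10])) (Us p11 [0,2,5,1,4,3,7,6,8,9,10])) (Us p18
    [3,1,6,0,7,2,4,5,8,9,10])) (Us p18 [7,4,5,2,3,0,1,6,8,9,10])) (Us p18 [4,7,2,6,0,3,1,5,8,9,10])"])
    (simp only: check known cong: imp_cong)

definition "p26 = ([(Red,[4,2,0,1,3,6,9,4,10]), (Blue,[2,5,4,8,3,7,6])] :: pattern)"
lemmas [known] = p26_def[THEN inst_cong] p26_def[THEN holds_cong]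
lemma [known]: "unsat p26"
  by (rule unsatI[where t = "
    Br 9 10 (Cy Red [4,10,9,6,3,1,0,2]) (Br 2 10 (Cy Red [4,10,2,0,1,3,6,9]) (Br 6 10 (Us p25
    [1,3,0,6,2,9,10,4,5,7,8]) (Cy Blue [2,10,6,7,3,8,4,5]) (Us p18 [0,2,1,4,3,9,6,10,5,7,8])) (Us p18
    [3,6,1,9,0,4,2,10,5,7,8])) (Us p18 [0,1,2,3,4,6,9,10,5,7,8])"])
    (simp only: check known cong: imp_cong)

definition "p27 = ([(Red,[8,6,2,0,1,3,7,8,9]), (Blue,[2,4,3,5,6,4,7,5,2])] :: pattern)"
lemmas [known] = p27_def[THEN inst_cong] p27_def[THEN holds_cong]
lemma [known]: "unsat p27"
  by (rule unsatI[where t = "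
    Br 7 9 (Cy Red [8,9,7,3,1,0,2,6]) (Br 6 9 (Cy Red [8,9,6,2,0,1,3,7]) (Br 3 9 (Us p25
    [0,1,2,3,6,7,9,8,4,5,10]) (Br 2 9 (Us p25 [1,0,3,2,7,6,9,8,4,5,10]) (Br 6 10 (Us p26
    [0,1,2,3,6,5,7,4,9,8,10]) (Br 7 10 (Us p26 [1,0,3,2,7,5,6,4,9,8,10]) (Cy Blue [6,10,7,4,3,9,2,5])
    (Us p18 [0,2,1,6,3,8,7,10,4,5,9])) (Us p18 [1,3,0,7,2,8,6,10,4,5,9])) (Us p18
    [3,7,1,8,0,6,2,9,4,5,10])) (Us p18 [6,2,8,0,7,1,3,9,4,5,10])) (Us p18 [1,3,0,7,2,8,6,9,4,5,10]))
    (Us p18 [0,2,1,6,3,8,7,9,4,5,10])"])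
    (simp only: check known cong: imp_cong)

definition "p28 = ([(Red,[3,1,0,2,5,9,6,3,8]), (Red,[4,9]), (Blue,[2,4,3,7,5,4]), (Blue,[8,9,10]), (Blue,[6,7])] :: pattern)"
lemmas [known] = p28_def[THEN inst_cong] p28_def[THEN holds_cong]
lemma [known]: "unsat p28"
  by (rule unsatI[where t = "
    Br 6 8 (Cy Red [3,8,6,9,5,2,0,1]) (Br 3 10 (Br 1 10 (Cy Red [3,10,1,0,2,5,9,6]) (Br 1 4 (Br 2 10
    (Cy Red [1,4,9,6,3,10,2,0]) (Cy Blue [6,8,9,10,2,4,3,7]) (Us p18 [3,6,1,9,0,5,2,10,4,7,8])) (Cy
    Blue [1,10,9,8,6,7,3,4]) (Us p18 [9,5,6,2,3,0,1,4,7,8,10])) (Us p18 [9,5,6,2,3,0,1,10,4,7,8])) (Cy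
    Blue [6,8,9,10,3,4,5,7]) (Us p18 [5,2,9,0,6,1,3,10,4,7,8])) (Us p18 [0,2,1,5,3,9,6,8,4,7,10])"])
    (simp only: check known cong: imp_cong)

definition "p29 = ([(Red,[4,8,6,2,0,1,3,7,8]), (Blue,[8,9]), (Blue,[2,4,3,5,6,4,7,5,2])] :: pattern)"
lemmas [known] = p29_def[THEN inst_cong] p29_def[THEN holds_cong]
lemma [known]: "unsat p29"
  by (rule unsatI[where t = "
    Br 8 10 (Us p27 [0,1,2,3,4,5,6,7,8,10,9]) (Br 3 10 (Us p28 [0,1,2,3,4,6,7,5,10,8,9]) (Br 2 9 (Us
    p28 [1,0,3,2,4,7,6,5,9,8,10]) (Cy Blue [3,10,8,9,2,4,7,5]) (Us p18 [3,7,1,8,0,6,2,9,4,5,10])) (Us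
    p18 [6,2,8,0,7,1,3,10,4,5,9])) (Us p18 [0,1,2,3,6,7,8,10,4,5,9])"])
    (simp only: check known cong: imp_cong)

definition "p30 = ([(Red,[4,7,5,2,0,1,3,6,7,8]), (Blue,[2,4,3]), (Blue,[5,4,6])] :: pattern)"
lemmas [known] = p30_def[THEN inst_cong] p30_def[THEN holds_cong]
lemma [known]: "unsat p30"
  by (rule unsatI[where t = "
    Br 6 8 (Cy Red [7,8,6,3,1,0,2,5]) (Br 5 8 (Cy Red [7,8,5,2,0,1,3,6]) (Br 3 8 (Us p25
    [0,1,2,3,5,6,8,7,4,9,10]) (Br 2 8 (Us p25 [1,0,3,2,6,5,8,7,4,9,10]) (Br 7 9 (Us p27
    [0,1,2,3,4,8,5,6,7,9,10]) (Us p29 [0,1,2,3,4,8,5,6,7,9,10]) (Us p18 [0,1,2,3,5,6,7,9,4,8,10])) (Us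
    p18 [3,6,1,7,0,5,2,8,4,9,10])) (Us p18 [5,2,7,0,6,1,3,8,4,9,10])) (Us p18
    [1,3,0,6,2,7,5,8,4,9,10])) (Us p18 [0,2,1,5,3,7,6,8,4,9,10])"])
    (simp only: check known cong: imp_cong)

definition "p31 = ([(Red,[0,1,4,8,7,6,2,0,3]), (Red,[5,7]), (Blue,[2,5,4]), (Blue,[3,7,9]), (Blue,[6,5,8]),
    (Blue,[7,10])] :: pattern)"
lemmas [known] = p31_def[THEN inst_cong] p31_def[THEN holds_cong]
lemma [known]: "unsat p31"
  by (rule unsatI[where t = "
    Br 1 3 (Cy Red [0,3,1,4,8,7,6,2]) (Br 2 3 (Cy Red [0,3,2,6,7,8,4,1]) (Br 4 3 (Us p25
    [7,8,6,4,2,1,3,0,5,9,10]) (Br 6 3 (Us p25 [4,1,8,0,7,2,3,6,5,9,10]) (Br 0 9 (Us p30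
    [8,7,4,6,3,1,2,0,9,5,10]) (Br 0 10 (Us p30 [8,7,4,6,3,1,2,0,10,5,9]) (Br 0 8 (Br 1 5 (Cy Red
    [0,8,4,1,5,7,6,2]) (Us p29 [7,8,6,4,3,5,2,1,0,9,10]) (Us p18 [7,6,8,2,4,0,1,5,3,9,10])) (Sw p25
    [0,8,9,5,7,2,6,3,1,4,10]) (Sw p11 [0,10,8,9,7,5,3,4,1,2,6])) (Us p18 [8,7,4,6,1,2,0,10,3,5,9]))
    (Us p18 [8,7,4,6,1,2,0,9,3,5,10])) (Us p18 [1,4,0,8,2,7,6,3,5,9,10])) (Us p18
    [6,2,7,0,8,1,4,3,5,9,10])) (Us p18 [4,8,1,7,0,6,2,3,5,9,10])) (Us p18 [7,6,8,2,4,0,1,3,5,9,10])"])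
    (simp only: check known cong: imp_cong)

definition "p32 = ([(Red,[4,7,5,2,0,1,3,6,7]), (Blue,[2,4,3]), (Blue,[5,4,6]), (Blue,[7,8])] :: pattern)"
lemmas [known] = p32_def[THEN inst_cong] p32_def[THEN holds_cong]
lemma [known]: "unsat p32"
  by (rule unsatI[where t = "
    Br 7 9 (Us p30 [0,1,2,3,4,5,6,7,9,8,10]) (Br 7 10 (Us p30 [0,1,2,3,4,5,6,7,10,8,9]) (Br 0 9 (Us
    p31 [0,1,2,9,3,4,5,7,6,8,10]) (Br 0 8 (Us p31 [0,1,2,8,3,4,5,7,6,9,10]) (Br 0 10 (Us p31
    [0,1,2,10,3,4,5,7,6,9,8]) (Br 1 9 (Us p31 [1,0,3,9,2,4,6,7,5,8,10]) (Br 1 8 (Us p31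
    [1,0,3,8,2,4,6,7,5,9,10]) (Br 1 10 (Us p31 [1,0,3,10,2,4,6,7,5,9,8]) (Br 4 8 (Br 3 8 (Cy Red
    [4,8,3,1,0,2,5,7]) (Br 0 4 (Br 1 4 (Cy Red [0,4,1,3,6,7,5,2]) (Cy Blue [3,8,0,9,7,10,1,4]) (Us p18
    [7,5,6,2,3,0,1,4,8,9,10])) (Cy Blue [3,8,1,9,7,10,0,4]) (Us p18 [6,7,3,5,1,2,0,4,8,9,10])) (Us p18
    [5,2,7,0,6,1,3,8,4,9,10])) (Br 3 9 (Br 3 10 (Br 6 9 (Cy Red [3,9,6,7,5,2,0,1]) (Us p30
    [5,2,7,0,9,6,1,3,10,4,8]) (Us p18 [0,2,1,5,3,7,6,9,4,8,10])) (Sw p25 [8,7,4,9,3,0,1,10,2,5,6]) (Us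
    p18 [5,2,7,0,6,1,3,10,4,8,9])) (Sw p25 [8,7,4,10,3,0,1,9,2,5,6]) (Us p18
    [5,2,7,0,6,1,3,9,4,8,10])) (Cl 4 8 7)) (Us p18 [7,5,6,2,3,0,1,10,4,8,9])) (Us p18
    [7,5,6,2,3,0,1,8,4,9,10])) (Us p18 [7,5,6,2,3,0,1,9,4,8,10])) (Us p18 [6,7,3,5,1,2,0,10,4,8,9]))
    (Us p18 [6,7,3,5,1,2,0,8,4,9,10])) (Us p18 [6,7,3,5,1,2,0,9,4,8,10])) (Us p18
    [0,1,2,3,5,6,7,10,4,8,9])) (Us p18 [0,1,2,3,5,6,7,9,4,8,10])"])
    (simp only: check known cong: imp_cong)

definition "p33 = ([(Red,[6,7,4,2,0,1,3,5,7]), (Blue,[3,6,4]), (Blue,[5,6])] :: pattern)"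
lemmas [known] = p33_def[THEN inst_cong] p33_def[THEN holds_cong]
lemma [known]: "unsat p33"
  by (rule unsatI[where t = "
    Br 2 6 (Us p25 [1,0,3,2,5,4,6,7,8,9,10]) (Br 7 9 (Us p30 [0,1,2,3,6,4,5,7,9,8,10]) (Us p32
    [0,1,2,3,6,4,5,7,9,8,10]) (Us p18 [0,1,2,3,4,5,7,9,6,8,10])) (Us p18 [3,5,1,7,0,4,2,6,8,9,10])"])
    (simp only: check known cong: imp_cong)

definition "p34 = ([(Red,[6,4,2,0,1,3,5,6,7])] :: pattern)"
lemmas [known] = p34_def[THEN inst_cong] p34_def[THEN holds_cong]
text \<open>A \<open>C7\<close> with a pendant edge 6-7. A second red edge from 7 to a cycle
  neighbor 4 or 5 of 6 inserts 7 into the cycle; one to 3, at distance two from 6, gives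
  \<open>p25\<close>. If all three pairs are blue, \<open>p33\<close> applies, and twins fall under
  \<open>p18\<close>.\<close>

lemma [known]: "unsat p34"
  by (rule unsatI[where t = "
    Br 5 7 (Cy Red [6,7,5,3,1,0,2,4]) (Br 4 7 (Cy Red [6,7,4,2,0,1,3,5]) (Br 3 7 (Us p25
    [0,1,2,3,4,5,7,6,8,9,10]) (Us p33 [0,1,2,3,4,5,7,6,8,9,10]) (Us p18 [4,2,6,0,5,1,3,7,8,9,10])) (Us
    p18 [1,3,0,5,2,6,4,7,8,9,10])) (Us p18 [0,2,1,4,3,6,5,7,8,9,10])"])
    (simp only: check known cong: imp_cong)

definition "p35 = ([(Red,[0,1,3,5,6,4,2,0]), (Blue,[6,7])] :: pattern)"
lemmas [known] = p35_def[THEN inst_cong] p35_def[THEN holds_cong]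
text \<open>By \<open>p34\<close> and \<open>p18\<close> the pairs between the cycle and the outside
  that are examined are neither red nor \<open>Unc\<close>. Seven of them together with 6-7 form a
  blue \<open>C8\<close> alternating between 0, 1, 3, 6 and 7, 8, 9, 10.\<close>

lemma [known]: "unsat p35"
  by (rule unsatI[where t = "
    Br 0 8 (Us p34 [5,6,3,4,1,2,0,8,7,9,10]) (Br 0 10 (Us p34 [5,6,3,4,1,2,0,10,7,8,9]) (Br 1 9 (Us
    p34 [6,4,5,2,3,0,1,9,7,8,10]) (Br 1 10 (Us p34 [6,4,5,2,3,0,1,10,7,8,9]) (Br 3 7 (Us p34
    [4,2,6,0,5,1,3,7,8,9,10]) (Br 3 8 (Us p34 [4,2,6,0,5,1,3,8,7,9,10]) (Br 6 9 (Us p34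
    [0,1,2,3,4,5,6,9,7,8,10]) (Cy Blue [3,8,0,10,1,9,6,7]) (Us p18 [0,1,2,3,4,5,6,9,7,8,10])) (Us p18
    [4,2,6,0,5,1,3,8,7,9,10])) (Us p18 [4,2,6,0,5,1,3,7,8,9,10])) (Us p18 [6,4,5,2,3,0,1,10,7,8,9]))
    (Us p18 [6,4,5,2,3,0,1,9,7,8,10])) (Us p18 [5,6,3,4,1,2,0,10,7,8,9])) (Us p18
    [5,6,3,4,1,2,0,8,7,9,10])"])
    (simp only: check known cong: imp_cong)

text \<open>The bare red \<open>C7\<close>. From here on a \<open>C7\<close> of either color ends a
  branch.\<close>

definition "p36 = ([(Red,[0,1,3,5,6,4,2,0])] :: pattern)"
lemmas [known] = p36_def[THEN inst_cong] p36_def[THEN holds_cong]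
lemma [known]: "unsat p36"
  by (rule unsatI[where t = "
    Br 6 7 (Us p34 [0,1,2,3,4,5,6,7,8,9,10]) (Us p35 [0,1,2,3,4,5,6,7,8,9,10]) (Us p18
    [0,1,2,3,4,5,6,7,8,9,10])"])
    (simp only: check known cong: imp_cong)

section \<open>Excluding a red path on eight vertices\<close>

definition "p37 = ([(Red,[0,1,7,8,2,6,5,3,4,9]), (Red,[2,3]), (Red,[5,8]), (Blue,[3,0,2,1,3,7,6,0,5,1,6]),
    (Blue,[0,4]), (Unc,[2,5])] :: pattern)"
lemmas [known] = p37_def[THEN inst_cong] p37_def[THEN holds_cong]
lemma [known]: "unsat p37"
  by (rule unsatI[where t = "
    Br 0 9 (Cy Red [4,9,0,1,7,8,2,3]) (Br 8 9 (Us p34 [2,3,6,4,5,9,8,7,0,1,10]) (Br 9 6 (Us p27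
    [4,9,3,6,0,1,5,2,8,7,10]) (Sw p17 [6,7,9,3,0,1,2,5,4,8,10]) (Sw p11 [9,0,6,8,2,7,1,3,4,5,10])) (Us
    p11 [8,2,9,7,6,4,5,3,0,1,10])) (Cl 9 0 4)"])
    (simp only: check known cong: imp_cong)

definition "p38 = ([(Red,[0,1,7,8,2,4,5,6,2]), (Red,[3,4]), (Red,[5,8]), (Blue,[3,0,2,1,4,0,5,1,6,7,4,9]),
    (Blue,[0,6]), (Unc,[2,5])] :: pattern)"
lemmas [known] = p38_def[THEN inst_cong] p38_def[THEN holds_cong]
lemma [known]: "unsat p38"
  by (rule unsatI[where t = "
    Br 3 9 (Us p37 [0,1,2,4,3,5,6,7,8,9,10]) (Cy Blue [4,9,3,0,2,1,6,7]) (Cl 3 9 4)"])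
    (simp only: check known cong: imp_cong)

definition "p39 = ([(Red,[0,1,6,7,5,3,2,4,5,8]), (Red,[2,7]), (Red,[3,4]), (Blue,[0,2,1,3,0,4,1,5,0]), (Unc,[2,5])] :: pattern)"
lemmas [known] = p39_def[THEN inst_cong] p39_def[THEN holds_cong]
lemma [known]: "unsat p39"
  by (rule unsatI[where t = "
    Br 0 8 (Cy Red [5,8,0,1,6,7,2,3]) (Br 1 8 (Cy Red [5,8,1,6,7,2,3,4]) (Br 6 8 (Us p34
    [4,3,2,5,7,8,6,1,0,9,10]) (Tw 2 5 8 (Br 6 3 (Us p34 [2,8,4,5,3,7,6,1,0,9,10]) (Br 6 4 (Us p34
    [2,8,3,5,4,7,6,1,0,9,10]) (Br 4 10 (Us p37 [0,1,2,3,4,5,8,6,7,10,9]) (Us p38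
    [0,1,2,3,4,5,8,6,7,10,9]) (Br 3 10 (Us p37 [0,1,2,4,3,5,8,6,7,10,9]) (Us p38
    [0,1,2,4,3,5,8,6,7,10,9]) (Cl 10 4 3))) (Cl 6 4 1)) (Cl 6 3 1))) (Us p11
    [6,7,8,1,2,5,4,3,0,9,10])) (Cl 8 1 5)) (Cl 8 0 5)"])
    (simp only: check known cong: imp_cong)

definition "p40 = ([(Red,[0,1,6,7,2,3,4,5,3]), (Red,[2,4]), (Red,[5,7]), (Blue,[0,2,1,3,0,4,1,5,0]), (Unc,[2,5,8])] :: pattern)"
lemmas [known] = p40_def[THEN inst_cong] p40_def[THEN holds_cong]
lemma [known]: "unsat p40"
  by (rule unsatI[where t = "
    Tw 8 5 0 (Br 2 8 (Us p39 [0,1,5,3,4,2,6,7,8,9,10]) (Cl 5 8 2) (Br 2 9 (Us p39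
    [0,1,5,3,4,2,6,7,9,8,10]) (Br 2 10 (Us p39 [0,1,5,3,4,2,6,7,10,8,9]) (Br 5 9 (Us p39
    [0,1,2,3,4,5,6,7,9,8,10]) (Sw p11 [2,9,8,10,5,0,1,3,4,6,7]) (St 5 8 2 9)) (St 2 8 5 10)) (St 2 8 5
    9)))"])
    (simp only: check known cong: imp_cong)

definition "p41 = ([(Red,[0,1,4,7,6,5,2,3]), (Blue,[1,3,0,2]), (Unc,[3,6])] :: pattern)"
lemmas [known] = p41_def[THEN inst_cong] p41_def[THEN holds_cong]
lemma [known]: "unsat p41"
  by (rule unsatI[where t = "
    Tw 6 3 0 (Tw 6 3 1 (Tw 3 6 7 (Br 0 5 (Us p11 [3,7,6,2,4,5,1,0,8,9,10]) (Tw 6 3 2 (Br 1 5 (Us p34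
    [2,3,6,7,5,4,1,0,8,9,10]) (Tw 3 6 5 (Br 1 2 (Us p34 [5,3,6,7,2,4,1,0,8,9,10]) (Br 3 10 (Us p39
    [0,1,6,5,2,3,4,7,10,8,9]) (Br 6 8 (Us p39 [0,1,3,5,2,6,4,7,8,9,10]) (Br 6 10 (Us p39
    [0,1,3,5,2,6,4,7,10,8,9]) (Br 0 8 (Br 5 8 (Cy Red [0,8,5,2,6,7,4,1]) (Sw p11
    [3,0,6,10,2,8,1,5,4,7,9]) (Cl 5 8 6)) (Sw p25 [6,8,10,0,3,5,2,1,4,7,9]) (Sw p11
    [0,5,8,2,1,6,3,10,4,7,9])) (Us p40 [0,1,3,5,2,6,4,7,10,8,9])) (Us p40 [0,1,3,5,2,6,4,7,8,9,10]))
    (Us p40 [0,1,6,5,2,3,4,7,10,8,9])) (Cl 1 2 0))) (Cl 5 1 6))) (Cl 5 0 2))))"])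
    (simp only: check known cong: imp_cong)

definition "p42 = ([(Red,[4,5,1,2,3,8,6,2,7,5,6]), (Red,[7,8]), (Blue,[6,4,1,0,3,4,7,9]), (Blue,[0,2]), (Unc,[6,7])] :: pattern)"
lemmas [known] = p42_def[THEN inst_cong] p42_def[THEN holds_cong]
lemma [known]: "unsat p42"
  by (rule unsatI[where t = "
    Br 6 9 (Us p11 [6,8,7,9,3,5,2,1,0,4,10]) (Br 1 6 (Us p33 [3,8,2,6,7,1,4,5,0,9,10]) (Sw p33
    [7,9,4,6,3,1,2,0,5,8,10]) (Br 6 3 (Us p33 [7,8,2,3,1,6,4,5,0,9,10]) (Sw p33
    [7,9,4,6,1,3,2,0,5,8,10]) (St 6 1 3 7))) (Cl 6 9 7)"])
    (simp only: check known cong: imp_cong)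

definition "p43 = ([(Red,[2,1,5,6,2,3,7,6]), (Red,[4,5]), (Blue,[0,1,4,3,0,2]), (Blue,[4,6]), (Unc,[6,8])] :: pattern)"
lemmas [known] = p43_def[THEN inst_cong] p43_def[THEN holds_cong]
lemma [known]: "unsat p43"
  by (rule unsatI[where t = "
    Tw 8 6 4 (Tw 8 6 5 (Tw 8 6 2 (Tw 8 6 7 (Br 9 8 (Us p11 [8,5,6,9,1,7,2,3,0,4,10]) (Us p42
    [0,1,2,3,4,5,6,8,7,9,10]) (Br 8 10 (Us p11 [8,5,6,10,1,7,2,3,0,4,9]) (Us p42
    [0,1,2,3,4,5,6,8,7,10,9]) (St 8 9 6 10))))))"])
    (simp only: check known cong: imp_cong)

definition "p44 = ([(Red,[0,1,6,2,3,4,2,5,4,6,3,8,5,6,8,4,9]), (Red,[3,5]), (Red,[7,8]),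
    (Blue,[2,0,3,1,2,7,4,0,5,1,4]), (Blue,[3,7,6])] :: pattern)"
lemmas [known] = p44_def[THEN inst_cong] p44_def[THEN holds_cong]
lemma [known]: "unsat p44"
  by (rule unsatI[where t = "
    Br 0 9 (Cy Red [4,9,0,1,6,2,3,8]) (Br 6 9 (Us p27 [9,6,4,2,0,1,5,3,8,7,10]) (Sw p22
    [0,2,3,9,1,4,7,6,5,8,10]) (Us p43 [0,3,5,2,7,8,6,4,9,1,10])) (Cl 9 0 4)"])
    (simp only: check known cong: imp_cong)

definition "p45 = ([(Red,[0,1,7,2,3,4,5,6,3]), (Red,[7,4,8]), (Blue,[1,2,0,4,1,6,0,3]), (Blue,[0,5])] :: pattern)"
lemmas [known] = p45_def[THEN inst_cong] p45_def[THEN holds_cong]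
lemma [known]: "unsat p45"
  by (rule unsatI[where t = "
    Br 0 8 (Us p34 [1,0,7,8,2,4,3,6,5,9,10]) (Br 1 8 (Cy Red [4,8,1,7,2,3,6,5]) (Br 7 8 (Us p34
    [6,5,3,4,2,8,7,1,0,9,10]) (Br 2 8 (Br 1 5 (Cy Red [2,8,4,7,1,5,6,3]) (Br 7 3 (Us p34
    [5,4,6,8,3,2,7,1,0,9,10]) (Br 7 5 (Us p34 [2,3,8,6,4,5,7,1,0,9,10]) (Br 3 8 (Us p33
    [6,3,5,8,4,2,1,7,0,9,10]) (Sw p34 [7,5,3,0,8,2,1,4,6,9,10]) (Br 3 9 (Us p11
    [3,6,8,9,5,2,4,7,0,1,10]) (Sw p11 [3,0,8,9,2,7,1,5,4,6,10]) (Us p43 [0,8,4,5,7,2,3,6,9,1,10])))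
    (Us p11 [7,2,5,1,8,6,4,3,0,9,10])) (Us p11 [7,2,3,1,8,6,4,5,0,9,10])) (Cl 1 5 0)) (Br 7 6 (Br 3 8
    (Us p34 [8,4,3,5,2,6,7,1,0,9,10]) (Br 2 4 (Br 1 3 (Us p34 [4,5,2,6,3,7,1,0,8,9,10]) (Br 1 5 (Us
    p32 [5,6,1,3,8,7,2,4,0,9,10]) (Br 7 3 (Br 7 5 (Br 2 5 (Br 2 6 (Br 3 5 (Br 4 6 (Br 5 8 (Us p34
    [6,5,3,8,2,4,7,1,0,9,10]) (Br 6 8 (Us p33 [6,8,3,4,2,5,1,7,0,9,10]) (Br 5 9 (Us p44
    [0,1,2,3,5,6,7,8,4,9,10]) (Br 2 9 (Us p44 [0,1,3,5,2,6,7,8,4,9,10]) (Cy Blue [5,9,2,0,3,1,6,8])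
    (Sw p43 [7,5,1,3,4,0,2,8,9,6,10])) (Us p43 [0,2,4,3,1,7,5,6,9,8,10])) (Us p41
    [1,7,4,8,2,5,6,3,0,9,10])) (Cl 5 8 7)) (Sw p34 [1,2,4,8,6,3,0,5,7,9,10]) (Us p41
    [0,1,2,4,7,3,6,5,8,9,10])) (Sw p34 [3,5,8,0,2,4,1,6,7,9,10]) (Us p41 [0,1,2,3,7,4,5,6,8,9,10]))
    (Sw p34 [6,2,1,8,4,3,0,5,7,9,10]) (Us p41 [0,1,4,2,7,5,6,3,8,9,10])) (Sw p34
    [3,8,1,2,4,5,0,6,7,9,10]) (Us p41 [0,1,3,2,7,6,5,4,8,9,10])) (Sw p34 [2,8,1,7,4,5,0,3,6,9,10]) (Cl
    7 5 1)) (Sw p34 [2,8,1,7,4,3,0,5,6,9,10]) (Cl 7 3 1)) (Cl 1 5 0)) (Cl 3 1 6)) (Sw p34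
    [4,2,1,8,6,3,0,5,7,9,10]) (Cl 4 2 8)) (Cl 3 8 2)) (Sw p34 [2,8,1,7,4,6,0,3,5,9,10]) (Cl 7 6 1))
    (Cl 2 8 7)) (Us p11 [7,2,8,1,3,4,6,5,0,9,10])) (Cl 8 1 4)) (Cl 8 0 4)"])
    (simp only: check known cong: imp_cong)

definition "p46 = ([(Red,[0,1,7,2,3,4,5,6,3]), (Red,[4,7]), (Blue,[1,2,0,4,1,6,0,3]), (Blue,[0,5]), (Blue,[4,8])] :: pattern)"
lemmas [known] = p46_def[THEN inst_cong] p46_def[THEN holds_cong]
lemma [known]: "unsat p46"
  by (rule unsatI[where t = "
    Br 4 9 (Us p45 [0,1,2,3,4,5,6,7,9,8,10]) (Br 3 8 (Br 0 8 (Cy Red [3,8,0,1,7,4,5,6]) (Br 1 8 (Us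
    p34 [3,6,8,5,1,4,7,2,0,9,10]) (Br 3 9 (Br 0 9 (Cy Red [3,9,0,1,7,4,5,6]) (Br 2 5 (Br 2 9 (Us p34
    [3,6,9,5,2,4,7,1,0,8,10]) (Sw p33 [2,9,1,4,6,8,3,0,5,7,10]) (Us p43 [0,4,5,6,1,7,2,3,9,8,10])) (Sw
    p34 [0,9,5,4,2,8,1,6,3,7,10]) (Us p41 [0,1,3,2,7,6,5,4,8,9,10])) (Cl 9 0 3)) (Sw p34
    [8,4,1,9,2,3,0,5,6,7,10]) (Cl 3 9 4)) (Us p11 [1,7,8,0,4,3,5,6,2,9,10])) (Cl 8 0 3)) (Br 1 9 (Br 2
    9 (Cy Red [1,9,2,3,6,5,4,7]) (Cy Blue [3,8,4,9,2,1,6,0]) (Cl 9 2 1)) (Sw p34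
    [3,8,0,4,2,9,1,6,5,7,10]) (Sw p11 [1,2,9,6,0,4,3,8,5,7,10])) (Cl 3 8 4)) (Us p43
    [0,2,3,6,1,7,4,5,9,8,10])"])
    (simp only: check known cong: imp_cong)

definition "p47 = ([(Red,[0,1,5,2,3,4,6,7,5]), (Red,[2,6]), (Blue,[0,2,1,4,0,3])] :: pattern)"
lemmas [known] = p47_def[THEN inst_cong] p47_def[THEN holds_cong]
lemma [known]: "unsat p47"
  by (rule unsatI[where t = "
    Br 0 7 (Cy Red [5,2,3,4,6,7,0,1]) (Br 0 6 (Us p34 [5,2,1,3,0,4,6,7,8,9,10]) (Br 1 7 (Us p34
    [4,3,6,2,7,5,1,0,8,9,10]) (Br 2 9 (Us p45 [0,1,7,6,2,3,4,5,9,8,10]) (Us p46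
    [0,1,7,6,2,3,4,5,9,8,10]) (Us p43 [0,7,6,4,1,5,2,3,9,8,10])) (Us p11 [1,5,7,0,2,6,3,4,8,9,10]))
    (Cl 6 0 4)) (Us p41 [4,3,1,0,2,5,7,6,8,9,10])"])
    (simp only: check known cong: imp_cong)

definition "p48 = ([(Red,[0,1,4,8,7,5,2]), (Red,[3,7]), (Blue,[2,0,3,1,5,4,3]), (Unc,[1,6])] :: pattern)"
lemmas [known] = p48_def[THEN inst_cong] p48_def[THEN holds_cong]
lemma [known]: "unsat p48"
  by (rule unsatI[where t = "
    Tw 6 1 0 (Tw 6 1 4 (Br 1 2 (Cy Red [4,6,0,1,2,5,7,8]) (Tw 6 1 5 (Br 1 7 (Br 2 6 (Us p11
    [1,4,6,0,8,2,7,5,3,9,10]) (Us p47 [2,5,1,0,6,7,4,8,3,9,10]) (Cl 6 2 0)) (Sw p11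
    [1,2,6,7,0,5,3,4,8,9,10]) (Cl 7 1 3))) (Cl 1 2 0)))"])
    (simp only: check known cong: imp_cong)

definition "p49 = ([(Red,[0,1,5,8,7,2,3,4,7]), (Red,[1,6]), (Blue,[2,0,4,1,2,5,4]), (Blue,[0,3])] :: pattern)"
lemmas [known] = p49_def[THEN inst_cong] p49_def[THEN holds_cong]
lemma [known]: "unsat p49"
  by (rule unsatI[where t = "
    Br 2 6 (Cy Red [1,6,2,3,4,7,8,5]) (Br 3 6 (Us p34 [1,6,5,3,8,2,7,4,0,9,10]) (Br 4 6 (Cy Red
    [1,6,4,3,2,7,8,5]) (Br 0 7 (Br 8 2 (Cy Red [0,7,4,3,2,8,5,1]) (Br 0 8 (Br 1 3 (Us p34
    [0,8,7,5,2,1,3,4,6,9,10]) (Br 5 3 (Us p34 [0,8,1,7,5,2,3,4,6,9,10]) (Br 8 3 (Us p34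
    [0,1,7,5,2,8,3,4,6,9,10]) (Br 5 6 (Br 0 5 (Us p46 [3,2,8,5,0,1,6,7,4,9,10]) (Sw p35
    [3,6,0,2,5,1,4,7,8,9,10]) (Us p41 [3,2,1,0,7,6,5,8,4,9,10])) (Sw p35 [3,0,6,2,5,1,4,7,8,9,10]) (Us
    p48 [8,5,3,2,1,4,6,7,0,9,10])) (Us p11 [3,2,8,4,7,5,0,1,6,9,10])) (Cl 3 5 2)) (Cl 1 3 0)) (Sw p25
    [0,8,3,2,6,5,1,4,7,9,10]) (Us p41 [4,3,1,0,2,5,8,7,6,9,10])) (Cl 8 2 5)) (Br 0 5 (Br 1 7 (Br 1 3
    (Us p34 [0,1,5,3,8,2,7,4,6,9,10]) (Br 0 6 (Us p47 [3,2,1,6,0,7,5,8,4,9,10]) (Sw p34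
    [1,2,3,5,6,4,0,7,8,9,10]) (Sw p11 [0,3,6,7,1,2,4,5,8,9,10])) (Cl 1 3 0)) (Cy Blue
    [0,7,1,2,5,4,6,3]) (Cl 7 1 4)) (Sw p35 [3,6,0,2,5,1,4,7,8,9,10]) (Sw p11
    [0,3,5,7,6,2,4,1,8,9,10])) (Cl 7 0 4)) (Cl 6 4 1)) (Us p11 [3,2,6,4,7,1,8,5,0,9,10])) (Cl 6 2 1)"])
    (simp only: check known cong: imp_cong)

definition "p50 = ([(Red,[0,1,4,9,8,5,2]), (Red,[3,8]), (Blue,[2,0,3,4,5,1,6,5]), (Blue,[1,7])] :: pattern)"
lemmas [known] = p50_def[THEN inst_cong] p50_def[THEN holds_cong]
lemma [known]: "unsat p50"
  by (rule unsatI[where t = "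
    Br 0 7 (Br 2 7 (Cy Red [0,7,2,5,8,9,4,1]) (Sw p35 [1,7,5,2,4,0,3,8,6,9,10]) (Cl 7 2 0)) (Sw p34
    [5,6,4,1,3,7,0,2,8,9,10]) (Cl 0 7 1)"])
    (simp only: check known cong: imp_cong)

definition "p51 = ([(Red,[0,1,5,9,8,2,3,4,8]), (Blue,[2,0,4,1,2,5,4]), (Blue,[6,1,7]), (Blue,[0,3]), (Unc,[2,6])] :: pattern)"
lemmas [known] = p51_def[THEN inst_cong] p51_def[THEN holds_cong]
lemma [known]: "unsat p51"
  by (rule unsatI[where t = "
    Tw 6 2 0 (Tw 6 2 5 (Tw 6 2 8 (Br 3 6 (Br 2 4 (Us p41 [1,5,4,2,9,3,6,8,0,7,10]) (Us p50
    [0,1,3,6,5,2,4,7,8,9,10]) (Br 2 7 (Br 0 7 (Us p18 [5,1,9,0,8,7,2,4,3,6,10]) (Br 1 3 (Us p11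
    [2,8,4,7,9,3,5,1,0,6,10]) (Br 9 2 (Br 9 4 (Us p47 [1,5,4,3,6,9,8,2,0,7,10]) (Sw p11
    [4,0,2,9,7,5,1,6,3,8,10]) (Cl 9 4 5)) (Sw p11 [2,0,4,9,7,5,1,6,3,8,10]) (Cl 9 2 5)) (Cl 1 3 0))
    (Cl 0 7 1)) (Us p50 [0,1,3,4,5,2,7,6,8,9,10]) (St 2 4 6 7))) (Sw p34 [2,0,5,3,4,6,1,7,8,9,10]) (Cl
    6 2 3))))"])
    (simp only: check known cong: imp_cong)

text \<open>The red part is a \<open>C4\<close> 6-3-2-5 with the tail 6-7-4-1-0, that is, a path on
  eight vertices with a chord at its end 5.\<close>

definition "p52 = ([(Red,[0,1,4,7,6,3,2,5,6]), (Blue,[1,3,0,2])] :: pattern)"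
lemmas [known] = p52_def[THEN inst_cong] p52_def[THEN holds_cong]
lemma [known]: "unsat p52"
  by (rule unsatI[where t = "
    Br 0 5 (Cy Red [6,3,2,5,0,1,4,7]) (Br 1 5 (Us p34 [6,3,7,2,4,5,1,0,8,9,10]) (Br 4 5 (Us p47
    [0,1,5,2,3,4,6,7,8,9,10]) (Br 4 3 (Us p47 [0,1,3,2,5,4,6,7,8,9,10]) (Br 1 9 (Us p49
    [0,1,5,2,3,4,9,6,7,8,10]) (Br 1 8 (Us p49 [0,1,5,2,3,4,8,6,7,9,10]) (Br 5 8 (Br 4 8 (Us p34
    [3,2,6,5,7,8,4,1,0,9,10]) (Br 3 8 (Br 1 2 (Cy Red [3,8,5,6,7,4,1,2]) (Br 4 2 (Us p34
    [3,8,6,5,7,2,4,1,0,9,10]) (Br 7 2 (Us p47 [1,4,2,5,8,7,3,6,0,9,10]) (Br 7 8 (Us p47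
    [1,4,8,5,2,7,3,6,0,9,10]) (Cy Blue [7,2,0,5,1,3,4,8]) (Cl 7 8 4)) (Cl 7 2 4)) (Cl 2 4 5)) (Cl 1 2
    0)) (Us p50 [0,1,2,5,4,3,8,9,6,7,10]) (Us p51 [0,1,3,2,5,4,8,9,6,7,10])) (Cl 4 8 1)) (Us p50
    [0,1,2,3,4,5,8,9,6,7,10]) (Us p51 [0,1,5,2,3,4,8,9,6,7,10])) (Us p48 [0,1,2,5,4,3,8,6,7,9,10]))
    (Us p48 [0,1,2,3,4,5,9,6,7,8,10])) (Cl 4 3 1)) (Cl 4 5 1)) (Us p11 [1,4,5,0,7,2,6,3,8,9,10])) (Cl
    5 0 2)"])
    (simp only: check known cong: imp_cong)

definition "p53 = ([(Red,[0,1,3,6,7,5,2]), (Blue,[0,2]), (Unc,[1,4])] :: pattern)"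
lemmas [known] = p53_def[THEN inst_cong] p53_def[THEN holds_cong]
lemma [known]: "unsat p53"
  by (rule unsatI[where t = "
    Tw 4 1 0 (Tw 4 1 3 (Br 1 5 (Us p34 [3,4,6,0,7,1,5,2,8,9,10]) (Br 1 2 (Cy Red [3,4,0,1,2,5,7,6])
    (Us p52 [2,5,0,1,7,4,3,6,8,9,10]) (Cl 1 2 0)) (Us p11 [5,7,1,2,6,0,3,4,8,9,10])))"])
    (simp only: check known cong: imp_cong)

definition "p54 = ([(Red,[0,1,5,2,6,8,3,4]), (Red,[3,9]), (Blue,[0,2,7,3,0,4,1]), (Blue,[6,4,7])] :: pattern)"
lemmas [known] = p54_def[THEN inst_cong] p54_def[THEN holds_cong]
lemma [known]: "unsat p54"
  by (rule unsatI[where t = "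
    Br 0 9 (Cy Red [3,9,0,1,5,2,6,8]) (Br 1 9 (Us p34 [6,8,2,3,5,9,1,0,4,7,10]) (Br 1 6 (Br 2 4 (Us
    p34 [1,5,6,2,8,4,3,9,0,7,10]) (Sw p34 [3,0,7,9,2,1,4,6,5,8,10]) (Cl 2 4 6)) (Sw p34
    [1,9,6,0,4,2,7,3,5,8,10]) (Sw p53 [9,1,3,4,6,7,0,2,5,8,10])) (Us p53 [0,1,3,5,9,8,2,6,4,7,10]))
    (Cl 9 0 3)"])
    (simp only: check known cong: imp_cong)

definition "p55 = ([(Red,[0,1,5,2,7,8,3,4]), (Red,[1,6]), (Blue,[1,4,0,2]), (Blue,[0,3]), (Blue,[4,7])] :: pattern)"
lemmas [known] = p55_def[THEN inst_cong] p55_def[THEN holds_cong]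
lemma [known]: "unsat p55"
  by (rule unsatI[where t = "
    Br 3 6 (Us p34 [2,5,7,1,8,6,3,4,0,9,10]) (Br 4 6 (Cy Red [1,6,4,3,8,7,2,5]) (Br 2 6 (Us p52
    [4,3,1,6,8,5,2,7,0,9,10]) (Br 3 9 (Us p54 [0,1,2,3,4,5,7,6,8,9,10]) (Br 1 9 (Br 3 10 (Us p54
    [0,1,2,3,4,5,7,6,8,10,9]) (Br 4 9 (Cy Red [1,9,4,3,8,7,2,5]) (Br 0 7 (Br 5 4 (Us p34
    [7,8,0,3,1,4,5,2,6,9,10]) (Br 0 5 (Br 0 9 (Us p52 [4,3,1,9,8,5,0,7,2,6,10]) (Br 1 3 (Us p34
    [5,2,0,7,1,8,3,4,6,9,10]) (Sw p34 [0,9,2,3,6,1,4,5,7,8,10]) (Cl 1 3 0)) (Us p41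
    [4,3,1,9,8,5,0,7,2,6,10])) (Sw p33 [6,2,3,0,9,5,1,4,7,8,10]) (Cl 5 0 2)) (Cl 5 4 1)) (Sw p34
    [0,7,2,4,6,9,3,10,1,5,8]) (Cl 7 0 2)) (Cl 4 9 3)) (Us p53 [4,3,1,8,10,5,7,2,0,6,9])) (Sw p34
    [3,0,9,2,1,6,4,7,5,8,10]) (Us p53 [0,1,3,5,9,8,2,7,4,6,10])) (Us p53 [4,3,1,8,9,5,7,2,0,6,10]))
    (Us p41 [4,3,1,6,8,5,2,7,0,9,10])) (Cl 6 4 1)) (Us p53 [4,3,1,8,6,5,7,2,0,9,10])"])
    (simp only: check known cong: imp_cong)

definition "p56 = ([(Red,[4,3,9,8,2,6,1,0,5]), (Blue,[1,4,0,3,5,1,7,3]), (Blue,[0,2]), (Blue,[4,8])] :: pattern)"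
lemmas [known] = p56_def[THEN inst_cong] p56_def[THEN holds_cong]
lemma [known]: "unsat p56"
  by (rule unsatI[where t = "
    Br 2 5 (Br 1 3 (Us p34 [2,5,8,0,9,1,3,4,6,7,10]) (Br 1 2 (Us p52 [4,3,0,1,9,5,2,8,6,7,10]) (Br 0 6
    (Us p55 [1,0,2,3,4,6,5,8,9,7,10]) (Br 0 7 (Us p55 [1,0,2,3,4,5,7,8,9,6,10]) (Br 0 8 (Br 6 4 (Cy
    Red [0,8,9,3,4,6,2,5]) (Sw p34 [0,7,6,3,4,5,1,2,8,9,10]) (Cl 6 4 1)) (Sw p34
    [0,7,8,3,4,5,1,2,6,9,10]) (Cl 8 0 2)) (Cl 0 7 1)) (Cl 6 0 2)) (Cl 1 2 0)) (Cl 1 3 0)) (Sw p34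
    [3,5,7,2,1,0,4,8,6,9,10]) (Cl 5 2 0)"])
    (simp only: check known cong: imp_cong)

definition "p57 = ([(Red,[0,1,2,3,4,5,6,7])] :: pattern)"
lemmas [known] = p57_def[THEN inst_cong] p57_def[THEN holds_cong]
text \<open>A red pair 0-7 closes a \<open>C8\<close>, a red pair 0-6 or 1-7 a \<open>C7\<close>,
  and a red pair 4-7 or 0-3 a \<open>C4\<close> as in \<open>p52\<close>. By \<open>p55\<close> and
  \<open>p53\<close> the second vertices 1 and 6 see 8, 9 and 10 in blue, and \<open>p56\<close>
  excludes red pairs 0-8 and 7-9. What remains contains the blue \<open>C7\<close> 0-8-1-10-6-9-7
  with the pendant edge 7-4.\<close>

lemma [known]: "unsat p57"
  by (rule unsatI[where t = "
    Br 0 6 (Us p36 [5,6,4,0,3,1,2,7,8,9,10]) (Br 0 7 (Cy Red [6,7,0,1,2,3,4,5]) (Br 1 7 (Us p34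
    [4,5,3,6,2,7,1,0,8,9,10]) (Br 4 7 (Us p52 [0,1,6,7,2,5,4,3,8,9,10]) (Br 0 3 (Us p52
    [7,6,1,0,5,2,3,4,8,9,10]) (Br 1 8 (Us p55 [0,1,3,6,7,2,8,4,5,9,10]) (Br 1 9 (Us p55
    [0,1,3,6,7,2,9,4,5,8,10]) (Br 1 10 (Us p55 [0,1,3,6,7,2,10,4,5,8,9]) (Br 6 8 (Us p55
    [7,6,4,1,0,5,8,3,2,9,10]) (Br 6 9 (Us p55 [7,6,4,1,0,5,9,3,2,8,10]) (Br 6 10 (Us p55
    [7,6,4,1,0,5,10,3,2,8,9]) (Br 0 8 (Us p56 [0,1,3,6,7,8,2,9,4,5,10]) (Br 7 9 (Us p56
    [7,6,4,1,0,9,5,8,3,2,10]) (Sw p34 [10,1,6,8,9,0,7,4,2,3,5]) (Sw p53 [4,7,3,1,9,0,8,6,2,5,10])) (Cl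
    0 8 1)) (Us p53 [7,6,1,5,10,2,4,3,0,8,9])) (Us p53 [7,6,1,5,9,2,4,3,0,8,10])) (Us p53
    [7,6,1,5,8,2,4,3,0,9,10])) (Us p53 [0,1,6,2,10,5,3,4,7,8,9])) (Us p53 [0,1,6,2,9,5,3,4,7,8,10]))
    (Us p53 [0,1,6,2,8,5,3,4,7,9,10])) (Us p41 [7,6,1,0,5,2,3,4,8,9,10])) (Us p41
    [0,1,6,7,2,5,4,3,8,9,10])) (Us p11 [1,2,7,0,3,6,4,5,8,9,10])) (Cl 7 0 6)) (Us p11
    [6,5,0,7,4,1,3,2,8,9,10])"])
    (simp only: check known cong: imp_cong)

section \<open>Excluding a red path on seven vertices\<close>

definition "p58 = ([(Red,[1,0,3,4,1,2,5,6,3]), (Unc,[2,0,4])] :: pattern)"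
lemmas [known] = p58_def[THEN inst_cong] p58_def[THEN holds_cong]
lemma [known]: "unsat p58"
  by (rule unsatI[where t = "
    Br 0 6 (Us p36 [1,4,2,3,5,0,6,7,8,9,10]) (Br 0 7 (Us p57 [4,3,6,5,2,1,0,7,8,9,10]) (Br 0 8 (Us p57
    [4,3,6,5,2,1,0,8,7,9,10]) (Br 0 9 (Us p57 [4,3,6,5,2,1,0,9,7,8,10]) (Br 0 10 (Us p57
    [4,3,6,5,2,1,0,10,7,8,9]) (Br 2 8 (Us p57 [4,1,0,3,6,5,2,8,7,9,10]) (Br 2 9 (Us p57
    [4,1,0,3,6,5,2,9,7,8,10]) (Br 2 10 (Us p57 [4,1,0,3,6,5,2,10,7,8,9]) (Br 6 4 (Us p36
    [0,3,1,4,2,6,5,7,8,9,10]) (Br 4 7 (Us p57 [7,4,3,6,5,2,1,0,8,9,10]) (Br 6 8 (Us p57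
    [4,3,0,1,2,5,6,8,7,9,10]) (Sw p34 [4,7,6,0,8,9,2,10,1,3,5]) (Br 6 9 (Us p57
    [4,3,0,1,2,5,6,9,7,8,10]) (Sw p34 [4,7,6,0,9,8,2,10,1,3,5]) (Br 6 10 (Us p57
    [4,3,0,1,2,5,6,10,7,8,9]) (Sw p34 [4,7,6,0,10,8,2,9,1,3,5]) (St 6 9 8 10)))) (Cl 4 0 7)) (Cl 4 0
    6)) (Cl 2 0 10)) (Cl 2 0 9)) (Cl 2 0 8)) (St 0 2 4 10)) (St 0 2 4 9)) (St 0 2 4 8)) (St 0 2 4 7))
    (St 0 2 6 4)"])
    (simp only: check known cong: imp_cong)

definition "p59 = ([(Red,[1,0,4,3,6,2,1,5,4]), (Blue,[0,2,5,3,0]), (Unc,[0,5,7])] :: pattern)"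
lemmas [known] = p59_def[THEN inst_cong] p59_def[THEN holds_cong]
lemma [known]: "unsat p59"
  by (rule unsatI[where t = "
    Br 0 7 (Us p57 [5,4,3,6,2,1,0,7,8,9,10]) (Cl 5 7 0) (Br 0 8 (Us p57 [5,4,3,6,2,1,0,8,7,9,10]) (Br
    0 9 (Us p57 [5,4,3,6,2,1,0,9,7,8,10]) (Br 0 10 (Us p57 [5,4,3,6,2,1,0,10,7,8,9]) (Br 1 7 (Br 2 7
    (Us p57 [5,1,0,4,3,6,2,7,8,9,10]) (Br 6 7 (Us p58 [0,1,7,4,5,6,3,2,8,9,10]) (Tw 5 7 6 (Br 2 8 (Us
    p57 [5,1,0,4,3,6,2,8,7,9,10]) (Sw p34 [6,7,5,2,3,8,0,9,1,4,10]) (Br 2 9 (Us p57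
    [5,1,0,4,3,6,2,9,7,8,10]) (Sw p34 [6,7,5,2,3,9,0,8,1,4,10]) (Br 2 10 (Us p57
    [5,1,0,4,3,6,2,10,7,8,9]) (Sw p34 [6,7,5,2,3,10,0,8,1,4,9]) (St 2 9 8 10))))) (Us p53
    [2,6,0,3,7,1,4,5,8,9,10])) (Cl 7 5 2)) (Cl 5 7 1) (Us p53 [0,1,2,5,7,6,4,3,8,9,10])) (St 0 7 5
    10)) (St 0 7 5 9)) (St 0 7 5 8))"])
    (simp only: check known cong: imp_cong)

definition "p60 = ([(Red,[7,1,0,3,2,8,9]), (Blue,[6,0,2,7,4,0,5,7]), (Blue,[8,10])] :: pattern)"
lemmas [known] = p60_def[THEN inst_cong] p60_def[THEN holds_cong]
lemma [known]: "unsat p60"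
  by (rule unsatI[where t = "
    Br 9 10 (Us p57 [7,1,0,3,2,8,9,10,4,5,6]) (Br 9 4 (Us p57 [7,1,0,3,2,8,9,4,5,6,10]) (Sw p57
    [8,10,9,4,0,2,7,5,1,3,6]) (Br 9 5 (Us p57 [7,1,0,3,2,8,9,5,4,6,10]) (Sw p57
    [8,10,9,5,0,2,7,4,1,3,6]) (Br 9 6 (Us p57 [7,1,0,3,2,8,9,6,4,5,10]) (Sw p57
    [8,10,9,6,0,2,7,4,1,3,5]) (St 9 5 4 6)))) (Cl 9 10 8)"])
    (simp only: check known cong: imp_cong)

definition "p61 = ([(Red,[1,0,4,3,7,2,1,6,4]), (Red,[5,7,10]), (Blue,[0,2,6,5,0,3]), (Blue,[4,8]), (Blue,[6,9])] :: pattern)"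
lemmas [known] = p61_def[THEN inst_cong] p61_def[THEN holds_cong]
lemma [known]: "unsat p61"
  by (rule unsatI[where t = "
    Br 3 8 (Us p57 [6,4,0,1,2,7,3,8,5,9,10]) (Br 1 5 (Br 2 3 (Us p57 [10,7,2,3,4,0,1,6,5,8,9]) (Sw p57
    [4,8,3,2,0,5,6,9,1,7,10]) (Br 2 5 (Us p57 [6,1,0,4,3,7,2,5,8,9,10]) (Sw p57
    [4,8,3,0,2,5,6,9,1,7,10]) (Us p58 [2,7,3,1,5,4,0,6,8,9,10]))) (Sw p57 [4,8,3,0,2,6,5,1,7,9,10])
    (Us p53 [0,1,2,6,5,7,4,3,8,9,10])) (Cl 3 8 4)"])
    (simp only: check known cong: imp_cong)

definition "p62 = ([(Red,[2,1,0,4,2,9,3,1,5,4,6,9,5]), (Red,[1,8]), (Red,[3,4]), (Red,[9,10]),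
    (Blue,[2,0,3,8,5,0,6,8,9]), (Blue,[0,7])] :: pattern)"
lemmas [known] = p62_def[THEN inst_cong] p62_def[THEN holds_cong]
lemma [known]: "unsat p62"
  by (rule unsatI[where t = "
    Br 2 3 (Us p57 [10,9,2,3,4,0,1,8,5,6,7]) (Br 2 5 (Us p57 [8,1,0,4,3,9,2,5,6,7,10]) (Br 2 6 (Us p57
    [8,1,0,4,3,9,2,6,5,7,10]) (Us p60 [0,1,5,4,3,6,7,2,9,10,8]) (Us p43 [8,3,9,5,0,1,2,4,6,7,10])) (Us
    p43 [8,3,9,6,0,1,2,4,5,7,10])) (Us p43 [8,5,9,6,0,1,2,4,3,7,10])"])
    (simp only: check known cong: imp_cong)

definition "p63 = ([(Red,[0,1,4,2,0,3,7,1,6,2,8,1,9,2,7]), (Red,[8,3,9]), (Red,[2,10]), (Blue,[4,0,5,8,9]),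
    (Blue,[8,10]), (Unc,[7,9])] :: pattern)"
lemmas [known] = p63_def[THEN inst_cong] p63_def[THEN holds_cong]
lemma [known]: "unsat p63"
  by (rule unsatI[where t = "
    Br 6 7 (Us p57 [10,2,6,7,3,0,1,8,4,5,9]) (Br 6 9 (Us p57 [8,1,0,3,7,2,6,9,4,5,10]) (Br 7 4 (Us p57
    [8,3,0,1,6,2,7,4,5,9,10]) (Sw p26 [6,7,9,4,8,3,0,1,2,5,10]) (Us p58 [7,1,9,2,4,3,0,5,6,8,10])) (Us
    p58 [9,1,7,2,6,3,0,4,5,8,10])) (Us p58 [7,1,9,2,6,3,0,4,5,8,10])"])
    (simp only: check known cong: imp_cong)

definition "p64 = ([(Red,[0,1,3,5,6,4,2]), (Unc,[0,2])] :: pattern)"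
lemmas [known] = p64_def[THEN inst_cong] p64_def[THEN holds_cong]
text \<open>The twin ends 0 and 2 both see 1 and 4 in red, so each of them closes the inner path
  1-3-5-6-4 to a red \<open>C6\<close>.\<close>

lemma [known]: "unsat p64"
  by (rule unsatI[where t = "
    Tw 0 2 4 (Tw 2 0 1 (Br 0 3 (Us p36 [1,2,0,4,3,6,5,7,8,9,10]) (Br 0 6 (Us p36
    [1,2,3,4,5,0,6,7,8,9,10]) (Br 3 2 (Us p36 [1,2,0,3,4,5,6,7,8,9,10]) (Br 6 2 (Us p36
    [0,4,1,2,3,6,5,7,8,9,10]) (Br 2 9 (Us p57 [9,2,4,6,5,3,1,0,7,8,10]) (Br 0 7 (Us p57
    [2,4,6,5,3,1,0,7,8,9,10]) (Br 0 8 (Us p57 [2,4,6,5,3,1,0,8,7,9,10]) (Br 0 9 (Us p57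
    [2,4,6,5,3,1,0,9,7,8,10]) (Br 0 10 (Us p57 [2,4,6,5,3,1,0,10,7,8,9]) (Br 2 7 (Us p57
    [7,2,4,6,5,3,1,0,8,9,10]) (Br 2 8 (Us p57 [8,2,4,6,5,3,1,0,7,9,10]) (Br 2 10 (Us p57
    [10,2,4,6,5,3,1,0,7,8,9]) (Br 5 10 (Br 5 7 (Br 5 8 (Br 5 9 (Br 4 9 (Br 1 6 (Br 1 7 (Br 1 8 (Br 1 9
    (Br 3 4 (Br 4 7 (Br 4 8 (Br 5 2 (Br 0 5 (Br 6 7 (Us p57 [2,4,0,1,3,5,6,7,8,9,10]) (Br 3 6 (Us p57
    [10,5,3,6,4,0,1,2,7,8,9]) (Br 3 8 (Us p57 [2,1,0,4,6,5,3,8,7,9,10]) (Sw p26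
    [3,6,8,7,2,4,0,1,5,9,10]) (Us p63 [0,1,5,4,6,7,9,3,2,8,10])) (Us p63 [0,1,5,4,7,8,9,3,2,6,10]))
    (Us p63 [0,1,5,4,8,9,3,6,2,7,10])) (Us p62 [2,1,3,6,4,7,8,9,0,5,10]) (Cl 5 0 3)) (Us p62
    [0,1,3,6,4,7,8,9,2,5,10]) (Cl 5 2 3)) (Us p61 [0,1,3,6,4,7,2,5,8,10,9]) (Us p53
    [0,4,6,2,8,5,1,3,7,9,10])) (Us p61 [0,1,3,6,4,8,2,5,7,10,9]) (Us p53 [0,4,6,2,7,5,1,3,8,9,10]))
    (Us p61 [0,1,6,9,4,7,2,5,3,10,8]) (Cl 4 3 0)) (Us p61 [0,4,6,3,1,7,2,5,9,10,8]) (Us p53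
    [0,1,3,2,9,5,4,6,7,8,10])) (Us p61 [0,4,6,3,1,7,2,5,8,10,9]) (Us p53 [0,1,3,2,8,5,4,6,7,9,10]))
    (Us p61 [0,4,6,3,1,8,2,5,7,10,9]) (Us p53 [0,1,3,2,7,5,4,6,8,9,10])) (Us p61
    [0,4,9,3,1,7,2,5,6,10,8]) (Cl 1 6 0)) (Us p61 [0,1,3,6,4,7,2,5,9,8,10]) (Us p53
    [0,4,6,2,9,5,1,3,7,8,10])) (Us p60 [0,1,6,4,7,8,10,2,5,3,9]) (Us p53 [3,5,0,6,9,1,4,2,7,8,10]))
    (Us p60 [0,1,6,4,7,9,10,2,5,3,8]) (Us p53 [3,5,0,6,8,1,4,2,7,9,10])) (Us p60
    [0,1,6,4,8,9,10,2,5,3,7]) (Us p53 [3,5,0,6,7,1,4,2,8,9,10])) (Us p60 [0,1,6,4,7,8,9,2,5,3,10]) (Us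
    p53 [3,5,0,6,10,1,4,2,7,8,9])) (Us p59 [0,1,3,6,4,2,5,10,7,8,9])) (Us p59
    [0,1,3,6,4,2,5,8,7,9,10])) (Us p59 [0,1,3,6,4,2,5,7,8,9,10])) (Us p59 [2,1,3,6,4,0,5,10,7,8,9]))
    (Us p59 [2,1,3,6,4,0,5,9,7,8,10])) (Us p59 [2,1,3,6,4,0,5,8,7,9,10])) (Us p59
    [2,1,3,6,4,0,5,7,8,9,10])) (Us p59 [0,1,3,6,4,2,5,9,7,8,10])) (Us p58 [2,4,6,1,0,5,3,7,8,9,10]))
    (Us p58 [2,1,3,4,0,5,6,7,8,9,10])) (Us p58 [0,4,6,1,2,5,3,7,8,9,10])) (Us p58
    [0,1,3,4,2,5,6,7,8,9,10])))"])
    (simp only: check known cong: imp_cong)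

definition "p65 = ([(Red,[0,1,2,3,4]), (Red,[5,6,7]), (Unc,[3,5])] :: pattern)"
lemmas [known] = p65_def[THEN inst_cong] p65_def[THEN holds_cong]
text \<open>The twin 5 of 3 also sees 4 in red, which joins the two paths to a path on eight
  vertices.\<close>

lemma [known]: "unsat p65"
  by (rule unsatI[where t = "
    Tw 5 3 4 (Us p57 [7,6,5,4,3,2,1,0,8,9,10])"])
    (simp only: check known cong: imp_cong)

definition "p66 = ([(Red,[0,1,2,6,3,7,5,1]), (Red,[4,7]), (Red,[5,6]), (Blue,[7,8]), (Blue,[0,2,4,0,3,4,5,0])] :: pattern)"
lemmas [known] = p66_def[THEN inst_cong] p66_def[THEN holds_cong]
lemma [known]: "unsat p66"
  by (rule unsatI[where t = "
    Br 3 8 (Us p57 [0,1,2,6,5,7,3,8,4,9,10]) (Br 0 9 (Us p57 [4,7,3,6,2,1,0,9,5,8,10]) (Br 1 9 (Br 2 9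
    (Us p57 [0,1,5,7,3,6,2,9,4,8,10]) (Sw p57 [7,8,3,0,5,4,2,9,1,6,10]) (Us p64
    [9,1,2,5,6,7,3,0,4,8,10])) (Sw p57 [1,9,0,2,4,3,8,7,5,6,10]) (Us p53 [0,1,4,2,9,7,6,3,5,8,10]))
    (Sw p53 [5,0,7,2,9,8,4,3,1,6,10])) (Cl 3 8 7)"])
    (simp only: check known cong: imp_cong)

definition "p67 = ([(Red,[0,1,4,7,2,6,5,1]), (Red,[3,7]), (Red,[4,6]), (Blue,[2,0,3]), (Blue,[0,4])] :: pattern)"
lemmas [known] = p67_def[THEN inst_cong] p67_def[THEN holds_cong]
lemma [known]: "unsat p67"
  by (rule unsatI[where t = "
    Br 0 5 (Us p34 [5,0,6,1,2,4,7,3,8,9,10]) (Br 5 3 (Us p57 [4,6,2,7,3,5,1,0,8,9,10]) (Br 2 3 (Us p57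
    [4,7,3,2,6,5,1,0,8,9,10]) (Br 3 4 (Us p57 [4,3,7,2,6,5,1,0,8,9,10]) (Br 7 9 (Br 0 9 (Us p57
    [3,7,2,6,5,1,0,9,4,8,10]) (Br 1 8 (Br 1 9 (Br 5 2 (Us p57 [3,7,4,6,2,5,1,0,8,9,10]) (Br 5 8 (Us
    p57 [0,1,4,7,2,6,5,8,3,9,10]) (Br 8 9 (Us p57 [8,9,7,2,6,5,1,0,3,4,10]) (Sw p35
    [5,8,2,9,3,0,4,1,6,7,10]) (Us p64 [8,1,9,5,7,6,2,0,3,4,10])) (Us p64 [8,1,5,4,6,7,2,0,3,9,10]))
    (Us p64 [5,1,2,9,6,7,4,0,3,8,10])) (Us p66 [3,7,2,5,0,4,6,1,9,8,10]) (Us p53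
    [0,1,3,5,9,7,6,2,4,8,10])) (Us p66 [3,7,2,5,0,4,6,1,8,9,10]) (Us p53 [0,1,3,5,8,7,6,2,4,9,10]))
    (Us p64 [9,7,0,2,1,6,5,3,4,8,10])) (Us p66 [0,1,5,2,3,4,6,7,9,8,10]) (Us p53
    [3,7,0,2,9,1,6,5,4,8,10])) (Us p64 [4,1,3,5,7,6,2,0,8,9,10])) (Us p64 [3,7,2,4,6,1,5,0,8,9,10]))
    (Us p64 [5,1,3,4,7,6,2,0,8,9,10])) (Us p64 [0,1,5,4,6,7,2,3,8,9,10])"])
    (simp only: check known cong: imp_cong)

definition "p68 = ([(Red,[0,1,4,6,3,5,7,6]), (Red,[2,5]), (Blue,[2,0,3])] :: pattern)"
lemmas [known] = p68_def[THEN inst_cong] p68_def[THEN holds_cong]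
lemma [known]: "unsat p68"
  by (rule unsatI[where t = "
    Br 0 7 (Us p34 [1,4,0,6,7,3,5,2,8,9,10]) (Br 1 3 (Us p67 [0,1,7,2,3,4,6,5,8,9,10]) (Br 1 7 (Us p67
    [0,1,3,2,7,4,6,5,8,9,10]) (Br 4 7 (Us p57 [2,5,3,6,7,4,1,0,8,9,10]) (Br 4 3 (Us p57
    [2,5,7,6,3,4,1,0,8,9,10]) (Br 1 8 (Br 7 8 (Us p57 [0,1,4,6,3,5,7,8,2,9,10]) (Br 2 8 (Us p57
    [8,2,5,7,6,4,1,0,3,9,10]) (Br 0 4 (Us p57 [8,1,0,4,6,7,5,2,3,9,10]) (Sw p35
    [2,8,0,7,4,1,3,6,5,9,10]) (Sw p64 [0,2,4,8,3,7,1,5,6,9,10])) (Us p64 [8,1,2,4,5,6,7,0,3,9,10]))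
    (Cl 8 7 1)) (Br 2 8 (Us p57 [8,2,5,7,6,4,1,0,3,9,10]) (Sw p35 [1,8,7,2,4,0,3,6,5,9,10]) (Sw p64
    [8,1,2,7,0,4,3,5,6,9,10])) (Us p53 [0,1,2,4,8,5,6,7,3,9,10])) (Cl 4 3 1)) (Cl 4 7 1)) (Us p53
    [0,1,2,4,7,5,6,3,8,9,10])) (Us p53 [0,1,2,4,3,5,6,7,8,9,10])) (Us p64 [7,5,0,3,1,6,4,2,8,9,10])"])
    (simp only: check known cong: imp_cong)

definition "p69 = ([(Red,[0,1,3,7,5,6,2]), (Red,[1,4]), (Blue,[0,2,5,8,7])] :: pattern)"
lemmas [known] = p69_def[THEN inst_cong] p69_def[THEN holds_cong]
lemma [known]: "unsat p69"
  by (rule unsatI[where t = "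
    Br 2 4 (Us p57 [4,2,6,5,7,3,1,0,8,9,10]) (Br 0 7 (Us p68 [2,6,4,0,5,1,7,3,8,9,10]) (Br 0 3 (Us p57
    [4,1,0,3,7,5,6,2,8,9,10]) (Br 3 4 (Us p57 [0,1,4,3,7,5,6,2,8,9,10]) (Sw p35
    [0,3,7,4,8,2,5,6,1,9,10]) (Sw p64 [3,0,4,7,2,8,5,1,6,9,10])) (Cl 3 0 7)) (Us p65
    [2,6,5,7,3,0,1,4,8,9,10])) (Us p64 [4,1,2,3,6,7,5,0,8,9,10])"])
    (simp only: check known cong: imp_cong)

definition "p70 = ([(Red,[0,1,3,5,6,4,2]), (Red,[4,7]), (Blue,[0,2])] :: pattern)"
lemmas [known] = p70_def[THEN inst_cong] p70_def[THEN holds_cong]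
lemma [known]: "unsat p70"
  by (rule unsatI[where t = "
    Br 0 7 (Us p57 [2,4,6,5,3,1,0,7,8,9,10]) (Br 5 7 (Us p68 [0,1,2,7,3,4,5,6,8,9,10]) (Br 5 2 (Us p68
    [0,1,7,2,3,4,5,6,8,9,10]) (Br 6 2 (Us p57 [7,4,2,6,5,3,1,0,8,9,10]) (Br 6 7 (Us p57
    [2,4,7,6,5,3,1,0,8,9,10]) (Br 1 10 (Us p69 [0,1,2,3,10,6,4,5,7,8,9]) (Br 0 10 (Us p57
    [2,4,6,5,3,1,0,10,7,8,9]) (Br 1 8 (Us p69 [0,1,2,3,8,6,4,5,7,9,10]) (Sw p57
    [8,1,10,0,2,5,7,6,3,4,9]) (Us p53 [0,1,2,3,8,4,5,6,7,9,10])) (Cl 0 10 1)) (Us p53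
    [0,1,2,3,10,4,5,6,7,8,9])) (Cl 6 7 5)) (Cl 6 2 5)) (Us p65 [0,1,3,5,6,2,4,7,8,9,10])) (Us p65
    [0,1,3,5,6,7,4,2,8,9,10])) (Us p64 [7,4,0,6,1,5,3,2,8,9,10])"])
    (simp only: check known cong: imp_cong)

definition "p71 = ([(Red,[0,1,2,3,4,5,6])] :: pattern)"
lemmas [known] = p71_def[THEN inst_cong] p71_def[THEN holds_cong]
text \<open>The ends are joined in blue: red gives a \<open>C7\<close>, twins give
  \<open>p64\<close>. Red edges to the outside are excluded at the second vertices 1 and 5 by
  \<open>p70\<close>, and at the ends by \<open>p57\<close>. The blue pairs then contain the
  \<open>C7\<close> 0-6-7-5-9-1-8 with the pendant edge 0-10.\<close>

lemma [known]: "unsat p71"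
  by (rule unsatI[where t = "
    Br 0 6 (Us p36 [5,6,4,0,3,1,2,7,8,9,10]) (Br 5 9 (Us p70 [0,1,6,2,5,3,4,9,7,8,10]) (Br 1 8 (Us p70
    [6,5,0,4,1,3,2,8,7,9,10]) (Br 0 8 (Us p57 [6,5,4,3,2,1,0,8,7,9,10]) (Br 1 9 (Us p70
    [6,5,0,4,1,3,2,9,7,8,10]) (Br 1 10 (Us p70 [6,5,0,4,1,3,2,10,7,8,9]) (Br 0 10 (Us p57
    [6,5,4,3,2,1,0,10,7,8,9]) (Br 5 7 (Us p70 [0,1,6,2,5,3,4,7,8,9,10]) (Br 6 7 (Us p57
    [7,6,5,4,3,2,1,0,8,9,10]) (Sw p34 [5,9,7,1,6,8,0,10,2,3,4]) (Cl 6 7 5)) (Us p53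
    [6,5,0,4,7,1,3,2,8,9,10])) (Cl 0 10 1)) (Us p53 [0,1,6,2,10,5,3,4,7,8,9])) (Us p53
    [0,1,6,2,9,5,3,4,7,8,10])) (Cl 0 8 1)) (Us p53 [0,1,6,2,8,5,3,4,7,9,10])) (Us p53
    [6,5,0,4,9,1,3,2,7,8,10])) (Us p64 [0,1,6,2,5,3,4,7,8,9,10])"])
    (simp only: check known cong: imp_cong)

section \<open>Excluding a red path on six vertices\<close>

definition "p72 = ([(Red,[0,1,2,3,4,5]), (Unc,[4,6])] :: pattern)"
lemmas [known] = p72_def[THEN inst_cong] p72_def[THEN holds_cong]
text \<open>The twin 6 of the second last vertex 4 sees the end 5 in red as well and prolongs the
  path. The same argument gives \<open>p79\<close>, \<open>p93\<close> and \<open>p97\<close> for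
  shorter paths.\<close>

lemma [known]: "unsat p72"
  by (rule unsatI[where t = "
    Tw 6 4 5 (Us p71 [6,5,4,3,2,1,0,7,8,9,10])"])
    (simp only: check known cong: imp_cong)

definition "p73 = ([(Red,[0,1,2,4,6,8]), (Blue,[2,0,3,2,5,4,7])] :: pattern)"
lemmas [known] = p73_def[THEN inst_cong] p73_def[THEN holds_cong]
lemma [known]: "unsat p73"
  by (rule unsatI[where t = "
    Br 0 9 (Us p71 [8,6,4,2,1,0,9,3,5,7,10]) (Sw p71 [9,0,3,2,5,4,7,1,6,8,10]) (Sw p72
    [7,4,5,2,0,3,9,1,6,8,10])"])
    (simp only: check known cong: imp_cong)

text \<open>A red \<open>C5\<close> 1-2-4-5-3 with pendant edges 1-0 and 5-6 at two nonadjacent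
  vertices.\<close>

definition "p74 = ([(Red,[0,1,2,4,5,3,1]), (Red,[5,6])] :: pattern)"
lemmas [known] = p74_def[THEN inst_cong] p74_def[THEN holds_cong]
lemma [known]: "unsat p74"
  by (rule unsatI[where t = "
    Br 0 2 (Us p71 [3,1,0,2,4,5,6,7,8,9,10]) (Br 2 7 (Us p71 [0,1,3,5,4,2,7,6,8,9,10]) (Br 2 8 (Us p71
    [0,1,3,5,4,2,8,6,7,9,10]) (Br 2 9 (Us p71 [0,1,3,5,4,2,9,6,7,8,10]) (Br 4 7 (Us p71
    [6,5,3,1,2,4,7,0,8,9,10]) (Br 4 8 (Us p71 [6,5,3,1,2,4,8,0,7,9,10]) (Br 4 9 (Us p71
    [6,5,3,1,2,4,9,0,7,8,10]) (Br 0 9 (Us p71 [3,5,4,2,1,0,9,6,7,8,10]) (Us p73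
    [0,1,2,9,4,7,5,8,6,3,10]) (Br 0 3 (Us p71 [6,5,4,2,1,0,3,7,8,9,10]) (Sw p72
    [8,4,7,2,0,3,9,1,5,6,10]) (Br 0 7 (Us p71 [3,5,4,2,1,0,7,6,8,9,10]) (Us p73
    [0,1,2,7,4,8,5,9,3,6,10]) (St 0 3 7 9)))) (Us p72 [0,1,3,5,4,2,9,6,7,8,10])) (Us p72
    [0,1,3,5,4,2,8,6,7,9,10])) (Us p72 [0,1,3,5,4,2,7,6,8,9,10])) (Us p72 [6,5,3,1,2,4,9,0,7,8,10]))
    (Us p72 [6,5,3,1,2,4,8,0,7,9,10])) (Us p72 [6,5,3,1,2,4,7,0,8,9,10])) (Us p72
    [6,5,3,1,2,4,0,7,8,9,10])"])
    (simp only: check known cong: imp_cong)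

definition "p75 = ([(Red,[0,1,3,5,6,4]), (Blue,[0,2,1,4]), (Blue,[6,7])] :: pattern)"
lemmas [known] = p75_def[THEN inst_cong] p75_def[THEN holds_cong]
lemma [known]: "unsat p75"
  by (rule unsatI[where t = "
    Br 4 7 (Us p71 [7,4,6,5,3,1,0,2,8,9,10]) (Br 0 8 (Us p71 [4,6,5,3,1,0,8,2,7,9,10]) (Sw p71
    [6,7,4,1,2,0,8,3,5,9,10]) (Br 0 3 (Us p72 [4,6,5,3,0,1,8,2,7,9,10]) (Sw p71
    [6,7,4,1,2,0,3,5,8,9,10]) (Br 0 9 (Us p71 [4,6,5,3,1,0,9,2,7,8,10]) (Sw p71
    [6,7,4,1,2,0,9,3,5,8,10]) (St 0 3 8 9)))) (Cl 4 7 6)"])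
    (simp only: check known cong: imp_cong)

definition "p76 = ([(Red,[0,1,2,3,4,5]), (Red,[4,6])] :: pattern)"
lemmas [known] = p76_def[THEN inst_cong] p76_def[THEN holds_cong]
text \<open>By \<open>p75\<close> and \<open>p72\<close>, vertex 4 sees 7, 8 and 9 in red too, while
  0 and 1 see its leaves 5, 6, 7 and 8 in blue. A blue pair 5-7 or 5-8 then produces
  \<open>p74\<close> with the colors swapped, and a red one prolongs the path.\<close>

lemma [known]: "unsat p76"
  by (rule unsatI[where t = "
    Br 1 5 (Us p74 [0,1,2,5,3,4,6,7,8,9,10]) (Br 0 5 (Us p71 [6,4,3,2,1,0,5,7,8,9,10]) (Br 1 6 (Us p74
    [0,1,2,6,3,4,5,7,8,9,10]) (Br 0 6 (Us p71 [5,4,3,2,1,0,6,7,8,9,10]) (Br 4 8 (Br 1 8 (Us p74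
    [5,4,3,8,2,1,0,6,7,9,10]) (Br 0 8 (Us p71 [5,4,3,2,1,0,8,6,7,9,10]) (Br 4 7 (Br 1 7 (Us p74
    [5,4,3,7,2,1,0,6,8,9,10]) (Br 0 7 (Us p71 [5,4,3,2,1,0,7,6,8,9,10]) (Br 4 9 (Br 1 9 (Us p74
    [5,4,3,9,2,1,0,6,7,8,10]) (Br 5 7 (Us p71 [7,5,4,3,2,1,0,6,8,9,10]) (Sw p74
    [9,1,5,8,7,0,6,2,3,4,10]) (Br 3 5 (Us p71 [6,4,5,3,2,1,0,7,8,9,10]) (Sw p72
    [9,1,8,0,5,3,7,2,4,6,10]) (Br 5 8 (Us p71 [8,5,4,3,2,1,0,6,7,9,10]) (Sw p74
    [9,1,5,7,8,0,6,2,3,4,10]) (St 5 3 7 8)))) (Us p72 [5,4,3,2,1,0,9,6,7,8,10])) (Us p75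
    [0,1,5,2,6,3,4,9,7,8,10]) (Us p72 [0,1,2,3,4,5,9,6,7,8,10])) (Cl 0 7 1)) (Us p72
    [5,4,3,2,1,0,7,6,8,9,10])) (Us p75 [0,1,5,2,6,3,4,7,8,9,10]) (Us p72 [0,1,2,3,4,5,7,6,8,9,10]))
    (Cl 0 8 1)) (Us p72 [5,4,3,2,1,0,8,6,7,9,10])) (Us p75 [0,1,6,2,5,3,4,8,7,9,10]) (Us p72
    [0,1,2,3,4,5,8,6,7,9,10])) (Cl 0 6 1)) (Us p72 [5,4,3,2,1,0,6,7,8,9,10])) (Cl 0 5 1)) (Us p72
    [6,4,3,2,1,0,5,7,8,9,10])"])
    (simp only: check known cong: imp_cong)

definition "p77 = ([(Red,[0,1,2,3,4,5]), (Blue,[4,6])] :: pattern)"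
lemmas [known] = p77_def[THEN inst_cong] p77_def[THEN holds_cong]
lemma [known]: "unsat p77"
  by (rule unsatI[where t = "
    Br 1 7 (Us p76 [5,4,3,2,1,0,7,6,8,9,10]) (Br 0 7 (Us p71 [5,4,3,2,1,0,7,6,8,9,10]) (Br 1 8 (Us p76
    [5,4,3,2,1,0,8,6,7,9,10]) (Br 0 8 (Us p71 [5,4,3,2,1,0,8,6,7,9,10]) (Br 1 9 (Us p76
    [5,4,3,2,1,0,9,6,7,8,10]) (Br 4 7 (Us p76 [0,1,2,3,4,5,7,6,8,9,10]) (Sw p71
    [9,1,8,0,7,4,6,2,3,5,10]) (Us p72 [0,1,2,3,4,5,7,6,8,9,10])) (Us p72 [5,4,3,2,1,0,9,6,7,8,10]))
    (Cl 0 8 1)) (Us p72 [5,4,3,2,1,0,8,6,7,9,10])) (Cl 0 7 1)) (Us p72 [5,4,3,2,1,0,7,6,8,9,10])"])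
    (simp only: check known cong: imp_cong)

definition "p78 = ([(Red,[0,1,2,3,4,5])] :: pattern)"
lemmas [known] = p78_def[THEN inst_cong] p78_def[THEN holds_cong]
text \<open>The second last vertex 4 sees the outside vertex 9 in some color: \<open>p76\<close>,
  \<open>p77\<close> and \<open>p72\<close> cover the three cases. The path on five vertices in
  \<open>p92\<close> is settled by the same split.\<close>

lemma [known]: "unsat p78"
  by (rule unsatI[where t = "
    Br 4 9 (Us p76 [0,1,2,3,4,5,9,6,7,8,10]) (Us p77 [0,1,2,3,4,5,9,6,7,8,10]) (Us p72
    [0,1,2,3,4,5,9,6,7,8,10])"])
    (simp only: check known cong: imp_cong)

section \<open>Excluding a red path on five vertices\<close>

definition "p79 = ([(Red,[0,1,2,4,5]), (Unc,[1,3])] :: pattern)"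
lemmas [known] = p79_def[THEN inst_cong] p79_def[THEN holds_cong]
lemma [known]: "unsat p79"
  by (rule unsatI[where t = "
    Tw 3 1 0 (Us p78 [5,4,2,1,0,3,6,7,8,9,10])"])
    (simp only: check known cong: imp_cong)

definition "p80 = ([(Red,[0,1,2,6,3]), (Red,[1,5]), (Blue,[3,1,4,5])] :: pattern)"
lemmas [known] = p80_def[THEN inst_cong] p80_def[THEN holds_cong]
lemma [known]: "unsat p80"
  by (rule unsatI[where t = "
    Br 0 3 (Us p78 [5,1,0,3,6,2,4,7,8,9,10]) (Br 0 2 (Us p78 [5,1,0,2,6,3,4,7,8,9,10]) (Sw p78
    [2,0,3,1,4,5,6,7,8,9,10]) (Br 0 7 (Us p78 [3,6,2,1,0,7,4,5,8,9,10]) (Sw p78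
    [7,0,3,1,4,5,2,6,8,9,10]) (Br 0 5 (Us p78 [3,6,2,1,0,5,4,7,8,9,10]) (Sw p79
    [3,0,5,2,4,1,6,7,8,9,10]) (St 0 7 2 5)))) (Cl 0 3 1)"])
    (simp only: check known cong: imp_cong)

definition "p81 = ([(Red,[0,1,3]), (Red,[2,4,5]), (Unc,[1,2])] :: pattern)"
lemmas [known] = p81_def[THEN inst_cong] p81_def[THEN holds_cong]
lemma [known]: "unsat p81"
  by (rule unsatI[where t = "
    Tw 2 1 0 (Us p78 [3,1,0,2,4,5,6,7,8,9,10])"])
    (simp only: check known cong: imp_cong)

definition "p82 = ([(Red,[0,1,3,6,4,1,5]), (Blue,[0,2,1]), (Blue,[3,2,4]), (Blue,[6,7])] :: pattern)"
lemmas [known] = p82_def[THEN inst_cong] p82_def[THEN holds_cong]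
lemma [known]: "unsat p82"
  by (rule unsatI[where t = "
    Br 3 7 (Us p76 [7,3,6,4,1,0,5,2,8,9,10]) (Br 0 3 (Us p78 [5,1,0,3,6,4,2,7,8,9,10]) (Sw p76
    [6,7,3,0,2,1,4,5,8,9,10]) (Br 0 4 (Us p78 [5,1,0,4,6,3,2,7,8,9,10]) (Sw p77
    [6,7,3,2,0,4,1,5,8,9,10]) (Br 0 5 (Us p78 [4,6,3,1,0,5,2,7,8,9,10]) (Sw p77
    [6,7,3,2,0,5,1,4,8,9,10]) (St 0 4 3 5)))) (Cl 3 7 6)"])
    (simp only: check known cong: imp_cong)

definition "p83 = ([(Red,[5,6,3,1,4,6,7]), (Red,[0,1]), (Blue,[0,2,5,4,3]), (Blue,[1,2])] :: pattern)"
lemmas [known] = p83_def[THEN inst_cong] p83_def[THEN holds_cong]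
lemma [known]: "unsat p83"
  by (rule unsatI[where t = "
    Br 0 4 (Us p78 [7,6,3,1,0,4,2,5,8,9,10]) (Sw p80 [3,4,0,1,6,5,2,7,8,9,10]) (Sw p79
    [3,4,5,0,2,1,6,7,8,9,10])"])
    (simp only: check known cong: imp_cong)

definition "p84 = ([(Red,[0,1,3,7,4,1,5,7,6,1]), (Blue,[0,2,5,6,2,1])] :: pattern)"
lemmas [known] = p84_def[THEN inst_cong] p84_def[THEN holds_cong]
lemma [known]: "unsat p84"
  by (rule unsatI[where t = "
    Br 3 6 (Us p76 [6,3,7,4,1,0,5,2,8,9,10]) (Us p83 [0,1,2,3,6,5,7,4,8,9,10]) (Br 3 5 (Us p78
    [0,1,5,3,7,4,2,6,8,9,10]) (Us p83 [0,1,2,3,5,6,7,4,8,9,10]) (Cl 3 6 5))"])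
    (simp only: check known cong: imp_cong)

definition "p85 = ([(Red,[0,1,2,5,6]), (Red,[1,4]), (Blue,[1,3])] :: pattern)"
lemmas [known] = p85_def[THEN inst_cong] p85_def[THEN holds_cong]
lemma [known]: "unsat p85"
  by (rule unsatI[where t = "
    Br 0 3 (Us p78 [6,5,2,1,0,3,4,7,8,9,10]) (Br 3 4 (Us p78 [3,4,1,2,5,6,0,7,8,9,10]) (Br 1 6 (Br 2 3
    (Us p76 [3,2,5,6,1,0,4,7,8,9,10]) (Br 6 3 (Us p78 [3,6,5,2,1,0,4,7,8,9,10]) (Br 5 7 (Br 1 7 (Br 0
    5 (Br 5 4 (Br 3 7 (Us p76 [3,7,5,2,1,0,6,4,8,9,10]) (Br 0 2 (Us p78 [4,1,0,2,5,6,3,7,8,9,10]) (Us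
    p84 [6,1,3,7,4,0,2,5,8,9,10]) (Br 0 6 (Us p78 [4,1,0,6,5,2,3,7,8,9,10]) (Us p84
    [2,1,3,7,4,0,6,5,8,9,10]) (Br 0 7 (Us p78 [6,5,2,1,0,7,3,4,8,9,10]) (Us p84
    [2,1,3,6,4,0,7,5,8,9,10]) (St 0 6 2 7)))) (Cl 7 3 1)) (Us p82 [0,1,3,2,6,7,5,4,8,9,10]) (Us p79
    [6,5,2,4,1,0,3,7,8,9,10])) (Us p82 [4,1,3,2,6,7,5,0,8,9,10]) (Us p79 [6,5,2,0,1,4,3,7,8,9,10]))
    (Us p80 [0,1,2,7,3,6,5,4,8,9,10]) (Us p79 [0,1,2,7,5,6,3,4,8,9,10])) (Us p82
    [0,1,3,2,6,4,5,7,8,9,10]) (Us p79 [6,5,2,7,1,0,3,4,8,9,10])) (Cl 6 3 1)) (Cl 2 3 1)) (Us p80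
    [0,1,2,6,3,4,5,7,8,9,10]) (Us p81 [0,1,6,4,5,2,3,7,8,9,10])) (Cl 4 3 1)) (Cl 0 3 1)"])
    (simp only: check known cong: imp_cong)

definition "p86 = ([(Red,[0,1,3,4,2]), (Blue,[2,3,5]), (Unc,[0,2,5])] :: pattern)"
lemmas [known] = p86_def[THEN inst_cong] p86_def[THEN holds_cong]
lemma [known]: "unsat p86"
  by (rule unsatI[where t = "
    Br 0 5 (Us p78 [2,4,3,1,0,5,6,7,8,9,10]) (Cl 2 0 5) (Br 0 6 (Us p78 [2,4,3,1,0,6,5,7,8,9,10]) (Br
    0 7 (Us p78 [2,4,3,1,0,7,5,6,8,9,10]) (Sw p81 [6,0,2,7,3,5,1,4,8,9,10]) (St 0 5 2 7)) (St 0 5 2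
    6))"])
    (simp only: check known cong: imp_cong)

definition "p87 = ([(Red,[0,1,2,8,3,1,7,8]), (Red,[4,1,5]), (Red,[1,6]), (Blue,[2,3]), (Unc,[3,7])] :: pattern)"
lemmas [known] = p87_def[THEN inst_cong] p87_def[THEN holds_cong]
lemma [known]: "unsat p87"
  by (rule unsatI[where t = "
    Br 2 7 (Us p76 [3,8,2,7,1,0,4,5,6,9,10]) (Br 0 3 (Us p78 [6,1,0,3,8,2,4,5,7,9,10]) (Br 0 7 (Us p78
    [3,8,2,1,0,7,4,5,6,9,10]) (Br 3 4 (Us p78 [4,3,8,2,1,0,5,6,7,9,10]) (Br 3 5 (Us p78
    [5,3,8,2,1,0,4,6,7,9,10]) (Sw p82 [4,3,1,0,2,5,7,8,6,9,10]) (Us p86 [5,1,3,2,8,7,0,4,6,9,10])) (Us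
    p86 [4,1,3,2,8,7,0,5,6,9,10])) (Us p86 [0,1,7,2,8,3,4,5,6,9,10])) (Us p86
    [0,1,3,2,8,7,4,5,6,9,10])) (Cl 7 3 2)"])
    (simp only: check known cong: imp_cong)

definition "p88 = ([(Red,[7,1,0,2,3,1,4,2,5,1,6,2,9,1,8]), (Blue,[3,4])] :: pattern)"
lemmas [known] = p88_def[THEN inst_cong] p88_def[THEN holds_cong]
lemma [known]: "unsat p88"
  by (rule unsatI[where t = "
    Br 4 9 (Us p78 [9,4,2,3,1,0,5,6,7,8,10]) (Br 0 3 (Us p78 [7,1,0,3,2,4,5,6,8,9,10]) (Br 0 5 (Us p78
    [4,2,3,1,0,5,6,7,8,9,10]) (Br 0 6 (Us p78 [4,2,3,1,0,6,5,7,8,9,10]) (Sw p85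
    [5,0,3,1,6,4,9,2,7,8,10]) (Us p87 [4,1,3,0,5,7,8,6,2,9,10])) (Us p87 [4,1,3,0,6,7,8,5,2,9,10]))
    (Us p87 [5,1,4,3,6,7,8,0,2,9,10])) (Us p87 [0,1,3,4,5,6,7,9,2,8,10])"])
    (simp only: check known cong: imp_cong)

text \<open>Vertex 1 has red degree at least eight and lies on a red \<open>C4\<close> 1-2-9-3,
  whose opposite vertex 9 has the further red neighbor 10.\<close>

definition "p89 = ([(Red,[0,1,2,9,3,1,4]), (Red,[5,1,6]), (Red,[7,1,8]), (Red,[9,10])] :: pattern)"
lemmas [known] = p89_def[THEN inst_cong] p89_def[THEN holds_cong]
lemma [known]: "unsat p89"
  by (rule unsatI[where t = "
    Br 0 9 (Br 1 10 (Br 9 4 (Br 9 7 (Br 9 8 (Br 2 10 (Us p76 [3,9,10,2,1,0,4,5,6,7,8]) (Us p88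
    [0,1,9,2,10,3,4,5,6,8,7]) (Br 0 2 (Us p78 [5,1,0,2,9,10,3,4,6,7,8]) (Us p88
    [10,1,9,0,2,3,4,5,6,7,8]) (Br 2 3 (Us p76 [10,9,2,3,1,0,5,4,6,7,8]) (Us p88
    [0,1,9,2,3,10,4,5,6,7,8]) (St 2 0 10 3)))) (Us p85 [3,9,2,8,10,1,0,4,5,6,7]) (Us p79
    [10,9,2,8,1,0,3,4,5,6,7])) (Us p85 [3,9,2,7,10,1,0,4,5,6,8]) (Us p79 [10,9,2,7,1,0,3,4,5,6,8]))
    (Us p85 [3,9,2,4,10,1,0,5,6,7,8]) (Us p79 [10,9,2,4,1,0,3,5,6,7,8])) (Us p85
    [0,1,3,10,4,9,2,5,6,7,8]) (Us p81 [0,1,10,5,9,2,3,4,6,7,8])) (Us p85 [3,9,2,0,10,1,4,5,6,7,8]) (Us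
    p79 [10,9,2,0,1,5,3,4,6,7,8])"])
    (simp only: check known cong: imp_cong)

definition "p90 = ([(Red,[0,1,2,4,5]), (Red,[1,3])] :: pattern)"
lemmas [known] = p90_def[THEN inst_cong] p90_def[THEN holds_cong]
text \<open>By \<open>p85\<close> and \<open>p79\<close>, vertex 1 sees 6 to 10 in red and thus has
  red degree at least eight. A red pair from 4 to one of its leaves 6 or 0 closes the
  \<open>C4\<close> of \<open>p89\<close>.\<close>

lemma [known]: "unsat p90"
  by (rule unsatI[where t = "
    Br 1 6 (Br 1 7 (Br 1 8 (Br 1 9 (Br 1 10 (Br 4 6 (Us p89 [0,1,2,6,7,3,8,9,10,4,5]) (Br 0 4 (Us p89
    [6,1,0,2,7,3,8,9,10,4,5]) (Br 0 2 (Us p78 [3,1,0,2,4,5,6,7,8,9,10]) (Br 0 5 (Us p78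
    [3,1,0,5,4,2,6,7,8,9,10]) (Br 2 6 (Us p76 [5,4,2,6,1,0,3,7,8,9,10]) (Br 0 7 (Us p78
    [5,4,2,1,0,7,3,6,8,9,10]) (Sw p85 [5,0,2,1,7,6,4,3,8,9,10]) (Sw p79 [5,0,2,7,6,4,1,3,8,9,10])) (Cl
    2 6 4)) (Cl 5 0 4)) (Cl 2 0 4)) (Us p79 [5,4,2,0,1,3,6,7,8,9,10])) (Us p79
    [5,4,2,6,1,0,3,7,8,9,10])) (Us p85 [0,1,2,10,3,4,5,6,7,8,9]) (Us p79 [0,1,2,10,4,5,3,6,7,8,9]))
    (Us p85 [0,1,2,9,3,4,5,6,7,8,10]) (Us p79 [0,1,2,9,4,5,3,6,7,8,10])) (Us p85
    [0,1,2,8,3,4,5,6,7,9,10]) (Us p79 [0,1,2,8,4,5,3,6,7,9,10])) (Us p85 [0,1,2,7,3,4,5,6,8,9,10]) (Us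
    p79 [0,1,2,7,4,5,3,6,8,9,10])) (Us p85 [0,1,2,6,3,4,5,7,8,9,10]) (Us p79 [0,1,2,6,4,5,3,7,8,9,10])"])
    (simp only: check known cong: imp_cong)

definition "p91 = ([(Red,[0,1,2,4,5]), (Blue,[1,3])] :: pattern)"
lemmas [known] = p91_def[THEN inst_cong] p91_def[THEN holds_cong]
lemma [known]: "unsat p91"
  by (rule unsatI[where t = "
    Br 0 3 (Us p78 [5,4,2,1,0,3,6,7,8,9,10]) (Br 1 6 (Us p90 [0,1,2,6,4,5,3,7,8,9,10]) (Br 0 6 (Us p78
    [5,4,2,1,0,6,3,7,8,9,10]) (Br 1 7 (Us p90 [0,1,2,7,4,5,3,6,8,9,10]) (Br 0 8 (Us p78
    [5,4,2,1,0,8,3,6,7,9,10]) (Sw p85 [7,1,6,2,3,0,8,4,5,9,10]) (Sw p79 [3,0,6,8,1,7,2,4,5,9,10])) (Us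
    p79 [0,1,2,7,4,5,3,6,8,9,10])) (Cl 0 6 1)) (Us p79 [0,1,2,6,4,5,3,7,8,9,10])) (Cl 0 3 1)"])
    (simp only: check known cong: imp_cong)

definition "p92 = ([(Red,[0,1,2,3,4])] :: pattern)"
lemmas [known] = p92_def[THEN inst_cong] p92_def[THEN holds_cong]
lemma [known]: "unsat p92"
  by (rule unsatI[where t = "
    Br 1 7 (Us p90 [0,1,2,7,3,4,5,6,8,9,10]) (Us p91 [0,1,2,7,3,4,5,6,8,9,10]) (Us p79
    [0,1,2,7,3,4,5,6,8,9,10])"])
    (simp only: check known cong: imp_cong)

section \<open>Excluding shorter red paths, down to a single edge\<close>

definition "p93 = ([(Red,[0,1,2,3]), (Unc,[2,4])] :: pattern)"
lemmas [known] = p93_def[THEN inst_cong] p93_def[THEN holds_cong]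
lemma [known]: "unsat p93"
  by (rule unsatI[where t = "
    Tw 4 2 3 (Us p92 [4,3,2,1,0,5,6,7,8,9,10])"])
    (simp only: check known cong: imp_cong)

definition "p94 = ([(Red,[0,1,2,3]), (Red,[2,4])] :: pattern)"
lemmas [known] = p94_def[THEN inst_cong] p94_def[THEN holds_cong]
lemma [known]: "unsat p94"
  by (rule unsatI[where t = "
    Br 1 3 (Us p92 [4,2,3,1,0,5,6,7,8,9,10]) (Br 0 3 (Us p92 [4,2,1,0,3,5,6,7,8,9,10]) (Br 1 4 (Us p92
    [3,2,4,1,0,5,6,7,8,9,10]) (Br 0 2 (Br 0 5 (Us p92 [3,2,1,0,5,4,6,7,8,9,10]) (Sw p91
    [4,1,3,2,0,5,6,7,8,9,10]) (Us p93 [3,2,0,1,5,4,6,7,8,9,10])) (Sw p92 [4,1,3,0,2,5,6,7,8,9,10]) (Cl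
    2 0 3)) (Us p93 [3,2,1,0,4,5,6,7,8,9,10])) (Cl 0 3 1)) (Us p93 [4,2,1,0,3,5,6,7,8,9,10])"])
    (simp only: check known cong: imp_cong)

definition "p95 = ([(Red,[0,1,2,3])] :: pattern)"
lemmas [known] = p95_def[THEN inst_cong] p95_def[THEN holds_cong]
lemma [known]: "unsat p95"
  by (rule unsatI[where t = "
    Br 2 8 (Us p94 [0,1,2,3,8,4,5,6,7,9,10]) (Br 1 4 (Us p94 [3,2,1,0,4,5,6,7,8,9,10]) (Br 0 4 (Us p92
    [3,2,1,0,4,5,6,7,8,9,10]) (Br 1 8 (Us p94 [3,2,1,0,8,4,5,6,7,9,10]) (Sw p92
    [0,4,1,8,2,3,5,6,7,9,10]) (Us p93 [3,2,1,0,8,4,5,6,7,9,10])) (Cl 0 4 1)) (Us p93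
    [3,2,1,0,4,5,6,7,8,9,10])) (Us p93 [0,1,2,3,8,4,5,6,7,9,10])"])
    (simp only: check known cong: imp_cong)

definition "p96 = ([(Red,[0,1,2]), (Blue,[1,3])] :: pattern)"
lemmas [known] = p96_def[THEN inst_cong] p96_def[THEN holds_cong]
lemma [known]: "unsat p96"
  by (rule unsatI[where t = "
    Br 0 3 (Us p95 [2,1,0,3,4,5,6,7,8,9,10]) (Br 0 4 (Us p95 [2,1,0,4,3,5,6,7,8,9,10]) (Sw p95
    [4,0,3,1,2,5,6,7,8,9,10]) (Br 0 5 (Us p95 [2,1,0,5,3,4,6,7,8,9,10]) (Sw p95
    [5,0,3,1,2,4,6,7,8,9,10]) (Br 0 6 (Us p95 [2,1,0,6,3,4,5,7,8,9,10]) (Sw p95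
    [6,0,3,1,2,4,5,7,8,9,10]) (St 0 5 4 6)))) (Cl 0 3 1)"])
    (simp only: check known cong: imp_cong)

definition "p97 = ([(Red,[0,1,2]), (Unc,[1,3])] :: pattern)"
lemmas [known] = p97_def[THEN inst_cong] p97_def[THEN holds_cong]
lemma [known]: "unsat p97"
  by (rule unsatI[where t = "
    Tw 3 1 0 (Us p95 [2,1,0,3,4,5,6,7,8,9,10])"])
    (simp only: check known cong: imp_cong)

definition "p98 = ([(Red,[0,1,2]), (Red,[3,1,4]), (Blue,[3,4])] :: pattern)"
lemmas [known] = p98_def[THEN inst_cong] p98_def[THEN holds_cong]
lemma [known]: "unsat p98"
  by (rule unsatI[where t = "
    Br 0 3 (Us p95 [2,1,0,3,4,5,6,7,8,9,10]) (Sw p96 [4,3,0,1,2,5,6,7,8,9,10]) (Br 0 4 (Us p95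
    [2,1,0,4,3,5,6,7,8,9,10]) (Sw p96 [3,4,0,1,2,5,6,7,8,9,10]) (Cl 0 3 4))"])
    (simp only: check known cong: imp_cong)

definition "p99 = ([(Red,[0,1,2])] :: pattern)"
lemmas [known] = p99_def[THEN inst_cong] p99_def[THEN holds_cong]
text \<open>By \<open>p96\<close> and \<open>p97\<close> the middle vertex 1 sees 3 and 4 in red as
  well. Among its neighbors 0, 2, 3, 4 not all are twins of 0: a red pair gives a path on four
  vertices, a blue one gives \<open>p98\<close>.\<close>

lemma [known]: "unsat p99"
  by (rule unsatI[where t = "
    Br 1 8 (Br 1 3 (Br 1 4 (Br 0 2 (Us p95 [8,1,0,2,3,4,5,6,7,9,10]) (Us p98 [3,1,4,0,2,5,6,7,8,9,10])
    (Br 0 3 (Us p95 [2,1,0,3,4,5,6,7,8,9,10]) (Us p98 [2,1,4,0,3,5,6,7,8,9,10]) (Br 0 4 (Us p95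
    [2,1,0,4,3,5,6,7,8,9,10]) (Us p98 [2,1,3,0,4,5,6,7,8,9,10]) (St 0 3 2 4)))) (Us p96
    [0,1,2,4,3,5,6,7,8,9,10]) (Us p97 [0,1,2,4,3,5,6,7,8,9,10])) (Us p96 [0,1,2,3,4,5,6,7,8,9,10]) (Us
    p97 [0,1,2,3,4,5,6,7,8,9,10])) (Us p96 [0,1,2,8,3,4,5,6,7,9,10]) (Us p97 [0,1,2,8,3,4,5,6,7,9,10])"])
    (simp only: check known cong: imp_cong)

definition "p100 = ([(Red,[0,1]), (Blue,[0,2])] :: pattern)"
lemmas [known] = p100_def[THEN inst_cong] p100_def[THEN holds_cong]
lemma [known]: "unsat p100"
  by (rule unsatI[where t = "
    Br 1 2 (Us p99 [0,1,2,3,4,5,6,7,8,9,10]) (Sw p99 [0,2,1,3,4,5,6,7,8,9,10]) (Cl 1 2 0)"])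
    (simp only: check known cong: imp_cong)

definition "p101 = ([(Red,[0,1])] :: pattern)"
lemmas [known] = p101_def[THEN inst_cong] p101_def[THEN holds_cong]
lemma [known]: "unsat p101"
  by (rule unsatI[where t = "
    Br 0 3 (Us p99 [1,0,3,2,4,5,6,7,8,9,10]) (Us p100 [0,1,3,2,4,5,6,7,8,9,10]) (Br 1 3 (Us p99
    [0,1,3,2,4,5,6,7,8,9,10]) (Us p100 [1,0,3,2,4,5,6,7,8,9,10]) (Cl 3 0 1))"])
    (simp only: check known cong: imp_cong)

text \<open>Vertex 0 has at most two twins, so one of the pairs 0-1, 0-2, 0-3 is red or blue; each
  case is \<open>p101\<close> up to relabelling and swapping.\<close>

lemma no_good: "unsat []"
  by (rule unsatI[where t = "
    Br 0 1 (Us p101 [0,1,2,3,4,5,6,7,8,9,10]) (Sw p101 [0,1,2,3,4,5,6,7,8,9,10]) (Br 0 2 (Us p101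
    [0,2,1,3,4,5,6,7,8,9,10]) (Sw p101 [0,2,1,3,4,5,6,7,8,9,10]) (Br 0 3 (Us p101
    [0,3,1,2,4,5,6,7,8,9,10]) (Sw p101 [0,3,1,2,4,5,6,7,8,9,10]) (St 0 2 1 3)))"]) (simp only: check known cong: imp_cong)

section \<open>Transfer of the finite statement to arbitrary vertex sets\<close>

lemma distinct_list_of_card:
  assumes "card A \<ge> n"
  obtains xs where "distinct xs" "length xs = n" "set xs \<subseteq> A"
  using assms by (metis obtain_subset_with_card_n finite_distinct_list distinct_card)

text \<open>Eleven vertices of \<open>W\<close> are numbered and the coloring is pulled back. It is
  not \<open>good\<close>; two ways of failing contradict the assumptions on twins, and the third
  yields the cycle.\<close>

lemma twin_ramsey:
  fixes val :: "'a \<Rightarrow> 'a \<Rightarrow> clr"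
  assumes card_W: "card W \<ge> 11"
    and sym: "\<And>a b. a \<in> W \<Longrightarrow> b \<in> W \<Longrightarrow> val a b = val b a"
    and twin: "\<And>a b x. a \<in> W \<Longrightarrow> b \<in> W \<Longrightarrow> x \<in> W \<Longrightarrow> distinct [a, b, x] \<Longrightarrow>
      val a b = Unc \<Longrightarrow> val a x = val b x"
    and star: "\<And>a b x y. {a, b, x, y} \<subseteq> W \<Longrightarrow> distinct [a, b, x, y] \<Longrightarrow>
      val a b = Unc \<Longrightarrow> val a x = Unc \<Longrightarrow> val a y \<noteq> Unc"
  shows "\<exists>s w. s \<noteq> Unc \<and> distinct w \<and> length w = 8 \<and> set w \<subseteq> W \<and>
    successively (\<lambda>a b. val a b = s) (w @ [hd w])"
proof -
  obtain vs where vs: "distinct vs" "length vs = 11" "set vs \<subseteq> W"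
    using card_W by (rule distinct_list_of_card)
  define e where "e = nth vs"
  define col where "col a b = val (e a) (e b)" for a b
  have e_W: "e a \<in> W" if "a < 11" for a
    using vs(2,3) that nth_mem[of a vs] by (auto simp: e_def)
  have e_eq: "e a = e b \<longleftrightarrow> a = b" if "a < 11" "b < 11" for a b
    using vs that by (simp add: e_def nth_eq_iff_index_eq)
  have ecol: "ecol col a b = val (e a) (e b)" if "a < 11" "b < 11" for a b
    using sym[OF e_W e_W] that by (simp add: ecol_def col_def)
  have "\<not> good col"
    using no_good unfolding unsat_def by simp
  then consider
      (twin) a b x where "verts [a, b, x]" "ecol col a b = Unc" "ecol col a x \<noteq> ecol col b x"
    | (star) a b x y where "verts [a, b, x, y]" "ecol col a b = Unc" "ecol col a x = Unc" "ecol col a y = Unc"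
    | (cycle) w s where "verts w" "length w = 8" "s \<noteq> Unc"
        "successively (\<lambda>a b. ecol col a b = s) (w @ [hd w])"
    unfolding good_def by blast
  thus ?thesis
  proof cases
    case twin
    thus ?thesis using assms(3)[of "e a" "e b" "e x"] by (auto simp: verts_def ecol e_W e_eq)
  next
    case star
    thus ?thesis using assms(4)[of "e a" "e b" "e x" "e y"] by (auto simp: verts_def ecol e_W e_eq)
  next
    case cycle
    have w: "distinct w" "\<And>a. a \<in> set w \<Longrightarrow> a < 11" using cycle(1) by (auto simp: verts_def)
    have "set (w @ [hd w]) = set w" using cycle(2) by (cases w) auto
    hence "successively (\<lambda>a b. val (e a) (e b) = s) (w @ [hd w])"
      using w(2) ecol by (intro successively_mono[OF cycle(4)]) auto
    hence "successively (\<lambda>a b. val a b = s) (map e (w @ [hd w]))"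
      by (simp only: successively_map)
    moreover have "map e (w @ [hd w]) = map e w @ [hd (map e w)]"
      using cycle(2) by (cases w) auto
    moreover have "distinct (map e w)" using w e_eq by (auto simp: distinct_map inj_on_def)
    ultimately show ?thesis using cycle(2,3) w(2) e_W by (intro exI[of _ s] exI[of _ "map e w"]) auto
  qed
qed

section \<open>Colorings without rainbow triangles\<close>

definition gallai :: "'a set \<Rightarrow> ('a \<Rightarrow> 'a \<Rightarrow> nat) \<Rightarrow> bool" where
  "gallai V c \<longleftrightarrow> finite V \<and> (\<forall>x\<in>V. \<forall>y\<in>V. c x y = c y x) \<and>
     (\<forall>x\<in>V. \<forall>y\<in>V. \<forall>z\<in>V. x \<noteq> y \<longrightarrow> y \<noteq> z \<longrightarrow> x \<noteq> z \<longrightarrow>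
        c x y = c y z \<or> c x y = c x z \<or> c y z = c x z)"

lemma gallaiD:
  assumes "gallai V c"
  shows gallai_finite: "finite V"
    and gallai_sym: "x \<in> V \<Longrightarrow> y \<in> V \<Longrightarrow> c x y = c y x"
    and gallai_triangle: "x \<in> V \<Longrightarrow> y \<in> V \<Longrightarrow> z \<in> V \<Longrightarrow> x \<noteq> y \<Longrightarrow> y \<noteq> z \<Longrightarrow> x \<noteq> z \<Longrightarrow>
          c x y = c y z \<or> c x y = c x z \<or> c y z = c x z"
  using assms unfolding gallai_def by blast+

lemma gallai_subset: "gallai V c \<Longrightarrow> T \<subseteq> V \<Longrightarrow> gallai T c"
  unfolding gallai_def by (meson finite_subset subsetD)

definition adj :: "('a \<Rightarrow> 'a \<Rightarrow> nat) \<Rightarrow> nat set \<Rightarrow> 'a set \<Rightarrow> ('a \<times> 'a) set" where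
  "adj c D T = {(x, y). x \<in> T \<and> y \<in> T \<and> x \<noteq> y \<and> c x y \<in> D}"

lemma adj_iff: "(x, y) \<in> adj c D T \<longleftrightarrow> x \<in> T \<and> y \<in> T \<and> x \<noteq> y \<and> c x y \<in> D"
  by (simp add: adj_def)

lemma reach_in: "(x, y) \<in> (adj c D T)\<^sup>* \<Longrightarrow> x \<in> T \<Longrightarrow> y \<in> T"
  by (induction rule: rtrancl_induct) (auto simp: adj_iff)

lemma reach_sym:
  assumes "gallai T c" "(x, y) \<in> (adj c D T)\<^sup>*"
  shows "(y, x) \<in> (adj c D T)\<^sup>*"
proof -
  have "sym (adj c D T)"
    using gallai_sym[OF assms(1)] by (auto simp: sym_def adj_iff)
  thus ?thesis using assms(2) by (meson sym_rtrancl symD)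
qed

text \<open>Along an edge \<open>y\<close>-\<open>z\<close> of the component of \<open>u\<close>,
  the pairs \<open>v\<close>-\<open>y\<close> and \<open>v\<close>-\<open>z\<close> have colors
  outside \<open>D\<close>, since \<open>v\<close> lies in another component. The color of
  \<open>y\<close>-\<open>z\<close> is in \<open>D\<close>, so the triangle can only avoid being
  rainbow if the other two colors agree.\<close>

lemma component_homogeneous:
  assumes T: "gallai T c" and v: "v \<in> T" "u \<in> T" "(u, v) \<notin> (adj c D T)\<^sup>*"
    and uw: "(u, w) \<in> (adj c D T)\<^sup>*"
  shows "c v w = c v u"
  using uw
proof (induction rule: rtrancl_induct)
  case base
  show ?case ..
next
  case (step y z)
  have yz: "y \<in> T" "z \<in> T" "y \<noteq> z" "c y z \<in> D" using step(2) by (auto simp: adj_iff)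
  have uz: "(u, z) \<in> (adj c D T)\<^sup>*" using step by auto
  have "v \<noteq> y" "v \<noteq> z" using v(3) step(1) uz by auto
  moreover have "c p v \<notin> D" if "(u, p) \<in> (adj c D T)\<^sup>*" "p \<in> T" "v \<noteq> p" for p
    using rtrancl.rtrancl_into_rtrancl[OF that(1), of v] v that by (auto simp: adj_iff)
  hence "c y v \<notin> D" "c z v \<notin> D" using step(1) uz yz calculation by blast+
  ultimately have "c v y = c v z"
    using gallai_triangle[OF T v(1) yz(1,2)] yz gallai_sym[OF T v(1)] by metis
  thus ?case using step(3) by simp
qed

text \<open>
  Gallai's theorem, by induction: remove a vertex \<open>x\<close> and let \<open>D\<close> be the colors that fail to connect
  the rest.  Either \<open>x\<close> has no \<open>D\<close>-edge to some \<open>D\<close>-component, or rainbow-freeness leaves only two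
  colors at \<open>x\<close>.\<close>

lemma gallai_two_colors:
  assumes "gallai T c" "card T \<ge> 2"
  shows "\<exists>r b. \<exists>u\<in>T. \<exists>v\<in>T. (u, v) \<notin> (adj c (- {r, b}) T)\<^sup>*"
  using assms
proof (induction "card T" arbitrary: T)
  case 0
  thus ?case by simp
next
  case (Suc n)
  \<comment> \<open>A vertex that sees at most two colors is isolated in the graph of all others.
    This settles the base case and the last case of the induction.\<close>
  have isolated: "\<exists>r b. \<exists>u\<in>T. \<exists>v\<in>T. (u, v) \<notin> (adj c (- {r, b}) T)\<^sup>*"
    if "x \<in> T" "y \<in> T" "x \<noteq> y" "\<And>z. z \<in> T \<Longrightarrow> z \<noteq> x \<Longrightarrow> c x z \<in> {r, b}" for x y r b
  proof -
    have "(x, y) \<notin> (adj c (- {r, b}) T)\<^sup>*"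
    proof
      assume "(x, y) \<in> (adj c (- {r, b}) T)\<^sup>*"
      thus False
        using that(3,4) by (cases rule: converse_rtranclE) (auto simp: adj_iff)
    qed
    thus ?thesis using that(1,2) by blast
  qed
  obtain x where x: "x \<in> T" using Suc by fastforce
  define S where "S = T - {x}"
  have fin: "finite T" using Suc gallai_finite by blast
  have S: "gallai S c" "card S = n" "S \<subseteq> T" "x \<notin> S"
    using Suc x fin gallai_subset[OF Suc(3), of S] unfolding S_def by auto
  have inS: "z \<in> S" if "z \<in> T" "z \<noteq> x" for z using that unfolding S_def by blast
  show ?case
  proof (cases "n \<ge> 2")
    case False
    hence "card S = 1" using S(2) Suc by linarith
    then obtain y where "S = {y}" by (meson card_1_singletonE)
    thus ?thesis using isolated[of x y "c x y" "c x y"] x inS S by blast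
  next
    case True
    then obtain r b u v where uv: "u \<in> S" "v \<in> S" "(u, v) \<notin> (adj c (- {r, b}) S)\<^sup>*"
      using Suc(1)[of S] S by auto
    define D where "D = - {r, b}"
    define R where "R = (adj c D S)\<^sup>*"
    have R_sym: "(p, q) \<in> R \<Longrightarrow> (q, p) \<in> R" for p q
      unfolding R_def by (rule reach_sym[OF S(1)])
    have R_trans: "(p, q) \<in> R \<Longrightarrow> (q, w) \<in> R \<Longrightarrow> (p, w) \<in> R" for p q w
      unfolding R_def by (rule rtrancl_trans)
    have R_in: "(p, q) \<in> R \<Longrightarrow> p \<in> S \<Longrightarrow> q \<in> S" for p q
      unfolding R_def by (rule reach_in)
    have hom: "p \<in> S \<Longrightarrow> q \<in> S \<Longrightarrow> (q, p) \<notin> R \<Longrightarrow> (q, w) \<in> R \<Longrightarrow> c p w = c p q" for p q w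
      unfolding R_def by (rule component_homogeneous[OF S(1)])
    have nonadj: "p \<in> S \<Longrightarrow> q \<in> S \<Longrightarrow> (p, q) \<notin> R \<Longrightarrow> c p q \<notin> D" for p q
      unfolding R_def by (metis adj_iff r_into_rtrancl rtrancl.rtrancl_refl)
    have other: "\<exists>q\<in>S. (p, q) \<notin> R" for p
      using uv R_sym R_trans unfolding R_def[symmetric] D_def[symmetric] by blast
    have sym: "p \<in> T \<Longrightarrow> q \<in> T \<Longrightarrow> c p q = c q p" for p q
      using gallai_sym[OF Suc(3)] by blast
    have tri: "p \<in> S \<Longrightarrow> q \<in> S \<Longrightarrow> p \<noteq> q \<Longrightarrow> c x p = c x q \<or> c x p = c p q \<or> c x q = c p q" for p q
      using gallai_triangle[OF Suc(3) x, of p q] S(3,4) sym x by (metis subsetD)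
    show ?thesis
    proof (cases "\<forall>y\<in>S. \<exists>a\<in>S. (y, a) \<in> R \<and> c x a \<in> D")
      case False
      then obtain y where y: "y \<in> S" "\<And>a. (y, a) \<in> R \<Longrightarrow> c x a \<notin> D" using R_in by blast
      \<comment> \<open>No \<open>D\<close>-edge leads from the component of \<open>y\<close> to
        \<open>x\<close>, so adding \<open>x\<close> back does not enlarge this component.\<close>
      have "(y, z) \<in> (adj c D T)\<^sup>* \<Longrightarrow> (y, z) \<in> R" for z
      proof (induction rule: rtrancl_induct)
        case base
        show ?case by (simp add: R_def)
      next
        case (step p q)
        have "q \<noteq> x" using step y(2)[of p] sym[of p x] x by (auto simp: adj_iff)
        moreover have "p \<in> S" using step(3) R_in y(1) by blast
        ultimately show ?case
          using step inS unfolding R_def by (metis adj_iff rtrancl.rtrancl_into_rtrancl)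
      qed
      moreover have "(y, x) \<notin> R" using R_in y(1) S(4) by blast
      ultimately show ?thesis using x y(1) S(3) unfolding D_def by blast
    next
      case True
      obtain a where a: "a \<in> S" "c x a \<in> D" using True uv(1) by blast
      define g where "g = c x a"
      \<comment> \<open>All \<open>D\<close>-colored edges at \<open>x\<close> share one color. For
        ends in different components this follows from the triangle, whose third side is not in
        \<open>D\<close>; ends in the same component are compared through an end in another
        one.\<close>
      have gD: "c x y = g" if y: "y \<in> S" "c x y \<in> D" for y
      proof -
        have *: "c x p = c x q" if "p \<in> S" "q \<in> S" "(p, q) \<notin> R" "c x p \<in> D" "c x q \<in> D" for p q
          using tri[of p q] nonadj[of p q] that by (metis R_def rtrancl.rtrancl_refl)
        obtain q where q: "q \<in> S" "(a, q) \<notin> R" using other by blast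
        obtain q' where q': "q' \<in> S" "(q, q') \<in> R" "c x q' \<in> D" using True q(1) by blast
        have aq': "(a, q') \<notin> R" using q q' R_sym R_trans by blast
        show ?thesis
        proof (cases "(a, y) \<in> R")
          case True
          hence "(y, q') \<notin> R" using aq' R_trans by blast
          thus ?thesis using *[of y q'] *[of a q'] aq' y q' a g_def by auto
        next
          case False
          thus ?thesis using *[of a y] y a g_def by auto
        qed
      qed
      \<comment> \<open>The component of \<open>q\<close> has a vertex \<open>q'\<close> with a
        \<open>D\<close>-edge to \<open>x\<close>. In the triangle \<open>x\<close>,
        \<open>q'\<close>, \<open>y\<close> the other two colors are not in \<open>D\<close>, hence
        equal; homogeneity replaces \<open>q'\<close> by \<open>q\<close>.\<close>
      have link: "c q y = c x y"
        if l: "y \<in> S" "q \<in> S" "(q, y) \<notin> R" "c x y \<notin> D" for y q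
      proof -
        obtain q' where q': "q' \<in> S" "(q, q') \<in> R" "c x q' \<in> D" using True l(2) by blast
        have n: "(q', y) \<notin> R" using q' l(3) R_trans by blast
        have "c q' y = c x y"
          using tri[of q' y] nonadj[of q' y] n q' l by (metis R_def rtrancl.rtrancl_refl)
        moreover have "c y q' = c y q" using hom[of y q q'] l q' by blast
        ultimately show ?thesis using sym S(3) l q'(1) by (metis subsetD)
      qed
      \<comment> \<open>Likewise all edges at \<open>x\<close> outside \<open>D\<close> share one
        color, by \<open>link\<close> from a third component or between the two components. Hence
        \<open>x\<close> sees at most two colors.\<close>
      have same: "c x y = c x z" if yz: "y \<in> S" "z \<in> S" "c x y \<notin> D" "c x z \<notin> D" for y z
      proof (cases "(z, y) \<in> R")
        case True
        obtain q where q: "q \<in> S" "(y, q) \<notin> R" using other by blast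
        have "c q z = c x z" "c q y = c x y"
          using link[of z q] link[of y q] yz q True R_sym R_trans by blast+
        moreover have "c q z = c q y" using hom[of q y z] q yz True R_sym by blast
        ultimately show ?thesis by simp
      next
        case False
        hence "c z y = c x y" "c y z = c x z"
          using link[of y z] link[of z y] yz R_sym by blast+
        thus ?thesis using sym S(3) yz by (metis subsetD)
      qed
      obtain p where p: "\<And>y. y \<in> S \<Longrightarrow> c x y \<in> {g, p}"
        using gD same by (metis insertCI)
      show ?thesis using isolated[of x a g p] p x a S inS by blast
    qed
  qed
qed


section \<open>Monochromatic 8-cycles and homogeneous sets\<close>

definition mono_c8 :: "'a set \<Rightarrow> ('a \<Rightarrow> 'a \<Rightarrow> nat) \<Rightarrow> bool" where
  "mono_c8 V c \<longleftrightarrow> (\<exists>s w. distinct w \<and> length w = 8 \<and> set w \<subseteq> V \<and>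
     successively (\<lambda>a b. c a b = s) (w @ [hd w]))"

lemma mono_c8I:
  "distinct w \<Longrightarrow> length w = 8 \<Longrightarrow> set w \<subseteq> V \<Longrightarrow>
    successively (\<lambda>a b. c a b = s) (w @ [hd w]) \<Longrightarrow> mono_c8 V c"
  unfolding mono_c8_def by blast

lemma length_3_iff: "length xs = 3 \<longleftrightarrow> (\<exists>a b c. xs = [a, b, c])"
  and length_4_iff: "length xs = 4 \<longleftrightarrow> (\<exists>a b c d. xs = [a, b, c, d])"
  by (auto simp: numeral_eq_Suc length_Suc_conv)

lemma mono_c8_biclique:
  assumes "card A \<ge> 4" "card B \<ge> 4" "A \<subseteq> V" "B \<subseteq> V" "A \<inter> B = {}"
    and "\<And>a b. a \<in> A \<Longrightarrow> b \<in> B \<Longrightarrow> c a b = s \<and> c b a = s"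
  shows "mono_c8 V c"
proof -
  obtain as bs where *: "distinct as" "length as = 4" "set as \<subseteq> A" "distinct bs" "length bs = 4" "set bs \<subseteq> B"
    using distinct_list_of_card assms(1,2) by metis
  then obtain a1 a2 a3 a4 b1 b2 b3 b4 where "as = [a1, a2, a3, a4]" "bs = [b1, b2, b3, b4]"
    unfolding length_4_iff by blast
  thus ?thesis
    using * assms by (intro mono_c8I[of "[a1, b1, a2, b2, a3, b3, a4, b4]" V c s]) auto
qed

text \<open>A path on three vertices inside \<open>T\<close> makes up for the missing fourth vertex
  of \<open>B\<close>: the cycle takes five vertices of \<open>T\<close> and three of
  \<open>B\<close>.\<close>

lemma mono_c8_path3:
  assumes "card T \<ge> 5" "card B \<ge> 3" "T \<subseteq> V" "B \<subseteq> V" "T \<inter> B = {}"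
    and "\<And>a b. a \<in> T \<Longrightarrow> b \<in> B \<Longrightarrow> c a b = s \<and> c b a = s"
    and "distinct [x, y, z]" "{x, y, z} \<subseteq> T" "c y x = s" "c x z = s"
  shows "mono_c8 V c"
proof -
  have "card (T - {x, y, z}) \<ge> 2"
    using assms(1,7,8) by (simp add: card_Diff_subset)
  then obtain ps where ps: "distinct ps" "length ps = 2" "set ps \<subseteq> T - {x, y, z}"
    by (rule distinct_list_of_card)
  obtain bs where bs: "distinct bs" "length bs = 3" "set bs \<subseteq> B"
    using distinct_list_of_card assms(2) by metis
  obtain p q b1 b2 b3 where "ps = [p, q]" "bs = [b1, b2, b3]"
    using ps(2) bs(2) unfolding length_3_iff by (auto simp: numeral_eq_Suc length_Suc_conv)
  thus ?thesis
    using ps bs assms by (intro mono_c8I[of "[y, x, z, b1, p, b2, q, b3]" V c s]) auto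
qed

definition homogeneous :: "('a \<Rightarrow> 'a \<Rightarrow> nat) \<Rightarrow> 'a set \<Rightarrow> 'a set \<Rightarrow> bool" where
  "homogeneous c V T \<longleftrightarrow> T \<subseteq> V \<and> (\<forall>v\<in>V - T. \<exists>s. \<forall>t\<in>T. c v t = s)"

lemma homogeneous_trans:
  assumes "homogeneous c V T" "homogeneous c T H"
  shows "homogeneous c V H"
  using assms unfolding homogeneous_def by (metis DiffI DiffE subsetD subset_trans)


lemma length_8_iff: "length xs = 8 \<longleftrightarrow> (\<exists>a b c d e f g h. xs = [a, b, c, d, e, f, g, h])"
  by (auto simp: numeral_eq_Suc length_Suc_conv)

text \<open>Used to find two vertices of \<open>Out r\<close> next to a vertex of
  \<open>Out b\<close> on a red cycle. Predecessor \<open>y\<close> and successor \<open>z\<close>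
  are kept apart because \<open>P\<close> has a direction.\<close>

lemma cycle_neighbours:
  assumes "successively P (w @ [hd w])" "length w = 8" "distinct w" "x \<in> set w"
  shows "\<exists>y\<in>set w. \<exists>z\<in>set w. P y x \<and> P x z \<and> y \<noteq> z"
proof -
  obtain a b c d e f g h where w: "w = [a, b, c, d, e, f, g, h]"
    using assms(2) unfolding length_8_iff by blast
  have step: ?thesis if "x = q" "{p, r} \<subseteq> set w" "P p q" "P q r" "p \<noteq> r" for p q r
    using that by blast
  have P: "P a b" "P b c" "P c d" "P d e" "P e f" "P f g" "P g h" "P h a"
    using assms(1) unfolding w by simp_all
  from assms(4) consider "x = a" | "x = b" | "x = c" | "x = d" | "x = e" | "x = f" | "x = g" | "x = h" unfolding w by auto
  thus ?thesis
  proof cases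
    case 1
    show ?thesis by (rule step[OF 1 _ P(8) P(1)]) (use assms(3) w in auto)
  next
    case 2
    show ?thesis by (rule step[OF 2 _ P(1) P(2)]) (use assms(3) w in auto)
  next
    case 3
    show ?thesis by (rule step[OF 3 _ P(2) P(3)]) (use assms(3) w in auto)
  next
    case 4
    show ?thesis by (rule step[OF 4 _ P(3) P(4)]) (use assms(3) w in auto)
  next
    case 5
    show ?thesis by (rule step[OF 5 _ P(4) P(5)]) (use assms(3) w in auto)
  next
    case 6
    show ?thesis by (rule step[OF 6 _ P(5) P(6)]) (use assms(3) w in auto)
  next
    case 7
    show ?thesis by (rule step[OF 7 _ P(6) P(7)]) (use assms(3) w in auto)
  next
    case 8
    show ?thesis by (rule step[OF 8 _ P(7) P(8)]) (use assms(3) w in auto)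
  qed
qed

section \<open>The upper bound for at least two colors\<close>

lemma gallai_mono_c8:
  assumes V: "gallai V c" and k: "k \<ge> 2" and colors: "\<And>x y. x \<in> V \<Longrightarrow> y \<in> V \<Longrightarrow> x \<noteq> y \<Longrightarrow> c x y < k"
    and card_V: "card V \<ge> 3 * k + 5"
  shows "mono_c8 V c"
proof (rule ccontr)
  assume no_c8: "\<not> mono_c8 V c"
  have fin_V: "finite V" and sym: "x \<in> V \<Longrightarrow> y \<in> V \<Longrightarrow> c x y = c y x" for x y
    using gallai_finite[OF V] gallai_sym[OF V] by auto
  have "homogeneous c V V" by (simp add: homogeneous_def)
  then obtain T where T: "homogeneous c V T" "card T \<ge> 4"
    and T_min: "\<And>H. homogeneous c V H \<Longrightarrow> card H \<ge> 4 \<Longrightarrow> card T \<le> card H"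
    using ex_has_least_nat[of "\<lambda>H. homogeneous c V H \<and> card H \<ge> 4" V card] card_V by auto
  have TV: "T \<subseteq> V" using T(1) by (simp add: homogeneous_def)
  obtain t0 where t0: "t0 \<in> T" using T(2) by fastforce
  have fin_T: "finite T" using TV fin_V finite_subset by blast
  have gallai_T: "gallai T c" using V TV gallai_subset by blast
  define Out where "Out s = {v \<in> V - T. \<forall>t\<in>T. c v t = s}" for s
  have Out_sub: "Out s \<subseteq> V" "T \<inter> Out s = {}" for s unfolding Out_def by auto
  have fin_Out: "finite (Out s)" for s using Out_sub fin_V finite_subset by blast
  have Out_color: "c t v = s \<and> c v t = s" if "t \<in> T" "v \<in> Out s" for t v s
    using that sym[of t v] TV unfolding Out_def by auto
  have Out_disj: "Out s \<inter> Out s' = {}" if "s \<noteq> s'" for s s'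
    using that t0 unfolding Out_def by auto
  have card_Out: "card (Out s) \<le> 3" for s
    using mono_c8_biclique[OF T(2) _ TV Out_sub, of s c s] Out_color no_c8 by force
  have cover: "V \<subseteq> T \<union> (\<Union>s<k. Out s)"
  proof
    fix v assume v: "v \<in> V"
    show "v \<in> T \<union> (\<Union>s<k. Out s)"
    proof (cases "v \<in> T")
      case False
      then obtain s where s: "\<forall>t\<in>T. c v t = s" using T(1) v unfolding homogeneous_def by blast
      have "s < k" using colors[of v t0] s t0 v False TV by auto
      thus ?thesis using s v False unfolding Out_def by blast
    qed auto
  qed
  have sum_Out: "card V \<le> card T + (\<Sum>s<k. card (Out s))"
  proof -
    have "card V \<le> card (T \<union> (\<Union>s<k. Out s))"
      using cover fin_T fin_Out by (intro card_mono) auto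
    also have "\<dots> \<le> card T + card (\<Union>s<k. Out s)" by (rule card_Un_le)
    also have "card (\<Union>s<k. Out s) \<le> (\<Sum>s<k. card (Out s))" by (rule card_UN_le) simp
    finally show ?thesis by simp
  qed
  have "(\<Sum>s<k. card (Out s)) \<le> 3 * k"
    using sum_mono[of "{..<k}" "\<lambda>s. card (Out s)" "\<lambda>_. 3"] card_Out by simp
  hence card_T: "card T \<ge> 5" using sum_Out card_V by linarith

  obtain r' b' u v where uv: "u \<in> T" "v \<in> T" "(u, v) \<notin> (adj c (- {r', b'}) T)\<^sup>*"
    using gallai_two_colors[OF gallai_T] card_T by auto
  \<comment> \<open>The two colors from Gallai's theorem may coincide or exceed the range. The
    counting below needs two distinct colors below \<open>k\<close>; enlarging the removed set of
    colors only deletes edges and keeps \<open>u\<close> and \<open>v\<close> apart.\<close>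
  have "\<exists>r b. r \<noteq> b \<and> r < k \<and> b < k \<and> {r', b'} \<inter> {..<k} \<subseteq> {r, b}"
  proof -
    have other: "\<exists>d<k. d \<noteq> e" for e :: nat
      using k by (intro exI[of _ "if e = 0 then 1 else 0"]) auto
    show ?thesis
    proof (cases "r' < k")
      case True
      obtain d where "d < k" "d \<noteq> r'" using other by blast
      thus ?thesis using True by (cases "b' < k \<and> b' \<noteq> r'") fastforce+
    next
      case False
      obtain d where "d < k" "d \<noteq> (if b' < k then b' else 0)" using other by blast
      thus ?thesis using False k by (intro exI[of _ "if b' < k then b' else 0"] exI[of _ d]) auto
    qed
  qed
  then obtain r b where rb: "r \<noteq> b" "r < k" "b < k" "{r', b'} \<inter> {..<k} \<subseteq> {r, b}" by blast
  define R where "R = (adj c (- {r, b}) T)\<^sup>*"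
  have "adj c (- {r, b}) T \<subseteq> adj c (- {r', b'}) T"
    using rb(4) colors TV by (fastforce simp: adj_def)
  hence uvR: "(u, v) \<notin> R" using uv(3) rtrancl_mono unfolding R_def by blast
  have R_sym: "(p, q) \<in> R \<Longrightarrow> (q, p) \<in> R" for p q
    unfolding R_def by (rule reach_sym[OF gallai_T])
  have R_trans: "(p, q) \<in> R \<Longrightarrow> (q, w) \<in> R \<Longrightarrow> (p, w) \<in> R" for p q w
    unfolding R_def by (rule rtrancl_trans)
  have R_refl: "(p, p) \<in> R" for p unfolding R_def by simp
  have non_R: "c p q = r \<or> c p q = b" if "p \<in> T" "q \<in> T" "(p, q) \<notin> R" for p q
  proof -
    have "p \<noteq> q" using that R_refl by blast
    hence "(p, q) \<in> adj c (- {r, b}) T" if "\<not> (c p q = r \<or> c p q = b)"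
      using that \<open>p \<in> T\<close> \<open>q \<in> T\<close> by (simp add: adj_iff)
    thus ?thesis using \<open>(p, q) \<notin> R\<close> unfolding R_def by blast
  qed
  have R_hom: "c p q = c p q'" if "p \<in> T" "q \<in> T" "(q, p) \<notin> R" "(q, q') \<in> R" for p q q'
    using component_homogeneous[OF gallai_T that(1,2)] that(3,4) unfolding R_def by metis
  define cls where "cls p = {q \<in> T. (p, q) \<in> R}" for p
  have cls_le: "card (cls p) \<le> 3" if p: "p \<in> T" for p
  proof (rule ccontr)
    assume big: "\<not> card (cls p) \<le> 3"
    have "homogeneous c T (cls p)"
      unfolding homogeneous_def
    proof (intro conjI ballI)
      fix w assume w: "w \<in> T - cls p"
      hence "(p, w) \<notin> R" by (auto simp: cls_def)
      thus "\<exists>s. \<forall>t\<in>cls p. c w t = s" using R_hom[of w p] w p by (auto simp: cls_def intro!: exI[of _ "c w p"])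
    qed (auto simp: cls_def)
    hence "card T \<le> card (cls p)" using T_min[OF homogeneous_trans[OF T(1)]] big by force
    moreover have "cls p \<subseteq> T" by (auto simp: cls_def)
    ultimately have "cls p = T" using fin_T by (meson card_seteq)
    hence "u \<in> cls p" "v \<in> cls p" using uv by auto
    thus False using uvR R_sym R_trans unfolding cls_def by blast
  qed

  \<comment> \<open>The other \<open>k - 2\<close> colors account for at most
    \<open>3 * (k - 2)\<close> outside vertices, which leaves 11 of
    \<open>3 * k + 5\<close>.\<close>
  have "(\<Sum>s<k. card (Out s)) = (\<Sum>s\<in>{..<k} - {r, b}. card (Out s)) + (\<Sum>s\<in>{r, b}. card (Out s))"
    using rb by (intro sum.subset_diff) auto
  also have "(\<Sum>s\<in>{..<k} - {r, b}. card (Out s)) \<le> (\<Sum>s\<in>{..<k} - {r, b}. 3)"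
    by (rule sum_mono) (rule card_Out)
  also have "(\<Sum>s\<in>{..<k} - {r, b}. 3) = 3 * (k - 2)"
    using rb by (simp add: card_Diff_subset)
  finally have card_W: "card T + card (Out r) + card (Out b) \<ge> 11"
    using sum_Out card_V k rb(1) by simp

  \<comment> \<open>Six vertices are needed to repair red cycles below. If \<open>T\<close> had
    five, \<open>Out r\<close> and \<open>Out b\<close> would have three each. By
    \<open>mono_c8_path3\<close>, a vertex would see at most one vertex outside its class in each of
    the two colors, so its class would have at least three vertices. Two such classes do not fit
    into \<open>T\<close>.\<close>
  have card_T6: "card T \<ge> 6"
  proof (rule ccontr)
    assume "\<not> ?thesis"
    hence five: "card T = 5" "card (Out r) = 3" "card (Out b) = 3"
      using card_T card_W card_Out[of r] card_Out[of b] by linarith+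
    have mono: "y = z" if "x \<in> T" "y \<in> T" "z \<in> T" "(x, y) \<notin> R" "(x, z) \<notin> R" "c x y = c x z" for x y z
    proof (rule ccontr)
      assume "y \<noteq> z"
      have d: "x \<noteq> y" "x \<noteq> z" using that(4,5) R_refl by blast+
      have three: "card (Out (c x y)) \<ge> 3" using non_R[OF that(1,2,4)] five by auto
      have yx: "c y x = c x y" using sym TV that(1,2) by blast
      have "mono_c8 V c"
        by (rule mono_c8_path3[OF card_T three TV Out_sub Out_color, where x = x and y = y and z = z])
          (use that d \<open>y \<noteq> z\<close> yx in auto)
      thus False using no_c8 by blast
    qed
    have large: "card (cls x) \<ge> 3" if x: "x \<in> T" for x
    proof -
      have "inj_on (c x) (T - cls x)" using mono x by (auto simp: inj_on_def cls_def)
      moreover have "c x ` (T - cls x) \<subseteq> {r, b}" using non_R x by (auto simp: cls_def)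
      ultimately have "card (T - cls x) \<le> 2"
        using rb(1) by (metis card_2_iff card_inj_on_le finite.emptyI finite.insertI)
      moreover have "card (T - cls x) = card T - card (cls x)"
        using fin_T by (intro card_Diff_subset) (auto simp: cls_def)
      ultimately show ?thesis using five by linarith
    qed
    have "cls u \<inter> cls v = {}" using uvR R_sym R_trans unfolding cls_def by blast
    hence "card (cls u) + card (cls v) = card (cls u \<union> cls v)"
      using fin_T by (subst card_Un_disjoint) (auto simp: cls_def)
    also have "\<dots> \<le> card T" using fin_T by (intro card_mono) (auto simp: cls_def)
    finally show False using large[OF uv(1)] large[OF uv(2)] five by linarith
  qed

  define W where "W = T \<union> Out r \<union> Out b"
  have disj: "T \<inter> Out r = {}" "T \<inter> Out b = {}" "Out r \<inter> Out b = {}"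
    using Out_sub Out_disj rb(1) by auto
  have WV: "W \<subseteq> V" using TV Out_sub unfolding W_def by auto
  have "card W \<ge> 11"
    using card_W disj fin_T fin_Out unfolding W_def by (simp add: card_Un_disjoint Int_Un_distrib2)
  text \<open>
    On \<open>W\<close>, the vertices outside \<open>T\<close> are treated as twins, and the pairs between \<open>Out r\<close> and \<open>Out b\<close>,
    whose actual color is unknown, count as red.\<close>
  define val where "val x y =
    (if x \<in> T \<and> y \<in> T then if (x, y) \<in> R then Unc else if c x y = r then Red else Blue
     else if {x, y} \<subseteq> Out r \<or> {x, y} \<subseteq> Out b then Unc
     else if {x, y} \<subseteq> T \<union> Out b then Blue else Red)" for x y
  have notin: "x \<in> Out s \<Longrightarrow> x \<notin> T" "x \<in> Out r \<Longrightarrow> x \<notin> Out b" "x \<in> Out b \<Longrightarrow> x \<notin> Out r" for x s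
    using Out_sub disj by blast+
  have val_TT: "val x y = (if (x, y) \<in> R then Unc else if c x y = r then Red else Blue)"
    if "x \<in> T" "y \<in> T" for x y using that by (simp add: val_def)
  have val_Tr: "val x y = Red" "val y x = Red" if "x \<in> T" "y \<in> Out r" for x y
    using that notin(1)[OF that(2)] notin(1)[of x r] notin(1)[of x b] notin(2)[OF that(2)]
    by (auto simp: val_def)
  have val_Tb: "val x y = Blue" "val y x = Blue" if "x \<in> T" "y \<in> Out b" for x y
    using that notin(1)[OF that(2)] notin(1)[of x r] notin(1)[of x b] by (auto simp: val_def)
  have val_out: "val x y = Unc" if "x \<in> Out r \<and> y \<in> Out r \<or> x \<in> Out b \<and> y \<in> Out b" for x y
    using that notin(1)[of x] by (auto simp: val_def)
  have val_rb: "val x y = Red" "val y x = Red" if "x \<in> Out r" "y \<in> Out b" for x y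
    using that notin(1)[OF that(1)] notin(1)[OF that(2)] notin(2)[OF that(1)] notin(3)[OF that(2)]
    by (simp_all add: val_def)
  note val = val_TT val_Tr val_Tb val_out val_rb
  have W_cases: thesis
    if "x \<in> W" "x \<in> T \<Longrightarrow> thesis" "x \<in> Out r \<Longrightarrow> thesis" "x \<in> Out b \<Longrightarrow> thesis" for x thesis
    using that unfolding W_def by blast
  have val_sym: "val x y = val y x" if "x \<in> W" "y \<in> W" for x y
  proof -
    have "(x, y) \<in> R \<longleftrightarrow> (y, x) \<in> R" using R_sym by blast
    moreover have "c x y = c y x" using sym that WV by blast
    ultimately show ?thesis
      by (rule_tac W_cases[OF that(1)]; rule_tac W_cases[OF that(2)]) (simp_all add: val)
  qed
  have val_Unc: "x \<in> T \<and> y \<in> cls x \<or> x \<in> Out r \<and> y \<in> Out r \<or> x \<in> Out b \<and> y \<in> Out b"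
    if "val x y = Unc" "x \<in> W" "y \<in> W" for x y
    using that(1) by (rule_tac W_cases[OF that(2)]; rule_tac W_cases[OF that(3)])
      (auto simp: val cls_def split: if_splits)
  have "\<exists>s w. s \<noteq> Unc \<and> distinct w \<and> length w = 8 \<and> set w \<subseteq> W \<and>
    successively (\<lambda>a b. val a b = s) (w @ [hd w])"
  proof (rule twin_ramsey[OF \<open>card W \<ge> 11\<close> val_sym])
    fix x y z assume W: "x \<in> W" "y \<in> W" "z \<in> W" and "val x y = Unc"
    from val_Unc[OF this(4) W(1,2)] show "val x z = val y z"
    proof (elim disjE conjE)
      assume x: "x \<in> T" "y \<in> cls x"
      hence y: "y \<in> T" "(x, y) \<in> R" by (auto simp: cls_def)
      have R: "(x, z) \<in> R \<longleftrightarrow> (y, z) \<in> R" using y R_sym R_trans by blast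
      have c: "c x z = c y z" if "z \<in> T" "(x, z) \<notin> R"
        using R_hom[OF that(1) x(1) that(2) y(2)] sym[of x z] sym[of y z] that(1) x(1) y(1) subsetD[OF TV] by metis
      show ?thesis using R c x(1) y(1) by (rule_tac W_cases[OF W(3)]) (auto simp: val)
    next
      assume "x \<in> Out r" "y \<in> Out r"
      thus ?thesis by (rule_tac W_cases[OF W(3)]) (simp_all add: val)
    next
      assume "x \<in> Out b" "y \<in> Out b"
      thus ?thesis by (rule_tac W_cases[OF W(3)]) (simp_all add: val)
    qed
  next
    fix x y p q
    assume W: "{x, y, p, q} \<subseteq> W" and d: "distinct [x, y, p, q]" and U: "val x y = Unc" "val x p = Unc"
    show "val x q \<noteq> Unc"
    proof
      assume "val x q = Unc"
      note un = val_Unc[OF U(1)] val_Unc[OF U(2)] val_Unc[OF this]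
      have small: False if "{x, y, p, q} \<subseteq> A" "finite A" "card A \<le> 3" for A
        using card_mono[OF that(2,1)] that(3) d by simp
      show False
      proof (rule W_cases[of x])
        assume "x \<in> T"
        thus False
          using un W small[of "cls x"] fin_T cls_le[of x] notin(1)[of x] R_refl by (auto simp: cls_def)
      next
        assume "x \<in> Out r"
        thus False
          using un W small[of "Out r"] fin_Out card_Out[of r] notin(1,2)[of x] by auto
      next
        assume "x \<in> Out b"
        thus False
          using un W small[of "Out b"] fin_Out card_Out[of b] notin(1,3)[of x] by auto
      qed (use W in auto)
    qed
  qed
  then obtain s w where w: "s \<noteq> Unc" "distinct w" "length w = 8" "set w \<subseteq> W"
    "successively (\<lambda>a b. val a b = s) (w @ [hd w])" by blast
  have w_in: "set (w @ [hd w]) \<subseteq> W" using w(3,4) by (cases w) auto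
  have edge_T: "c x y = r \<or> c x y = b" if "x \<in> T" "y \<in> T" "val x y \<noteq> Unc" for x y
    using non_R that val_TT by metis
  show False
  proof (cases s)
    case Unc
    thus False using w by simp
  next
    case Blue
    \<comment> \<open>Blue needs no repair: the pairs with an unknown color were all declared
      red.\<close>
    have "c x y = b" if "x \<in> W" "y \<in> W" "val x y = Blue" for x y
      using that(3) edge_T[of x y] Out_color[of x y b] Out_color[of y x b]
      by (rule_tac W_cases[OF that(1)]; rule_tac W_cases[OF that(2)])
        (auto simp: val split: if_splits)
    hence "successively (\<lambda>x y. c x y = b) (w @ [hd w])"
      using w_in Blue by (intro successively_mono[OF w(5)]) blast
    thus False using no_c8 mono_c8I[of w V c b] w WV by blast
  next
    case Red
    text \<open>
      In a red cycle of \<open>val\<close>, both neighbors of a vertex of \<open>Out b\<close> lie in \<open>Out r\<close>, so that it can be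
      replaced by an unused vertex of \<open>T\<close>.\<close>
    define J where "J = set w \<inter> Out b"
    have J: "x \<in> J \<longleftrightarrow> x \<in> Out b" if "x \<in> set w" for x using that by (simp add: J_def)
    have red_b: "y \<in> Out r" if "x \<in> Out b" "y \<in> W" "val x y = Red \<or> val y x = Red" for x y
      using that(1,3) by (rule_tac W_cases[OF that(2)]) (auto simp: val)
    have red: "c x y = r" if "x \<in> W" "y \<in> W" "val x y = Red" "x \<notin> Out b" "y \<notin> Out b" for x y
      using that(3-) edge_T[of x y] Out_color[of x y r] Out_color[of y x r]
      by (rule_tac W_cases[OF that(1)]; rule_tac W_cases[OF that(2)])
        (auto simp: val split: if_splits)
    have "card J \<le> card (T - set w)"
    proof (cases "J = {}")
      case False
      then obtain x where x: "x \<in> set w" "x \<in> Out b" by (auto simp: J_def)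
      obtain y z where yz: "y \<in> set w" "z \<in> set w" "val y x = Red" "val x z = Red" "y \<noteq> z"
        using cycle_neighbours[OF w(5,3,2) x(1)] Red by auto
      have "{y, z} \<subseteq> set w \<inter> Out r" using yz red_b[OF x(2)] w(4) by blast
      from card_mono[OF _ this] have "card (set w \<inter> Out r) \<ge> 2" using yz(5) by simp
      moreover have "8 = card (set w \<inter> T) + card (set w \<inter> Out r) + card J"
      proof -
        have "set w = (set w \<inter> T) \<union> (set w \<inter> Out r) \<union> J" using w(4) unfolding J_def W_def by blast
        moreover have "card ((set w \<inter> T) \<union> (set w \<inter> Out r) \<union> J) =
          card ((set w \<inter> T) \<union> (set w \<inter> Out r)) + card J"
          using disj unfolding J_def by (intro card_Un_disjoint) auto
        moreover have "card ((set w \<inter> T) \<union> (set w \<inter> Out r)) = card (set w \<inter> T) + card (set w \<inter> Out r)"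
          using disj by (intro card_Un_disjoint) auto
        ultimately show ?thesis using distinct_card[OF w(2)] w(3) by simp
      qed
      moreover have "card (T - set w) = card T - card (set w \<inter> T)"
        using fin_T by (simp add: card_Diff_subset_Int Int_commute)
      ultimately show ?thesis using card_T6 by linarith
    qed simp
    then obtain h where h: "h ` J \<subseteq> T - set w" "inj_on h J"
      using card_le_inj[of J "T - set w"] fin_T unfolding J_def by auto
    define f where "f x = (if x \<in> J then h x else x)" for x
    have f_inj: "inj_on f (set w)"
    proof (rule inj_onI)
      fix x y assume "x \<in> set w" "y \<in> set w" "f x = f y"
      thus "x = y" using h inj_onD[OF h(2), of x y] unfolding f_def by (auto split: if_splits)
    qed
    have f_J: "f x \<in> T" if "x \<in> J" for x using h(1) that by (auto simp: f_def)
    have f_id: "f x = x" if "x \<notin> J" for x using that by (simp add: f_def)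
    \<comment> \<open>A red edge of the cycle has at most one replaced end. Its other end is then in
      \<open>Out r\<close> and sees every vertex of \<open>T\<close> in color
      \<open>r\<close>.\<close>
    have f_edge: "c (f x) (f y) = r" if xy: "x \<in> set w" "y \<in> set w" "val x y = Red" for x y
    proof -
      have W: "x \<in> W" "y \<in> W" using xy w(4) by auto
      consider "x \<in> J" | "y \<in> J" | "x \<notin> J" "y \<notin> J" by blast
      thus ?thesis
      proof cases
        case 1
        hence "y \<in> Out r" using red_b[of x y] J[OF xy(1)] W xy(3) by blast
        moreover from this have "y \<notin> J" using J[OF xy(2)] notin by blast
        ultimately show ?thesis using Out_color f_J[OF 1] f_id by metis
      next
        case 2
        hence "x \<in> Out r" using red_b[of y x] J[OF xy(2)] W xy(3) by blast
        moreover from this have "x \<notin> J" using J[OF xy(1)] notin by blast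
        ultimately show ?thesis using Out_color f_J[OF 2] f_id by metis
      next
        case 3
        thus ?thesis using red[OF W xy(3)] J xy f_id by metis
      qed
    qed
    have "successively (\<lambda>x y. c (f x) (f y) = r) (w @ [hd w])"
    proof (rule successively_mono[OF w(5)])
      fix x y assume "x \<in> set (w @ [hd w])" "y \<in> set (w @ [hd w])" "val x y = s"
      moreover have "set (w @ [hd w]) = set w" using w(3) by (cases w) auto
      ultimately show "c (f x) (f y) = r" using f_edge[of x y] Red by metis
    qed
    hence "successively (\<lambda>x y. c x y = r) (map f (w @ [hd w]))"
      by (simp only: successively_map)
    moreover have "map f (w @ [hd w]) = map f w @ [hd (map f w)]"
      using w(3) by (cases w) auto
    moreover have "f x \<in> V" if "x \<in> set w" for x
      using that f_J f_id w(4) WV TV by (metis subsetD)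
    hence "set (map f w) \<subseteq> V" by auto
    moreover have "distinct (map f w)" using w(2) f_inj by (simp add: distinct_map)
    ultimately show False
      using no_c8 mono_c8I[of "map f w" V c r] w(3) by simp
  qed
qed

section \<open>Copies of the triangle and of the 8-cycle\<close>

lemma less_8_iff: "i < (8::nat) \<longleftrightarrow> i \<in> {0, 1, 2, 3, 4, 5, 6, 7}"
  by auto

lemma triangle_edges_eq: "triangle_edges = {{0, 1}, {1, 2}, {0, 2}}"
proof -
  have "e \<in> {{0, 1}, {1, 2}, {0, 2}}" if sub: "e \<subseteq> {..<3}" and two: "card e = 2" for e :: "nat set"
  proof -
    obtain x y where e: "e = {x, y}" "x < y"
      using two unfolding card_2_iff by (metis insert_commute linorder_neqE_nat)
    hence "x = 0 \<and> y = 1 \<or> x = 1 \<and> y = 2 \<or> x = 0 \<and> y = 2" using sub by auto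
    thus ?thesis using e(1) by blast
  qed
  hence "triangle_edges \<subseteq> {{0, 1}, {1, 2}, {0, 2}}"
    unfolding triangle_edges_def K_edges_def by blast
  moreover have "{0, 1} \<in> K_edges 3" "{1, 2} \<in> K_edges 3" "{0, 2} \<in> K_edges 3"
    by (simp_all add: K_edges_def)
  ultimately show ?thesis unfolding triangle_edges_def by blast
qed

lemma rainbow_copy_triangle:
  "rainbow_copy n c 3 triangle_edges \<longleftrightarrow>
    (\<exists>x<n. \<exists>y<n. \<exists>z<n. distinct [x, y, z] \<and> distinct [c {x, y}, c {y, z}, c {x, z}])"
  (is "_ \<longleftrightarrow> ?R")
proof
  assume "rainbow_copy n c 3 triangle_edges"
  then obtain f :: "nat \<Rightarrow> nat" where f: "inj_on f {..<3}" "f ` {..<3} \<subseteq> {..<n}"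
    "inj_on (\<lambda>e. c (f ` e)) {{0, 1}, {1, 2}, {0, 2}}"
    unfolding rainbow_copy_def triangle_edges_eq by blast
  have d: "{0, 1} \<noteq> {1, 2::nat}" "{1, 2} \<noteq> {0, 2::nat}" "{0, 1} \<noteq> {0, 2::nat}"
    by (simp_all add: doubleton_eq_iff)
  have "distinct [f 0, f 1, f 2]" by (simp add: inj_on_eq_iff[OF f(1)])
  moreover have "distinct [c {f 0, f 1}, c {f 1, f 2}, c {f 0, f 2}]"
    using inj_on_eq_iff[OF f(3), of "{0, 1}" "{1, 2}"] inj_on_eq_iff[OF f(3), of "{1, 2}" "{0, 2}"]
      inj_on_eq_iff[OF f(3), of "{0, 1}" "{0, 2}"] d by simp
  moreover have "f 0 < n" "f 1 < n" "f 2 < n" using f(2) by (simp_all add: image_subset_iff)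
  ultimately show ?R by blast
next
  assume ?R
  then obtain x y z where *: "x < n" "y < n" "z < n" "distinct [x, y, z]"
    "distinct [c {x, y}, c {y, z}, c {x, z}]" by blast
  define f where "f = nth [x, y, z]"
  have eq: "{..<3::nat} = {0, 1, 2}" by auto
  have f: "f 0 = x" "f 1 = y" "f 2 = z" by (simp_all add: f_def)
  have "inj_on f {..<3}" "f ` {..<3} \<subseteq> {..<n}"
    using *(1-4) f unfolding eq by (simp_all add: inj_on_insert)
  moreover have "inj_on (\<lambda>e. c (f ` e)) {{0, 1}, {1, 2}, {0, 2}}"
    using *(5) f unfolding inj_on_def by (simp add: eq_commute)
  ultimately show "rainbow_copy n c 3 triangle_edges"
    unfolding rainbow_copy_def triangle_edges_eq by blast
qed

lemma mono_copy_c8: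
  assumes "mono_c8 {..<n} (\<lambda>x y. c {x, y})"
  shows "mono_copy n c 8 (cycle_edges 8)"
proof -
  obtain s w where w: "distinct w" "length w = 8" "set w \<subseteq> {..<n}"
    "successively (\<lambda>x y. c {x, y} = s) (w @ [hd w])"
    using assms unfolding mono_c8_def by blast
  have "c {w ! i, w ! ((i + 1) mod 8)} = s" if "i < 8" for i
    using w(2,4) that unfolding length_8_iff less_8_iff by auto
  hence "\<forall>e\<in>cycle_edges 8. c (nth w ` e) = s" unfolding cycle_edges_def by auto
  moreover have "inj_on (nth w) {..<8}" using w(1,2) by (simp add: inj_on_def nth_eq_iff_index_eq)
  moreover have "nth w ` {..<8} \<subseteq> {..<n}" using w(2,3) nth_mem by (metis image_subsetI lessThan_iff subsetD)
  ultimately show ?thesis unfolding mono_copy_def by blast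
qed

section \<open>The lower bound coloring\<close>

text \<open>Truncated subtraction gives color 0 to all pairs below 7. A color \<open>s > 0\<close>
  is used exactly when the larger end is one of \<open>3 * s + 4\<close>, \<open>3 * s + 5\<close>,
  \<open>3 * s + 6\<close>.\<close>

definition extremal :: "nat set \<Rightarrow> nat" where
  "extremal e = (Max e - 4) div 3"

lemma extremal_pair: "extremal {x, y} = (max x y - 4) div 3"
  by (simp add: extremal_def)

lemma extremal_k_coloring:
  assumes "k \<ge> 1"
  shows "k_coloring (3 * k + 4) k extremal"
  unfolding k_coloring_def K_edges_def
proof clarify
  fix e :: "nat set" assume "e \<subseteq> {..<3 * k + 4}" "card e = 2"
  then obtain x y where "e = {x, y}" "x < 3 * k + 4" "y < 3 * k + 4" by (auto simp: card_2_iff)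
  thus "extremal e < k" using assms by (auto simp: extremal_pair)
qed

text \<open>The two sides of a triangle at its largest vertex have the same color.\<close>

lemma extremal_no_rainbow: "\<not> rainbow_copy n extremal 3 triangle_edges"
  unfolding rainbow_copy_triangle extremal_pair by (auto simp: max_def)

text \<open>Color 0 lives on seven vertices. In a cycle of another color, the four disjoint edges
  from \<open>2 * i\<close> to \<open>2 * i + 1\<close> would have distinct larger ends, but only
  three values are possible.\<close>

lemma extremal_no_c8: "\<not> mono_copy n extremal 8 (cycle_edges 8)"
proof
  assume "mono_copy n extremal 8 (cycle_edges 8)"
  then obtain f s where f: "inj_on f {..<8}" "\<forall>e\<in>cycle_edges 8. extremal (f ` e) = s"
    unfolding mono_copy_def by blast
  have edge: "(max (f i) (f ((i + 1) mod 8)) - 4) div 3 = s" if "i < 8" for i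
  proof -
    have "{i, (i + 1) mod 8} \<in> cycle_edges 8" using that unfolding cycle_edges_def by blast
    from bspec[OF f(2) this] show ?thesis by (simp add: extremal_pair)
  qed
  show False
  proof (cases "s = 0")
    case True
    have "f i < 7" if "i < 8" for i using edge[OF that] True by (auto simp: max_def split: if_splits)
    hence "f ` {..<8} \<subseteq> {..<7}" by auto
    from card_mono[OF _ this] show False using f(1) by (simp add: card_image)
  next
    case False
    define g where "g i = max (f (2 * i)) (f (2 * i + 1))" for i
    have g: "g i \<in> {3 * s + 4..3 * s + 6}" if "i < 4" for i
    proof -
      have "(g i - 4) div 3 = s" using edge[of "2 * i"] that by (simp add: g_def)
      thus ?thesis using False by (simp, presburger)
    qed
    have "inj_on g {..<4}"
    proof (rule inj_onI)
      fix i j :: nat assume ij: "i \<in> {..<4}" "j \<in> {..<4}" "g i = g j"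
      obtain a b where ab: "a \<in> {2 * i, 2 * i + 1}" "b \<in> {2 * j, 2 * j + 1}" "g i = f a" "g j = f b"
        unfolding g_def by (metis insertI1 insertI2 max_def singletonI)
      have "a = b" using inj_onD[OF f(1), of a b] ab ij by auto
      thus "i = j" using ab by auto
    qed
    hence "4 = card (g ` {..<4})" by (simp add: card_image)
    also have "\<dots> \<le> card {3 * s + 4..3 * s + 6}" using g by (intro card_mono) auto
    finally show False by simp
  qed
qed

section \<open>The Gallai-Ramsey number\<close>

lemma gallai_ramsey_c8_upper:
  assumes "k \<ge> 1" "n \<ge> 3 * k + 5" "k_coloring n k c" "\<not> rainbow_copy n c 3 triangle_edges"
  shows "mono_copy n c 8 (cycle_edges 8)"
proof (rule mono_copy_c8)
  let ?c = "\<lambda>x y. c {x, y}"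
  have lt: "?c x y < k" if "x \<in> {..<n}" "y \<in> {..<n}" "x \<noteq> y" for x y
    using assms(3) that unfolding k_coloring_def K_edges_def by auto
  show "mono_c8 {..<n} ?c"
  proof (cases "k = 1")
    \<comment> \<open>With a single color, any eight vertices form the cycle, and
      \<open>3 * k + 5\<close> is exactly 8.\<close>
    case True
    have "successively (\<lambda>x y. ?c x y = 0) [0, 1, 2, 3, 4, 5, 6, 7, 0]"
      using lt assms(2) True by simp
    thus ?thesis using assms(2) True by (intro mono_c8I[of "[0, 1, 2, 3, 4, 5, 6, 7]" _ _ 0]) auto
  next
    case False
    have "gallai {..<n} ?c"
      using assms(4) unfolding gallai_def rainbow_copy_triangle by (auto simp: insert_commute)
    thus ?thesis using gallai_mono_c8[of "{..<n}" ?c k] lt assms(1,2) False by auto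
  qed
qed

theorem theorem8:
  fixes k :: nat
  assumes "k \<ge> 1"
  shows "gallai_ramsey k 3 triangle_edges 8 (cycle_edges 8) = 3 * k + 5"
  unfolding gallai_ramsey_def
proof (rule Least_equality)
  show "\<forall>n\<ge>3 * k + 5. \<forall>c. k_coloring n k c \<longrightarrow>
      rainbow_copy n c 3 triangle_edges \<or> mono_copy n c 8 (cycle_edges 8)"
    using gallai_ramsey_c8_upper assms by blast
next
  fix N
  assume N: "\<forall>n\<ge>N. \<forall>c. k_coloring n k c \<longrightarrow>
    rainbow_copy n c 3 triangle_edges \<or> mono_copy n c 8 (cycle_edges 8)"
  show "3 * k + 5 \<le> N"
  proof (rule ccontr)
    assume "\<not> 3 * k + 5 \<le> N"
    hence "N \<le> 3 * k + 4" by simp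
    \<comment> \<open>A valid \<open>N\<close> covers all larger orders as well, so one bad coloring
      of \<open>3 * k + 4\<close> vertices excludes every smaller \<open>N\<close> too.\<close>
    thus False using N extremal_k_coloring[OF assms] extremal_no_rainbow extremal_no_c8 by blast
  qed
qed

end
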